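(* Suppose that $f : \mathbb{X}_{d,0} \to \mathbb{R}$ is an upper semi-continuous intrinsic function with the following property: if $\Omega \in \mathbb{X}_d$ and $f(\Omega,x) \geq f(\mathcal{B},0)$ for all $x \in \Omega$, then $\Omega$ is biholomorphic to $\mathcal{B}$. Then there exists some $\epsilon = \epsilon(d,f) > 0$ such that: if $\Omega \subset \mathbb{C}^d$ is a bounded convex domain with $C^\infty$ boundary and $$f(\Omega,z) \geq f(\mathcal{B},0) - \epsilon$$ for all $z$ outside some compact subset of $\Omega$, then $\Omega$ is strongly pseudoconvex.
   Context: $\mathcal{B} \subset \mathbb{C}^d$ is the unit ball. $\mathbb{X}_d$ is the set of convex domains in $\mathbb{C}^d$ which do not contain a complex affine line, and $\mathbb{X}_{d,0}$ is the set of pairs $(\Omega,x)$ with $\Omega \in \mathbb{X}_d$, $x \in \Omega$. A function $f : \mathbb{X}_{d,0} \to \mathbb{R}$ is intrinsic if $f(\Omega_1,p_1) = f(\Omega_2,p_2)$ whenever there is a biholomorphism $\varphi : \Omega_1 \to \Omega_2$ with $\varphi(p_1) = p_2$. Topology: for compact sets, $d_H$ is the Hausdorff distance (for the Euclidean distance); for $R>0$ and closed $A, B$, let $d_H^{(R)}(A,B) = d_H(A \cap B_R(0), B \cap B_R(0))$, with $B_R(0)$ the closed Euclidean ball. Open convex sets $\Omega_n$ converge to an open convex set $\Omega$ in the local Hausdorff topology if there is $R_0 \geq 0$ with $\lim_{n\to\infty} d_H^{(R)}(\overline{\Omega}_n, \overline{\Omega}) = 0$ for all $R \geq R_0$. $\mathbb{X}_d$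 carries the local Hausdorff topology; $(\Omega_n,x_n) \to (\Omega,x)$ in $\mathbb{X}_{d,0}$ means $\Omega_n \to \Omega$ in the local Hausdorff topology and $x_n \to x$. *)

theory Defs
  imports "HOL-Analysis.Analysis"
begin

text \<open>
  Complex Euclidean space of dimension \<open>d \<ge> 1\<close> is \<open>complex ^ 'd\<close>, whose norm is the Euclidean one.
\<close>

definition convex_domain :: "(complex ^ 'd) set \<Rightarrow> bool" where
  "convex_domain \<Omega> \<longleftrightarrow> open \<Omega> \<and> \<Omega> \<noteq> {} \<and> convex \<Omega>"

definition contains_complex_line :: "(complex ^ 'd) set \<Rightarrow> bool" where
  "contains_complex_line \<Omega> \<longleftrightarrow> (\<exists>a v. v \<noteq> 0 \<and> (\<forall>\<zeta>::complex. a + \<zeta> *s v \<in> \<Omega>))"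

definition XX :: "(complex ^ 'd) set set" where
  "XX = {\<Omega>. convex_domain \<Omega> \<and> \<not> contains_complex_line \<Omega>}"

definition XX0 :: "((complex ^ 'd) set \<times> (complex ^ 'd)) set" where
  "XX0 = {(\<Omega>, x). \<Omega> \<in> XX \<and> x \<in> \<Omega>}"


section \<open>Biholomorphisms\<close>

definition holomorphic_map_on :: "(complex ^ 'm \<Rightarrow> complex ^ 'n) \<Rightarrow> (complex ^ 'm) set \<Rightarrow> bool" where
  "holomorphic_map_on \<phi> U \<longleftrightarrow>
     (\<forall>z\<in>U. \<exists>A :: complex ^ 'm ^ 'n. (\<phi> has_derivative (\<lambda>v. A *v v)) (at z))"

definition biholomorphism ::
  "(complex ^ 'm \<Rightarrow> complex ^ 'n) \<Rightarrow> (complex ^ 'm) set \<Rightarrow> (complex ^ 'n) set \<Rightarrow> bool" where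
  "biholomorphism \<phi> U V \<longleftrightarrow>
     bij_betw \<phi> U V \<and> holomorphic_map_on \<phi> U \<and> holomorphic_map_on (the_inv_into U \<phi>) V"

definition biholomorphic :: "(complex ^ 'm) set \<Rightarrow> (complex ^ 'n) set \<Rightarrow> bool" where
  "biholomorphic U V \<longleftrightarrow> (\<exists>\<phi>. biholomorphism \<phi> U V)"

text \<open>Only the values of \<open>f\<close> on \<^const>\<open>XX0\<close> matter, here and below.\<close>

definition intrinsic :: "((complex ^ 'd) set \<times> (complex ^ 'd) \<Rightarrow> real) \<Rightarrow> bool" where
  "intrinsic f \<longleftrightarrow>
     (\<forall>\<Omega>1 p1 \<Omega>2 p2. (\<Omega>1, p1) \<in> XX0 \<and> (\<Omega>2, p2) \<in> XX0 \<and>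
        (\<exists>\<phi>. biholomorphism \<phi> \<Omega>1 \<Omega>2 \<and> \<phi> p1 = p2) \<longrightarrow> f (\<Omega>1, p1) = f (\<Omega>2, p2))"


section \<open>The local Hausdorff topology\<close>

text \<open>
  The distance takes values in \<^typ>\<open>ennreal\<close>, so that \<open>hausdorff_distance {} B = \<infinity>\<close> for \<open>B \<noteq> {}\<close>
  while \<open>hausdorff_distance {} {} = 0\<close>.
\<close>

definition hausdorff_distance :: "'a::metric_space set \<Rightarrow> 'a set \<Rightarrow> ennreal" where
  "hausdorff_distance A B =
     max (SUP a\<in>A. INF b\<in>B. ennreal (dist a b)) (SUP b\<in>B. INF a\<in>A. ennreal (dist a b))"

definition hausdorff_distance_upto :: "real \<Rightarrow> 'a::real_normed_vector set \<Rightarrow> 'a set \<Rightarrow> ennreal" where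
  "hausdorff_distance_upto R A B = hausdorff_distance (A \<inter> cball 0 R) (B \<inter> cball 0 R)"

definition local_hausdorff_tendsto ::
  "(nat \<Rightarrow> 'a::real_normed_vector set) \<Rightarrow> 'a set \<Rightarrow> bool" where
  "local_hausdorff_tendsto \<Omega>s \<Omega> \<longleftrightarrow>
     (\<exists>R0\<ge>0. \<forall>R\<ge>R0.
        (\<lambda>n. hausdorff_distance_upto R (closure (\<Omega>s n)) (closure \<Omega>)) \<longlonglongrightarrow> 0)"

definition XX0_tendsto ::
  "(nat \<Rightarrow> (complex ^ 'd) set \<times> (complex ^ 'd)) \<Rightarrow> (complex ^ 'd) set \<times> (complex ^ 'd) \<Rightarrow> bool" where
  "XX0_tendsto S P \<longleftrightarrow>
     local_hausdorff_tendsto (\<lambda>n. fst (S n)) (fst P) \<and> (\<lambda>n. snd (S n)) \<longlonglongrightarrow> snd P"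

text \<open>
  The topology on \<^const>\<open>XX0\<close> is given by its convergent sequences, so upper semi-continuity is
  stated with sequences.
\<close>

definition upper_semicontinuous_XX0 :: "((complex ^ 'd) set \<times> (complex ^ 'd) \<Rightarrow> real) \<Rightarrow> bool" where
  "upper_semicontinuous_XX0 f \<longleftrightarrow>
     (\<forall>S P. range S \<subseteq> XX0 \<and> P \<in> XX0 \<and> XX0_tendsto S P \<longrightarrow>
        limsup (\<lambda>n. ereal (f (S n))) \<le> ereal (f P))"


section \<open>Smooth boundary and strong pseudoconvexity\<close>

text \<open>
  \<open>C_k_on k f U\<close>: \<open>f\<close> is of class \<open>C\<^sup>k\<close> on the open set \<open>U\<close>.  In finite dimension the derivative is
  of class \<open>C\<^sup>k\<close> iff its values on all fixed vectors \<open>v\<close> are.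
\<close>

primrec C_k_on :: "nat \<Rightarrow> ('a::euclidean_space \<Rightarrow> real) \<Rightarrow> 'a set \<Rightarrow> bool" where
  "C_k_on 0 f U \<longleftrightarrow> continuous_on U f"
| "C_k_on (Suc k) f U \<longleftrightarrow>
     (\<forall>x\<in>U. f differentiable (at x)) \<and> (\<forall>v. C_k_on k (\<lambda>x. frechet_derivative f (at x) v) U)"

definition C_infinity_on :: "('a::euclidean_space \<Rightarrow> real) \<Rightarrow> 'a set \<Rightarrow> bool" where
  "C_infinity_on f U \<longleftrightarrow> (\<forall>k. C_k_on k f U)"

definition local_defining_function ::
  "('a::euclidean_space) set \<Rightarrow> 'a \<Rightarrow> 'a set \<Rightarrow> ('a \<Rightarrow> real) \<Rightarrow> bool" where
  "local_defining_function \<Omega> p U r \<longleftrightarrow>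
     open U \<and> p \<in> U \<and> C_k_on 1 r U \<and> \<Omega> \<inter> U = {z \<in> U. r z < 0} \<and>
     (\<forall>z\<in>U. frechet_derivative r (at z) \<noteq> (\<lambda>v. 0))"

definition smooth_boundary :: "('a::euclidean_space) set \<Rightarrow> bool" where
  "smooth_boundary \<Omega> \<longleftrightarrow>
     (\<forall>p\<in>frontier \<Omega>. \<exists>U r. local_defining_function \<Omega> p U r \<and> C_infinity_on r U)"

text \<open>The Wirtinger derivatives with respect to \<open>z\<^sub>j\<close> and to the conjugate of \<open>z\<^sub>j\<close>.\<close>

definition deriv_z :: "'d \<Rightarrow> (complex ^ 'd \<Rightarrow> complex) \<Rightarrow> complex ^ 'd \<Rightarrow> complex" where
  "deriv_z j g p =
     (frechet_derivative g (at p) (axis j 1) - \<i> * frechet_derivative g (at p) (axis j \<i>)) / 2"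

definition deriv_zbar :: "'d \<Rightarrow> (complex ^ 'd \<Rightarrow> complex) \<Rightarrow> complex ^ 'd \<Rightarrow> complex" where
  "deriv_zbar j g p =
     (frechet_derivative g (at p) (axis j 1) + \<i> * frechet_derivative g (at p) (axis j \<i>)) / 2"

definition complex_tangent_space :: "(complex ^ 'd \<Rightarrow> real) \<Rightarrow> complex ^ 'd \<Rightarrow> (complex ^ 'd) set" where
  "complex_tangent_space r p = {v. (\<Sum>j\<in>UNIV. deriv_z j (\<lambda>z. of_real (r z)) p * v $ j) = 0}"

definition levi_form :: "(complex ^ 'd \<Rightarrow> real) \<Rightarrow> complex ^ 'd \<Rightarrow> complex ^ 'd \<Rightarrow> complex" where
  "levi_form r p v =
     (\<Sum>j\<in>UNIV. \<Sum>k\<in>UNIV.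
        deriv_zbar k (deriv_z j (\<lambda>z. of_real (r z))) p * v $ j * cnj (v $ k))"

text \<open>
  The Levi form of a \<open>C\<^sup>2\<close> function is real, and its positivity on the complex tangent space at \<open>p\<close>
  is the same for every local defining function at \<open>p\<close>.
\<close>

definition strongly_pseudoconvex :: "(complex ^ 'd) set \<Rightarrow> bool" where
  "strongly_pseudoconvex \<Omega> \<longleftrightarrow>
     (\<forall>p\<in>frontier \<Omega>. \<exists>U r. local_defining_function \<Omega> p U r \<and> C_k_on 2 r U \<and>
        (\<forall>v\<in>complex_tangent_space r p. v \<noteq> 0 \<longrightarrow> 0 < Re (levi_form r p v)))"

end

theory Submission
  imports Defs "HOL-Complex_Analysis.Great_Picard"
begin

text \<open>
  Suppose there is no such \<open>\<epsilon>\<close>. Then there are domains \<open>\<Omega>\<^sub>k\<close> satisfying the hypothesis with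
  \<open>\<epsilon> = 1/k\<close> and boundary points \<open>\<xi>\<^sub>k\<close> where the Levi form degenerates in a direction \<open>v\<^sub>k\<close>. By
  convexity the whole second fundamental form vanishes on the complex line of \<open>v\<^sub>k\<close>, so at height
  \<open>t\<close> above \<open>\<xi>\<^sub>k\<close> the domain contains a disc in direction \<open>v\<^sub>k\<close> of radius \<open>g\<^sub>k(t)\<close>, where
  \<open>g\<^sub>k(t) \<ge> c t powr (1/3)\<close>. Hence arbitrarily small heights \<open>t\<^sub>k\<close> satisfy \<open>g\<^sub>k(s t\<^sub>k) \<ge> s powr (2/5) g\<^sub>k(t\<^sub>k) / 2\<close> for all \<open>s \<le> 1\<close>.
  Rescaling affinely at these heights (with an Auerbach basis of the largest balanced subset) and
  passing to a limit gives \<open>D\<close> in \<open>XX\<close>. Points of \<open>D\<close> are limits of points leaving every compact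
  subset of the \<open>\<Omega>\<^sub>k\<close>, so semicontinuity gives \<open>f(D, \<cdot>) \<ge> f(B, 0)\<close> and there is a biholomorphism \<open>F\<close>
  from \<open>D\<close> to the ball \<open>B\<close>.

  But \<open>D\<close> lies in a half-space and contains a complex half-plane \<open>{(\<zeta> - 1) N | Re \<zeta> > 0}\<close> properly
  embedded in it, with discs of radius at least a multiple of \<open>Re \<zeta> powr (2/5)\<close> in direction \<open>V\<close>. The
  derivative of \<open>F\<close> along \<open>V\<close> at \<open>(\<zeta> - 1) N\<close> is holomorphic in \<open>\<zeta>\<close>; as \<open>F\<close> maps this point
  to within a multiple of \<open>Re \<zeta>\<close> of the sphere, where a disc in the ball has derivative at most a
  multiple of the square root of the distance to the sphere, that derivative is of order
  \<open>Re \<zeta> powr (1/2 - 2/5)\<close>. So it vanishes on the imaginary axis, hence identically, which is absurd.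
\<close>

section \<open>Holomorphic discs in the ball\<close>

text \<open>The Cayley transform \<open>Q\<close> carries the right half-plane to the unit disc and
  \<open>H 0\<close> to 0, so the Schwarz lemma applies to it. Its derivative bound gives the first
  claim and its growth bound the second, a Harnack inequality with a crude constant.\<close>

lemma right_half_plane_Schwarz:
  assumes hol: "H holomorphic_on ball 0 1"
    and pos: "\<And>\<tau>. norm \<tau> < 1 \<Longrightarrow> 0 < Re (H \<tau>)"
  shows "norm (deriv H 0) \<le> 2 * Re (H 0)"
    and "norm \<tau> < 1 \<Longrightarrow> (1 - (norm \<tau>)\<^sup>2) / 4 * Re (H 0) \<le> Re (H \<tau>)"
proof -
  define c where "c = H 0"
  have c: "Re c > 0" using pos[of 0] by (simp add: c_def)
  \<comment> \<open>This identity shows that the Cayley transform has modulus below 1, and later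
    turns the bound on its modulus back into a bound on \<open>Re (H \<tau>)\<close>.\<close>
  have sq: "(norm (w + cnj c))\<^sup>2 - (norm (w - c))\<^sup>2 = 4 * Re w * Re c" for w
    unfolding cmod_power2 by (simp add: power2_eq_square algebra_simps)
  have nz: "H \<tau> + cnj c \<noteq> 0" if "norm \<tau> < 1" for \<tau>
  proof -
    have "Re (H \<tau> + cnj c) > 0" using pos[OF that] c by simp
    then show ?thesis by (metis less_irrefl zero_complex.sel(1))
  qed
  define Q where "Q = (\<lambda>\<tau>. (H \<tau> - c) / (H \<tau> + cnj c))"
  have holQ: "Q holomorphic_on ball 0 1"
    unfolding Q_def by (intro holomorphic_intros hol) (use nz in auto)
  have Q0: "Q 0 = 0" by (simp add: Q_def c_def)
  have Q1: "norm (Q \<tau>) < 1" if "norm \<tau> < 1" for \<tau>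
  proof -
    have "(norm (H \<tau> - c))\<^sup>2 < (norm (H \<tau> + cnj c))\<^sup>2"
      using sq[of "H \<tau>"] mult_pos_pos[OF pos[OF that] c] by simp
    then have "norm (H \<tau> - c) < norm (H \<tau> + cnj c)"
      by (simp add: power2_less_imp_less)
    then show ?thesis using nz[OF that] by (simp add: Q_def norm_divide)
  qed
  note S = Schwarz_Lemma[OF holQ Q0 Q1]
  have dH: "(H has_field_derivative deriv H 0) (at 0)"
    using hol by (simp add: holomorphic_derivI)
  have "(Q has_field_derivative
      ((deriv H 0 * (H 0 + cnj c) - (H 0 - c) * deriv H 0) / ((H 0 + cnj c) * (H 0 + cnj c)))) (at 0)"
    unfolding Q_def
    by (rule derivative_eq_intros dH refl nz | simp add: nz)+
  then have "deriv Q 0 = deriv H 0 / (c + cnj c)"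
    using nz[of 0] by (simp add: DERIV_imp_deriv c_def)
  moreover have "norm (c + cnj c) = 2 * Re c"
    using c by (simp add: complex_add_cnj)
  moreover have "norm (deriv Q 0) \<le> 1" using S(2)[of 0] by simp
  ultimately show "norm (deriv H 0) \<le> 2 * Re (H 0)"
    using c by (simp add: norm_divide field_simps c_def)
  assume t: "norm \<tau> < 1"
  have "norm (H \<tau> - c) \<le> norm \<tau> * norm (H \<tau> + cnj c)"
    using S(1)[OF _ t] nz[OF t] by (simp add: Q_def norm_divide field_simps)
  then have "(norm (H \<tau> - c))\<^sup>2 \<le> (norm \<tau>)\<^sup>2 * (norm (H \<tau> + cnj c))\<^sup>2"
    by (metis norm_ge_zero power_mono power_mult_distrib)
  then have 1: "(1 - (norm \<tau>)\<^sup>2) * (norm (H \<tau> + cnj c))\<^sup>2 \<le> 4 * Re (H \<tau>) * Re c"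
    using sq[of "H \<tau>"] by (simp add: algebra_simps)
  have "Re c \<le> Re (H \<tau> + cnj c)" using pos[OF t] by simp
  also have "\<dots> \<le> norm (H \<tau> + cnj c)" by (rule complex_Re_le_cmod)
  finally have "(Re c)\<^sup>2 \<le> (norm (H \<tau> + cnj c))\<^sup>2" using c by (simp add: power_mono)
  moreover have "(norm \<tau>)\<^sup>2 \<le> 1" using t by (simp add: power_le_one)
  ultimately have "(1 - (norm \<tau>)\<^sup>2) * (Re c)\<^sup>2 \<le> (1 - (norm \<tau>)\<^sup>2) * (norm (H \<tau> + cnj c))\<^sup>2"
    by (intro mult_left_mono) auto
  with 1 have "(1 - (norm \<tau>)\<^sup>2) * (Re c)\<^sup>2 \<le> 4 * Re (H \<tau>) * Re c" by linarith
  then have "Re c * ((1 - (norm \<tau>)\<^sup>2) * Re c) \<le> Re c * (4 * Re (H \<tau>))"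
    by (simp add: power2_eq_square algebra_simps)
  then have "(1 - (norm \<tau>)\<^sup>2) * Re c \<le> 4 * Re (H \<tau>)"
    using c mult_le_cancel_left_pos by blast
  then show "(1 - (norm \<tau>)\<^sup>2) / 4 * Re (H 0) \<le> Re (H \<tau>)" by (simp add: c_def)
qed

text \<open>Bilinear rather than Hermitian: \<open>l\<close> acts as a complex covector, so
  \<open>cdot l\<close> composed with a holomorphic map is holomorphic.\<close>

definition cdot :: "complex ^ 'd \<Rightarrow> complex ^ 'd \<Rightarrow> complex" where
  "cdot l y = (\<Sum>i\<in>UNIV. l $ i * y $ i)"

lemma cdot_add: "cdot l (x + y) = cdot l x + cdot l y"
  and cdot_diff: "cdot l (x - y) = cdot l x - cdot l y"
  and cdot_smult: "cdot l (c *s x) = c * cdot l x"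
  and cdot_scaleR: "cdot l (r *\<^sub>R x) = r *\<^sub>R cdot l x"
  and cdot_zero: "cdot l 0 = 0"
  by (simp_all add: cdot_def algebra_simps sum.distrib sum_subtractf sum_distrib_left
      vector_scalar_mult_def scaleR_sum_right)

lemma cdot_axis: "cdot l (axis i c) = l $ i * c"
  by (simp add: cdot_def axis_def if_distrib sum.delta cong: if_cong)

definition cnjv :: "complex ^ 'd \<Rightarrow> complex ^ 'd" where
  "cnjv x = (\<chi> i. cnj (x $ i))"

lemma Re_cdot_cnjv: "Re (cdot (cnjv x) y) = inner x y"
  by (simp add: cdot_def cnjv_def inner_vec_def inner_complex_def)

lemma norm_smult: "norm (c *s (x :: complex ^ 'd)) = norm c * norm x"
proof -
  have "(norm (c *s x))\<^sup>2 = (norm c * norm x)\<^sup>2"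
    by (simp add: norm_vec_def L2_set_def power_mult_distrib norm_mult sum_distrib_left[symmetric]
        sum_nonneg real_sqrt_mult)
  then show ?thesis by simp
qed

text \<open>A rotation of \<open>y\<close> makes the pairing real and nonnegative, which reduces the
  claim to the real Cauchy-Schwarz inequality.\<close>

lemma norm_cdot_le: "norm (cdot l y) \<le> norm l * norm y"
proof -
  obtain u where u: "norm u = 1" "u * cdot l y = of_real (norm (cdot l y))"
  proof (cases "cdot l y = 0")
    case True then show ?thesis using that[of 1] by simp
  next
    case False
    have "cnj (cdot l y) / norm (cdot l y) * cdot l y = of_real (norm (cdot l y))"
      using False complex_norm_square[of "cdot l y"] by (simp add: field_simps power2_eq_square)
    moreover have "norm (cnj (cdot l y) / norm (cdot l y)) = 1" using False by (simp add: norm_divide)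
    ultimately show ?thesis using that by blast
  qed
  have "norm (cdot l y) = Re (cdot l (u *s y))" by (simp add: cdot_smult u(2))
  also have "\<dots> = inner (cnjv l) (u *s y)"
    by (simp flip: Re_cdot_cnjv add: cnjv_def)
  also have "\<dots> \<le> norm (cnjv l) * norm (u *s y)" by (rule norm_cauchy_schwarz)
  also have "\<dots> = norm l * norm y"
    by (simp add: norm_smult u(1)) (simp add: cnjv_def norm_vec_def)
  finally show ?thesis .
qed

lemma norm_cnjv: "norm (cnjv x) = norm x"
  by (simp add: cnjv_def norm_vec_def)

text \<open>The phase \<open>u\<close> turns the Hermitian pairing of \<open>X\<close> with
  \<open>a\<close> purely imaginary, and its real part is the real inner product.\<close>

lemma exists_unimodular_orthogonal:
  fixes a X :: "complex ^ 'd"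
  shows "\<exists>u::complex. norm u = 1 \<and> inner a (u *s X) = 0"
proof (cases "cdot (cnjv a) X = 0")
  case True
  then show ?thesis by (intro exI[of _ 1]) (simp flip: Re_cdot_cnjv)
next
  case False
  define w where "w = cdot (cnjv a) X"
  have "cnj w * w = of_real ((norm w)\<^sup>2)" by (metis complex_norm_square mult.commute of_real_power)
  then have "Re (\<i> * cnj w / norm w * w) = 0"
    using False by (simp add: mult.assoc)
  moreover have "norm (\<i> * cnj w / norm w) = 1" using False by (simp add: norm_divide norm_mult w_def)
  ultimately show ?thesis
    by (intro exI[of _ "\<i> * cnj w / norm w"]) (simp flip: Re_cdot_cnjv add: cdot_smult w_def)
qed

text \<open>
  The functional \<open>\<langle>\<cdot>, e\<rangle>\<close> is tested on \<open>e = a\<close> and on \<open>e = a + \<theta> w\<close>, where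
  \<open>\<theta>\<^sup>2 = 1 - |a|\<^sup>2\<close> and the unit vector \<open>w\<close> is a multiple of \<open>X\<close> real-orthogonal to \<open>a\<close>.
\<close>

lemma disc_in_ball_derivative_bound:
  fixes \<psi> :: "complex \<Rightarrow> complex ^ 'd"
  assumes der: "\<And>\<tau>. norm \<tau> < 1 \<Longrightarrow> \<exists>D. \<forall>i. ((\<lambda>t. \<psi> t $ i) has_field_derivative D $ i) (at \<tau>)"
    and X: "\<And>i. ((\<lambda>t. \<psi> t $ i) has_field_derivative X $ i) (at 0)"
    and bd: "\<And>\<tau>. norm \<tau> < 1 \<Longrightarrow> norm (\<psi> \<tau>) < 1"
  shows "norm X \<le> 4 * sqrt (1 - (norm (\<psi> 0))\<^sup>2)"
proof -
  define a where "a = \<psi> 0"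
  have a1: "norm a < 1" using bd[of 0] by (simp add: a_def)
  \<comment> \<open>For \<open>e\<close> in the closed unit ball, 1 minus the Hermitian pairing of
    \<open>\<psi>\<close> with \<open>e\<close> has positive real part, so the half-plane Schwarz
    lemma bounds its derivative at 0.\<close>
  have test: "norm (cdot (cnjv e) X) \<le> 2 * (1 - inner e a)" if e: "norm e \<le> 1" for e
  proof -
    define H where "H = (\<lambda>\<tau>. 1 - cdot (cnjv e) (\<psi> \<tau>))"
    have D: "(H has_field_derivative - cdot (cnjv e) D) (at \<tau>)"
      if "\<And>i. ((\<lambda>t. \<psi> t $ i) has_field_derivative D $ i) (at \<tau>)" for D \<tau>
    proof -
      have "((\<lambda>t. \<Sum>i\<in>UNIV. cnjv e $ i * \<psi> t $ i) has_field_derivative (\<Sum>i\<in>UNIV. cnjv e $ i * D $ i)) (at \<tau>)"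
        by (intro DERIV_sum DERIV_cmult that)
      from DERIV_diff[OF DERIV_const[of 1] this] show ?thesis by (simp add: H_def cdot_def)
    qed
    have hol: "H holomorphic_on ball 0 1"
      unfolding holomorphic_on_open[OF open_ball]
    proof
      fix \<tau> :: complex assume "\<tau> \<in> ball 0 1"
      then obtain D where "\<forall>i. ((\<lambda>t. \<psi> t $ i) has_field_derivative D $ i) (at \<tau>)"
        using der[of \<tau>] by auto
      then show "\<exists>f'. (H has_field_derivative f') (at \<tau>)" using D by blast
    qed
    have pos: "0 < Re (H \<tau>)" if "norm \<tau> < 1" for \<tau>
    proof -
      have "Re (cdot (cnjv e) (\<psi> \<tau>)) \<le> norm (cnjv e) * norm (\<psi> \<tau>)"
        using complex_Re_le_cmod norm_cdot_le order_trans by blast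
      also have "\<dots> \<le> 1 * norm (\<psi> \<tau>)"
        using e by (intro mult_right_mono) (auto simp: norm_cnjv)
      also have "\<dots> < 1" using bd[OF that] by simp
      finally show ?thesis by (simp add: H_def)
    qed
    have "norm (deriv H 0) \<le> 2 * Re (H 0)"
      by (rule right_half_plane_Schwarz(1)[OF hol pos])
    moreover have "deriv H 0 = - cdot (cnjv e) X" using D[OF X] by (rule DERIV_imp_deriv)
    ultimately show ?thesis by (simp add: H_def Re_cdot_cnjv a_def)
  qed
  define \<theta> where "\<theta> = sqrt (1 - (norm a)\<^sup>2)"
  have na: "(norm a)\<^sup>2 < 1" using a1 abs_square_less_1[of "norm a"] by simp
  have th: "\<theta> > 0" "\<theta>\<^sup>2 = 1 - (norm a)\<^sup>2" using na by (auto simp: \<theta>_def)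
  show ?thesis
  proof (cases "X = 0")
    case True then show ?thesis using na by (simp add: a_def)
  next
    case False
    obtain u where u: "norm u = 1" "inner a (u *s X) = 0"
      using exists_unimodular_orthogonal by blast
    define w where "w = (1 / norm X) *\<^sub>R (u *s X)"
    have w: "inner a w = 0" "norm w = 1" using False u by (auto simp: w_def norm_smult)
    have "(norm (a + \<theta> *\<^sub>R w))\<^sup>2 = 1"
      by (simp add: power2_norm_eq_inner inner_add_left inner_add_right inner_commute[of w a] w(1))
        (use th(2) w(2) in \<open>simp add: power2_eq_square flip: power2_norm_eq_inner\<close>)
    then have "norm (a + \<theta> *\<^sub>R w) \<le> 1"
      using abs_square_le_1[of "norm (a + \<theta> *\<^sub>R w)"] by simp
    \<comment> \<open>As \<open>w\<close> is real-orthogonal to \<open>a\<close>, both test vectors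
      satisfy \<open>1 - inner e a = \<theta>\<^sup>2\<close>. The difference of the two tests
      isolates \<theta> times the pairing with \<open>w\<close>; dividing by \<theta> leaves a bound
      of order \<theta>.\<close>
    from test[OF this] have 1: "norm (cdot (cnjv (a + \<theta> *\<^sub>R w)) X) \<le> 2 * \<theta>\<^sup>2"
      by (simp add: inner_add_left inner_commute[of w a] w(1) th(2) power2_norm_eq_inner)
    from test[of a] have 2: "norm (cdot (cnjv a) X) \<le> 2 * \<theta>\<^sup>2"
      using a1 by (simp add: th(2) power2_norm_eq_inner)
    have "cdot (cnjv (a + \<theta> *\<^sub>R w)) X = cdot (cnjv a) X + \<theta> *\<^sub>R cdot (cnjv w) X"
      by (simp add: cdot_def cnjv_def algebra_simps sum.distrib scaleR_sum_right complex_cnj_scaleR)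
    then have "\<theta> * norm (cdot (cnjv w) X) \<le> 4 * \<theta>\<^sup>2"
      using 1 2 th(1) norm_triangle_ineq4[of "cdot (cnjv (a + \<theta> *\<^sub>R w)) X" "cdot (cnjv a) X"] by simp
    then have "norm (cdot (cnjv w) X) \<le> 4 * \<theta>" using th(1) by (simp add: power2_eq_square)
    moreover have "norm X = Re (cdot (cnjv w) (u *s X))"
      using False by (simp add: Re_cdot_cnjv w_def norm_smult u(1) power2_eq_square flip: power2_norm_eq_inner)
    then have "norm X \<le> norm (cdot (cnjv w) X)"
      using complex_Re_le_cmod[of "cdot (cnjv w) (u *s X)"] by (simp add: cdot_smult norm_mult u(1))
    ultimately show ?thesis by (simp add: \<theta>_def a_def)
  qed
qed

text \<open>Cauchy's inequality bounds the second derivative on the disc of radius \<rho>/2 by means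
  of circles of radius \<rho>/3, which stay inside since 1/2 + 1/3 < 1. The constant is 18 = 2! *
  9.\<close>

lemma bounded_holomorphic_Taylor_1:
  assumes hol: "\<phi> holomorphic_on ball 0 \<rho>" and "0 < \<rho>"
    and bd: "\<And>\<tau>. norm \<tau> < \<rho> \<Longrightarrow> norm (\<phi> \<tau>) \<le> 1"
    and h: "norm h < \<rho> / 2"
  shows "norm (\<phi> h - \<phi> 0 - h * deriv \<phi> 0) \<le> 18 / \<rho>\<^sup>2 * (norm h)\<^sup>2"
proof -
  have "norm ((deriv ^^ 0) \<phi> h - (\<Sum>i\<le>1. (deriv ^^ i) \<phi> 0 * (h - 0) ^ i / fact i))
      \<le> 18 / \<rho>\<^sup>2 * norm (h - 0) ^ Suc 1 / fact 1"
  proof (rule complex_Taylor[where S = "ball 0 (\<rho>/2)"])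
    fix i and x :: complex assume x: "x \<in> ball 0 (\<rho>/2)"
    then have x': "x \<in> ball 0 \<rho>" using \<open>0 < \<rho>\<close> by auto
    then have "((deriv ^^ i) \<phi> has_field_derivative deriv ((deriv ^^ i) \<phi>) x) (at x)"
      by (intro holomorphic_derivI[OF holomorphic_higher_deriv[OF hol]]) auto
    then show "((deriv ^^ i) \<phi> has_field_derivative (deriv ^^ Suc i) \<phi> x) (at x within ball 0 (\<rho> / 2))"
      by (simp add: has_field_derivative_at_within)
  next
    fix x :: complex assume x: "x \<in> ball 0 (\<rho>/2)"
    have sub: "cball x (\<rho>/3) \<subseteq> ball 0 \<rho>"
      using x \<open>0 < \<rho>\<close> by (simp add: cball_subset_ball_iff)
    have "norm ((deriv ^^ 2) \<phi> x) \<le> fact 2 * 1 / (\<rho>/3)^2"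
    proof (rule Cauchy_inequality)
      show "\<phi> holomorphic_on ball x (\<rho> / 3)"
        using hol sub ball_subset_cball holomorphic_on_subset by (metis subset_trans)
      show "continuous_on (cball x (\<rho> / 3)) \<phi>"
        using hol sub holomorphic_on_imp_continuous_on continuous_on_subset by blast
      show "norm (\<phi> y) \<le> 1" if "norm (x - y) = \<rho>/3" for y
      proof -
        have "y \<in> cball x (\<rho>/3)" using that by (simp add: dist_norm)
        then show ?thesis using sub bd by (auto simp: subset_iff)
      qed
    qed (use \<open>0 < \<rho>\<close> in auto)
    then show "norm ((deriv ^^ Suc 1) \<phi> x) \<le> 18 / \<rho>\<^sup>2"
      by (simp add: numeral_2_eq_2 power_divide)
  qed (use \<open>0 < \<rho>\<close> h in auto)
  then show ?thesis by (simp add: algebra_simps numeral_2_eq_2)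
qed

text \<open>Second-order Taylor bounds make the difference quotients converge locally uniformly.\<close>

lemma holomorphic_partial_derivative:
  fixes \<Phi> :: "complex \<Rightarrow> complex \<Rightarrow> complex"
  assumes "open S"
    and \<rho>: "\<And>\<zeta>. \<zeta> \<in> S \<Longrightarrow> \<exists>d>0. \<exists>\<rho>>0. ball \<zeta> d \<subseteq> S \<and>
        (\<forall>z\<in>ball \<zeta> d. (\<Phi> z) holomorphic_on ball 0 \<rho> \<and> (\<forall>\<tau>\<in>ball 0 \<rho>. norm (\<Phi> z \<tau>) \<le> 1)) \<and>
        (\<forall>\<tau>\<in>ball 0 \<rho>. (\<lambda>z. \<Phi> z \<tau>) holomorphic_on ball \<zeta> d)"
  shows "(\<lambda>\<zeta>. deriv (\<Phi> \<zeta>) 0) holomorphic_on S"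
proof -
  have "\<exists>f'. ((\<lambda>\<zeta>. deriv (\<Phi> \<zeta>) 0) has_field_derivative f') (at \<zeta>)" if \<zeta>: "\<zeta> \<in> S" for \<zeta>
  proof -
    obtain d \<rho> where d: "d > 0" "\<rho> > 0" "ball \<zeta> d \<subseteq> S"
      and h1: "\<And>z. z \<in> ball \<zeta> d \<Longrightarrow> (\<Phi> z) holomorphic_on ball 0 \<rho>"
      and h2: "\<And>z \<tau>. z \<in> ball \<zeta> d \<Longrightarrow> \<tau> \<in> ball 0 \<rho> \<Longrightarrow> norm (\<Phi> z \<tau>) \<le> 1"
      and h3: "\<And>\<tau>. \<tau> \<in> ball 0 \<rho> \<Longrightarrow> (\<lambda>z. \<Phi> z \<tau>) holomorphic_on ball \<zeta> d"
      using \<rho>[OF \<zeta>] by (auto 0 4)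
    \<comment> \<open>The offset 3 keeps every increment, including the one for
      \<open>n = 0\<close>, below \<rho>/2.\<close>
    define h :: "nat \<Rightarrow> complex" where "h = (\<lambda>n. of_real (\<rho> / (real n + 3)))"
    have nh: "norm (h n) = \<rho> / (real n + 3)" for n using d by (simp add: h_def norm_divide del: of_real_divide)
    have hn: "norm (h n) < \<rho> / 2" "h n \<noteq> 0" for n
    proof -
      show "norm (h n) < \<rho> / 2" unfolding nh using d by (intro divide_strict_left_mono) auto
      then show "h n \<noteq> 0" using nh[of n] d by auto
    qed
    define q where "q = (\<lambda>n z. (\<Phi> z (h n) - \<Phi> z 0) / h n)"
    have est: "norm (q n z - deriv (\<Phi> z) 0) \<le> 18 / \<rho>\<^sup>2 * norm (h n)" if "z \<in> ball \<zeta> d" for n z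
    proof -
      have "norm (\<Phi> z (h n) - \<Phi> z 0 - h n * deriv (\<Phi> z) 0) \<le> 18 / \<rho>\<^sup>2 * (norm (h n))\<^sup>2"
        using bounded_holomorphic_Taylor_1[OF h1[OF that] d(2) _ hn(1)] h2[OF that] by auto
      moreover have "q n z - deriv (\<Phi> z) 0 = (\<Phi> z (h n) - \<Phi> z 0 - h n * deriv (\<Phi> z) 0) / h n"
        using hn(2) by (simp add: q_def field_simps)
      ultimately have "norm (q n z - deriv (\<Phi> z) 0) \<le> 18 / \<rho>\<^sup>2 * (norm (h n))\<^sup>2 / norm (h n)"
        by (simp only: norm_divide) (intro divide_right_mono, simp_all)
      then show ?thesis using hn(2) by (simp add: power2_eq_square)
    qed
    have lim: "(\<lambda>n. 18 / \<rho>\<^sup>2 * norm (h n)) \<longlonglongrightarrow> 0"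
    proof -
      have "(\<lambda>n. \<rho> / (real n + 3)) \<longlonglongrightarrow> 0"
        using LIMSEQ_ignore_initial_segment[OF lim_const_over_n[of "\<rho>"], of 3] by (simp add: add.commute)
      from tendsto_mult_left[OF this, of "18/\<rho>\<^sup>2"] show ?thesis by (simp add: nh)
    qed
    have unif: "uniform_limit (ball \<zeta> d) q (\<lambda>z. deriv (\<Phi> z) 0) sequentially"
    proof (rule uniform_limitI)
      fix e :: real assume "e > 0"
      with lim have "\<forall>\<^sub>F n in sequentially. 18 / \<rho>\<^sup>2 * norm (h n) < e"
        by (rule order_tendstoD)
      then show "\<forall>\<^sub>F n in sequentially. \<forall>x\<in>ball \<zeta> d. dist (q n x) (deriv (\<Phi> x) 0) < e"
      proof eventually_elim
        case (elim n)
        then show ?case using est le_less_trans unfolding dist_norm by blast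
      qed
    qed
    have "(\<lambda>z. deriv (\<Phi> z) 0) holomorphic_on ball \<zeta> d"
    proof (rule holomorphic_uniform_sequence[OF open_ball])
      show "q n holomorphic_on ball \<zeta> d" for n
      proof -
        have "h n \<in> ball 0 \<rho>" using hn(1)[of n] d by (simp add: dist_norm)
        then show ?thesis unfolding q_def using d(2) by (intro holomorphic_intros h3 hn) auto
      qed
      fix x assume "x \<in> ball \<zeta> d"
      then obtain e where "e > 0" "cball x e \<subseteq> ball \<zeta> d"
        using open_contains_cball[of "ball \<zeta> d"] open_ball by blast
      then show "\<exists>e>0. cball x e \<subseteq> ball \<zeta> d \<and> uniform_limit (cball x e) q (\<lambda>z. deriv (\<Phi> z) 0) sequentially"
        using uniform_limit_on_subset[OF unif] by blast
    qed
    then show ?thesis using d(1) holomorphic_on_open[OF open_ball] by (metis centre_in_ball)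
  qed
  then show ?thesis by (simp add: holomorphic_on_open[OF \<open>open S\<close>])
qed

text \<open>The bound lets \<open>G\<close> extend continuously by 0 across the imaginary axis. A
  continuous function that is holomorphic on both sides of a line is holomorphic, so the extension
  vanishes by the identity theorem.\<close>

lemma holomorphic_on_strip_eq_0:
  assumes hol: "G holomorphic_on {z. 0 < Re z \<and> Re z < 1}"
    and bd: "\<And>z. 0 < Re z \<Longrightarrow> Re z < 1 \<Longrightarrow> norm (G z) \<le> C * Re z powr \<alpha>"
    and "0 < \<alpha>" and z: "0 < Re z" "Re z < 1"
  shows "G z = 0"
proof -
  define h where "h = (\<lambda>z. if Re z \<le> 0 then 0 else G z)"
  define S where "S = {z::complex. Re z < 1}"
  have oS: "open S" by (simp add: S_def open_halfspace_Re_lt)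
  have oT: "open {z::complex. 0 < Re z \<and> Re z < 1}"
    by (simp add: Collect_conj_eq open_Int open_halfspace_Re_lt open_halfspace_Re_gt)
  have inn: "1 \<bullet> z = Re z" for z :: complex by (simp add: inner_complex_def)
  have bdh: "norm (h z) \<le> \<bar>C\<bar> * (max 0 (Re z)) powr \<alpha>" if "z \<in> S" for z
  proof (cases "Re z \<le> 0")
    case False
    then have "norm (G z) \<le> C * Re z powr \<alpha>" using that bd by (simp add: S_def)
    also have "\<dots> \<le> \<bar>C\<bar> * Re z powr \<alpha>" by (simp add: mult_right_mono)
    finally show ?thesis using False by (simp add: h_def max_def)
  qed (simp add: h_def)
  have cont: "continuous_on S h"
    unfolding continuous_on_eq_continuous_at[OF oS]
  proof
    fix x assume x: "x \<in> S"
    consider "Re x < 0" | "Re x > 0" | "Re x = 0" by linarith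
    then show "isCont h x"
    proof cases
      case 1
      have "\<forall>\<^sub>F z in nhds x. z \<in> {z. Re z < 0}"
        using 1 by (intro eventually_nhds_in_open) (auto simp: open_halfspace_Re_lt)
      then have "\<forall>\<^sub>F z in nhds x. h z = 0"
        by eventually_elim (simp add: h_def)
      then show ?thesis using isCont_cong[of h "\<lambda>_. 0" x] by simp
    next
      case 2
      then have "isCont G x"
        using holomorphic_on_imp_continuous_on[OF hol] continuous_on_eq_continuous_at[OF oT, of G] x
        by (simp add: S_def)
      moreover have "\<forall>\<^sub>F z in nhds x. z \<in> {z. 0 < Re z}"
        using 2 by (intro eventually_nhds_in_open) (auto simp: open_halfspace_Re_gt)
      then have "\<forall>\<^sub>F z in nhds x. h z = G z"
        by eventually_elim (simp add: h_def)
      ultimately show ?thesis using isCont_cong by blast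
    next
      case 3
      have "((\<lambda>z. \<bar>C\<bar> * (max 0 (Re z)) powr \<alpha>) \<longlongrightarrow> \<bar>C\<bar> * (max 0 (Re x)) powr \<alpha>) (at x)"
        using \<open>0 < \<alpha>\<close>
        by (intro tendsto_intros tendsto_powr2) (auto simp: 3 intro!: always_eventually)
      then have "((\<lambda>z. \<bar>C\<bar> * (max 0 (Re z)) powr \<alpha>) \<longlongrightarrow> 0) (at x)" using 3 by simp
      moreover have "\<forall>\<^sub>F z in at x. norm (h z) \<le> \<bar>C\<bar> * (max 0 (Re z)) powr \<alpha>"
        using eventually_at_in_open'[OF oS x] by eventually_elim (rule bdh)
      ultimately have "(h \<longlongrightarrow> 0) (at x)" by (rule Lim_null_comparison[rotated])
      then show ?thesis using 3 by (simp add: isCont_def h_def)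
    qed
  qed
  have holh: "h holomorphic_on S"
  proof (rule holomorphic_on_paste_across_line[OF oS _ _ _ cont, where d = 1 and k = 0])
    show "h holomorphic_on S \<inter> {z. 1 \<bullet> z < 0}"
      by (rule holomorphic_transform[of "\<lambda>_. 0"]) (auto simp: h_def inn)
    have "S \<inter> {z. 0 < 1 \<bullet> z} = {z. 0 < Re z \<and> Re z < 1}" by (auto simp: S_def inn)
    then show "h holomorphic_on S \<inter> {z. 0 < 1 \<bullet> z}"
      using hol by (auto simp: h_def intro: holomorphic_transform[of G])
  qed simp
  have "h z = 0"
  proof (rule analytic_continuation_open[where f = h and s = "{z. Re z < 0}" and s' = S and g = "\<lambda>_. 0"])
    have "-1 \<in> {z::complex. Re z < 0}" by simp
    then show "{z::complex. Re z < 0} \<noteq> {}" by blast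
    show "connected S" by (simp add: S_def convex_connected convex_halfspace_Re_lt)
  qed (use z holh oS in \<open>auto simp: h_def S_def open_halfspace_Re_lt\<close>)
  then show ?thesis using z by (simp add: h_def)
qed


section \<open>An obstruction to being biholomorphic to the ball\<close>

lemma has_field_derivative_along_complex_line:
  fixes F :: "complex ^ 'm \<Rightarrow> complex ^ 'n"
  assumes "(F has_derivative (\<lambda>v. A *v v)) (at (p + \<tau> *s w))"
  shows "((\<lambda>t. F (p + t *s w) $ i) has_field_derivative (A *v w) $ i) (at \<tau>)"
proof -
  have "bounded_linear (\<lambda>t::complex. t *s w)"
    unfolding linear_conv_bounded_linear[symmetric]
    by (rule linearI) (auto simp: vec_eq_iff algebra_simps)
  then have "((\<lambda>t. t *s w) has_derivative (\<lambda>t. t *s w)) (at \<tau>)"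
    by (rule bounded_linear_imp_has_derivative)
  then have "((\<lambda>t. p + t *s w) has_derivative (\<lambda>t. t *s w)) (at \<tau>)"
    using has_derivative_add[OF has_derivative_const[of p]] by fastforce
  from has_derivative_compose[OF this assms]
  have "((\<lambda>t. F (p + t *s w)) has_derivative (\<lambda>t. A *v (t *s w))) (at \<tau>)" .
  from bounded_linear.has_derivative[OF bounded_linear_vec_nth this, of i]
  show ?thesis
    by (simp add: has_field_derivative_def vec.scale mult_commute_abs)
qed

text \<open>This supplies the final contradiction. The discs in direction \<open>V\<close> exceed,
  by a factor of order \<open>Re \<zeta> powr (-\<alpha>)\<close>, the size at which the square-root
  bound in the ball still allows a derivative of order 1. Hence the derivative of \<open>F\<close>
  along \<open>V\<close> decays towards the imaginary axis and vanishes identically, although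
  \<open>F\<close> has an inverse with a derivative.\<close>

lemma not_biholomorphic_to_ball:
  fixes F :: "complex ^ 'd \<Rightarrow> complex ^ 'd"
  assumes bi: "biholomorphism F D (ball 0 1)" and "open D"
    and half: "\<And>y. y \<in> D \<Longrightarrow> -1 < Re (cdot l y)"
    and N: "cdot l N = 1" and "V \<noteq> 0" and "\<kappa> > 0" and "\<alpha> > 0"
    and disc: "\<And>\<zeta> \<tau>. 0 < Re \<zeta> \<Longrightarrow> Re \<zeta> \<le> 1 \<Longrightarrow> norm \<tau> < \<kappa> * Re \<zeta> powr (1/2 - \<alpha>) \<Longrightarrow>
                 (\<zeta> - 1) *s N + \<tau> *s V \<in> D"
  shows False
proof -
  define Fi where "Fi = the_inv_into D F"
  have bij: "bij_betw F D (ball 0 1)" and "holomorphic_map_on F D" "holomorphic_map_on Fi (ball 0 1)"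
    using bi by (auto simp: biholomorphism_def Fi_def)
  then obtain A B where A: "\<And>z. z \<in> D \<Longrightarrow> (F has_derivative (\<lambda>v. A z *v v)) (at z)"
    and B: "\<And>z. z \<in> ball 0 1 \<Longrightarrow> (Fi has_derivative (\<lambda>v. B z *v v)) (at z)"
    unfolding holomorphic_map_on_def by metis
  have FD: "norm (F z) < 1" if "z \<in> D" for z
    using bij that by (auto simp: bij_betw_def)
  have FiF: "Fi (F z) = z" if "z \<in> D" for z
    using bij that by (simp add: Fi_def bij_betw_def the_inv_into_f_f)
  have FiD: "Fi b \<in> D" if "norm b < 1" for b
    using bij that by (simp add: Fi_def bij_betw_def the_inv_into_into)
  define q where "q = (\<lambda>\<zeta>. (\<zeta> - 1) *s N)"
  have qD: "q \<zeta> \<in> D" if "0 < Re \<zeta>" "Re \<zeta> \<le> 1" for \<zeta>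
    using disc[of \<zeta> 0] that \<open>\<kappa> > 0\<close> by (simp add: q_def)
  define S where "S = {z. 0 < Re z \<and> Re z < 1}"
  have oS: "open S"
    by (simp add: S_def Collect_conj_eq open_Int open_halfspace_Re_lt open_halfspace_Re_gt)
  define c where "c = Re (1 + cdot l (Fi 0))"
  have c: "c > 0" using half[OF FiD[of 0]] by (simp add: c_def)
  \<comment> \<open>The function \<open>1 + cdot l (Fi b)\<close> has positive real part on the
    ball. On the complex line through 0 and \<open>F (q \<zeta>)\<close> it takes the value \<zeta>
    at the latter point, so the Harnack inequality compares \<open>Re \<zeta>\<close> with the
    distance to the sphere.\<close>
  have Harnack: "1 - (norm (F (q \<zeta>)))\<^sup>2 \<le> 4 / c * Re \<zeta>" if "\<zeta> \<in> S" for \<zeta>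
  proof -
    have qz: "q \<zeta> \<in> D" using that qD by (simp add: S_def)
    define b where "b = F (q \<zeta>)"
    \<comment> \<open>If \<open>b = 0\<close>, the quotient \<open>1 / norm b\<close> is 0 by
      convention; then \<open>u = 0\<close> and both facts about \<open>u\<close> below still
      hold.\<close>
    define u where "u = of_real (1 / norm b) *s b"
    have nb: "norm b < 1" using FD[OF qz] by (simp add: b_def)
    have u: "norm u \<le> 1" "of_real (norm b) *s u = b"
      by (auto simp: u_def norm_smult vector_smult_assoc norm_divide)
    define H where "H = (\<lambda>\<tau>. 1 + cdot l (Fi (0 + \<tau> *s u)))"
    have inball: "norm (\<tau> *s u) < 1" if "norm \<tau> < 1" for \<tau>
      using that mult_left_mono[OF u(1), of "norm \<tau>"] by (simp add: norm_smult)
    have hol: "H holomorphic_on ball 0 1"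
      unfolding holomorphic_on_open[OF open_ball]
    proof
      fix \<tau> :: complex assume "\<tau> \<in> ball 0 1"
      then have "0 + \<tau> *s u \<in> ball 0 1" using inball by simp
      from has_field_derivative_along_complex_line[OF B[OF this]]
      have "((\<lambda>t. \<Sum>i\<in>UNIV. l $ i * Fi (0 + t *s u) $ i) has_field_derivative
          (\<Sum>i\<in>UNIV. l $ i * (B (0 + \<tau> *s u) *v u) $ i)) (at \<tau>)"
        by (intro DERIV_sum DERIV_cmult)
      from DERIV_add[OF DERIV_const[of 1] this]
      show "\<exists>f'. (H has_field_derivative f') (at \<tau>)"
        unfolding H_def cdot_def by blast
    qed
    have pos: "0 < Re (H \<tau>)" if "norm \<tau> < 1" for \<tau>
      using half[OF FiD[OF inball[OF that]]] by (simp add: H_def)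
    have "(1 - (norm b)\<^sup>2) / 4 * Re (H 0) \<le> Re (H (of_real (norm b)))"
      using right_half_plane_Schwarz(2)[OF hol pos, of "of_real (norm b)"] nb by simp
    moreover have "H (of_real (norm b)) = \<zeta>"
    proof -
      have "H (of_real (norm b)) = 1 + cdot l (q \<zeta>)" by (simp add: H_def u(2)) (simp add: b_def FiF[OF qz])
      then show ?thesis by (simp only: q_def cdot_smult N) simp
    qed
    ultimately have "(1 - (norm b)\<^sup>2) / 4 * Re (H 0) \<le> Re \<zeta>" by simp
    moreover have "Re (H 0) = c" by (simp add: H_def c_def)
    ultimately show ?thesis using c by (simp add: b_def field_simps)
  qed
  \<comment> \<open>The disc of radius \<rho> in direction \<open>V\<close> is reparametrised by the
    unit disc, which multiplies the derivative by \<rho>. The square-root bound combined with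
    \<open>Harnack\<close> is then divided by \<rho>.\<close>
  have bound: "norm (A (q \<zeta>) *v V) \<le> 8 / (\<kappa> * sqrt c) * Re \<zeta> powr \<alpha>" if \<zeta>: "\<zeta> \<in> S" for \<zeta>
  proof -
    have qz: "q \<zeta> \<in> D" using that qD by (simp add: S_def)
    have s: "0 < Re \<zeta>" "Re \<zeta> \<le> 1" using \<zeta> by (auto simp: S_def)
    define \<rho> where "\<rho> = \<kappa> * Re \<zeta> powr (1/2 - \<alpha>)"
    have "\<rho> > 0" using s \<open>\<kappa> > 0\<close> by (simp add: \<rho>_def)
    define \<psi> where "\<psi> = (\<lambda>\<tau>. F (q \<zeta> + \<tau> *s (of_real \<rho> *s V)))"
    have inD: "q \<zeta> + \<tau> *s (of_real \<rho> *s V) \<in> D" if "norm \<tau> < 1" for \<tau>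
    proof -
      have "norm (\<tau> * of_real \<rho>) < \<rho>" using that \<open>\<rho> > 0\<close> by (simp add: norm_mult)
      from disc[OF s this[unfolded \<rho>_def]] show ?thesis
        by (simp add: q_def vector_smult_assoc \<rho>_def)
    qed
    have der: "((\<lambda>t. \<psi> t $ i) has_field_derivative
        (A (q \<zeta> + \<tau> *s (of_real \<rho> *s V)) *v (of_real \<rho> *s V)) $ i) (at \<tau>)" if "norm \<tau> < 1" for \<tau> i
      unfolding \<psi>_def by (rule has_field_derivative_along_complex_line[OF A[OF inD[OF that]]])
    have "norm (A (q \<zeta>) *v (of_real \<rho> *s V)) \<le> 4 * sqrt (1 - (norm (\<psi> 0))\<^sup>2)"
    proof (rule disc_in_ball_derivative_bound)
      show "\<exists>D. \<forall>i. ((\<lambda>t. \<psi> t $ i) has_field_derivative D $ i) (at \<tau>)" if "norm \<tau> < 1" for \<tau>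
        using der[OF that] by blast
      show "((\<lambda>t. \<psi> t $ i) has_field_derivative (A (q \<zeta>) *v (of_real \<rho> *s V)) $ i) (at 0)" for i
        using der[of 0 i] by simp
      show "norm (\<psi> \<tau>) < 1" if "norm \<tau> < 1" for \<tau>
        using FD[OF inD[OF that]] by (simp add: \<psi>_def)
    qed
    also have "\<dots> \<le> 4 * sqrt (4 / c * Re \<zeta>)"
      using Harnack[OF \<zeta>] by (simp add: \<psi>_def)
    also have "\<dots> = 8 / sqrt c * Re \<zeta> powr (1/2)"
      using s by (simp add: real_sqrt_divide real_sqrt_mult powr_half_sqrt)
    finally have "\<rho> * norm (A (q \<zeta>) *v V) \<le> 8 / sqrt c * Re \<zeta> powr (1/2)"
      using \<open>\<rho> > 0\<close> by (simp add: vec.scale norm_smult)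
    then have "norm (A (q \<zeta>) *v V) \<le> 8 / sqrt c * Re \<zeta> powr (1/2) / \<rho>"
      using \<open>\<rho> > 0\<close> by (simp only: pos_le_divide_eq mult.commute)
    also have "\<dots> = 8 / (\<kappa> * sqrt c) * (Re \<zeta> powr (1/2) / Re \<zeta> powr (1/2 - \<alpha>))"
      by (simp add: \<rho>_def field_simps)
    also have "Re \<zeta> powr (1/2) / Re \<zeta> powr (1/2 - \<alpha>) = Re \<zeta> powr \<alpha>"
      by (simp flip: powr_diff)
    finally show ?thesis .
  qed
  have zero: "(A (q \<zeta>) *v V) $ i = 0" if "\<zeta> \<in> S" for \<zeta> i
  proof -
    define \<Phi> where "\<Phi> = (\<lambda>\<zeta> \<tau>. F (q \<zeta> + \<tau> *s V) $ i)"
    have der: "(\<Phi> \<zeta> has_field_derivative (A (q \<zeta> + \<tau> *s V) *v V) $ i) (at \<tau>)"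
      if "q \<zeta> + \<tau> *s V \<in> D" for \<zeta> \<tau>
      unfolding \<Phi>_def by (rule has_field_derivative_along_complex_line[OF A[OF that]])
    have der0: "deriv (\<Phi> \<zeta>) 0 = (A (q \<zeta>) *v V) $ i" if "\<zeta> \<in> S" for \<zeta>
      using der[of \<zeta> 0] qD[of \<zeta>] that by (simp add: S_def DERIV_imp_deriv)
    have "(\<lambda>\<zeta>. deriv (\<Phi> \<zeta>) 0) holomorphic_on S"
    proof (rule holomorphic_partial_derivative[OF oS])
      fix \<zeta> assume \<zeta>: "\<zeta> \<in> S"
      define s where "s = Re \<zeta>"
      have s: "0 < s" "s < 1" using \<zeta> by (auto simp: S_def s_def)
      define d where "d = min (s/2) (1 - s)"
      have "d > 0" using s by (simp add: d_def)
      \<comment> \<open>The minimum with 1 makes \<rho> a common radius near \<zeta> for both signs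
        of \<open>1/2 - \<alpha>\<close>: real parts there lie between \<open>s/2\<close> and
        1.\<close>
      define \<rho> where "\<rho> = \<kappa> * min ((s/2) powr (1/2 - \<alpha>)) 1"
      have "\<rho> > 0" using s \<open>\<kappa> > 0\<close> by (simp add: \<rho>_def)
      have dS: "s / 2 < Re z \<and> Re z < 1" if "z \<in> ball \<zeta> d" for z
      proof -
        have "\<bar>Re \<zeta> - Re z\<bar> < d"
          using that abs_Re_le_cmod[of "\<zeta> - z"] by (simp add: dist_norm)
        then show ?thesis unfolding s_def[symmetric] d_def by linarith
      qed
      have inD: "q z + \<tau> *s V \<in> D" if z: "z \<in> ball \<zeta> d" and t: "\<tau> \<in> ball 0 \<rho>" for z \<tau>
      proof -
        have "min ((s/2) powr (1/2 - \<alpha>)) 1 \<le> Re z powr (1/2 - \<alpha>)"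
        proof (cases "1/2 - \<alpha> \<ge> 0")
          case True
          then show ?thesis using dS[OF z] s by (simp add: min.coboundedI1 powr_mono2)
        next
          case False
          then have "1 \<le> Re z powr (1/2 - \<alpha>)"
            using dS[OF z] s powr_mono2'[of "1/2 - \<alpha>" "Re z" 1] by auto
          then show ?thesis by simp
        qed
        then have "\<rho> \<le> \<kappa> * Re z powr (1/2 - \<alpha>)"
          using \<open>\<kappa> > 0\<close> by (simp add: \<rho>_def)
        then show ?thesis unfolding q_def using dS[OF z] s t by (intro disc) auto
      qed
      have 1: "(\<Phi> z) holomorphic_on ball 0 \<rho>" if "z \<in> ball \<zeta> d" for z
        unfolding holomorphic_on_open[OF open_ball] using der inD that by blast
      have 2: "norm (\<Phi> z \<tau>) \<le> 1" if "z \<in> ball \<zeta> d" "\<tau> \<in> ball 0 \<rho>" for z \<tau>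
        using FD[OF inD[OF that]] Finite_Cartesian_Product.norm_nth_le[of "F (q z + \<tau> *s V)" i]
        by (simp add: \<Phi>_def)
      have 3: "(\<lambda>z. \<Phi> z \<tau>) holomorphic_on ball \<zeta> d" if "\<tau> \<in> ball 0 \<rho>" for \<tau>
        unfolding holomorphic_on_open[OF open_ball]
      proof
        fix z assume "z \<in> ball \<zeta> d"
        then have D: "q z + \<tau> *s V \<in> D" using inD that by blast
        have eq: "q z + \<tau> *s V = (\<tau> *s V - N) + z *s N" for z
          by (simp add: q_def vec_eq_iff algebra_simps)
        show "\<exists>f'. ((\<lambda>z. \<Phi> z \<tau>) has_field_derivative f') (at z)"
          unfolding \<Phi>_def eq
          by (rule exI, rule has_field_derivative_along_complex_line, rule A) (use D eq in simp)
      qed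
      have "ball \<zeta> d \<subseteq> S" using dS s by (force simp: S_def)
      then show "\<exists>d>0. \<exists>\<rho>>0. ball \<zeta> d \<subseteq> S \<and>
        (\<forall>z\<in>ball \<zeta> d. (\<Phi> z) holomorphic_on ball 0 \<rho> \<and> (\<forall>\<tau>\<in>ball 0 \<rho>. norm (\<Phi> z \<tau>) \<le> 1)) \<and>
        (\<forall>\<tau>\<in>ball 0 \<rho>. (\<lambda>z. \<Phi> z \<tau>) holomorphic_on ball \<zeta> d)"
        using \<open>d > 0\<close> \<open>\<rho> > 0\<close> 1 2 3 by blast
    qed
    then have "(\<lambda>\<zeta>. deriv (\<Phi> \<zeta>) 0) holomorphic_on {z. 0 < Re z \<and> Re z < 1}"
      by (simp only: S_def)
    then have "deriv (\<Phi> \<zeta>) 0 = 0"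
    proof (rule holomorphic_on_strip_eq_0[OF _ _ \<open>\<alpha> > 0\<close>])
      fix z assume "0 < Re z" "Re z < 1"
      then have z: "z \<in> S" by (simp add: S_def)
      have "norm ((A (q z) *v V) $ i) \<le> norm (A (q z) *v V)"
        by (rule Finite_Cartesian_Product.norm_nth_le)
      also have "\<dots> \<le> 8 / (\<kappa> * sqrt c) * Re z powr \<alpha>" by (rule bound[OF z])
      finally show "norm (deriv (\<Phi> z) 0) \<le> 8 / (\<kappa> * sqrt c) * Re z powr \<alpha>"
        unfolding der0[OF z] .
    qed (use that in \<open>auto simp: S_def\<close>)
    then show ?thesis using der0[OF that] by simp
  qed
  define p where "p = q (1/2)"
  have pD: "p \<in> D" using qD[of "1/2"] by (simp add: p_def)
  have "A p *v V = 0" using zero[of "1/2"] by (simp add: vec_eq_iff p_def S_def)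
  \<comment> \<open>The chain rule applied to \<open>Fi\<close> after \<open>F\<close>, which is the
    identity on \<open>D\<close>, shows that \<open>A p\<close> is injective.\<close>
  have "((\<lambda>z. Fi (F z)) has_derivative (\<lambda>v. B (F p) *v (A p *v v))) (at p)"
    using has_derivative_compose[OF A[OF pD] B[of "F p"]] FD[OF pD] by simp
  moreover have "((\<lambda>z. Fi (F z)) has_derivative (\<lambda>v. v)) (at p)"
    by (rule has_derivative_transform_within_open[OF has_derivative_ident \<open>open D\<close> pD])
      (simp add: FiF)
  ultimately have "(\<lambda>v. B (F p) *v (A p *v v)) = (\<lambda>v. v)"
    by (rule has_derivative_unique)
  then have "B (F p) *v (A p *v V) = V" by metis
  then show False using \<open>A p *v V = 0\<close> \<open>V \<noteq> 0\<close> by simp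
qed

section \<open>Gauges and local Hausdorff convergence\<close>

text \<open>Convex domains containing 0 are encoded by their Minkowski gauges, so that limits of
  domains become limits of functions. A gauge is finite and nonnegative, but homogeneous only under
  nonnegative real factors.\<close>

definition sublinear :: "('a::real_vector \<Rightarrow> real) \<Rightarrow> bool" where
  "sublinear p \<longleftrightarrow> (\<forall>x. 0 \<le> p x) \<and> (\<forall>x y. p (x + y) \<le> p x + p y) \<and>
     (\<forall>c x. 0 \<le> c \<longrightarrow> p (c *\<^sub>R x) = c * p x)"

lemma sublinearD:
  assumes "sublinear p"
  shows "0 \<le> p x" "p (x + y) \<le> p x + p y" "0 \<le> c \<Longrightarrow> p (c *\<^sub>R x) = c * p x"
  using assms by (auto simp: sublinear_def)

lemma sublinear_0: "sublinear p \<Longrightarrow> p 0 = 0"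
  using sublinearD(3)[of p 0 0] by simp

definition gauge_fun :: "'a::real_vector set \<Rightarrow> 'a \<Rightarrow> real" where
  "gauge_fun U y = Inf {t. 0 < t \<and> (1/t) *\<^sub>R y \<in> U}"

lemma gauge_fun:
  fixes U :: "'a::real_normed_vector set"
  assumes "open U" "convex U" "0 \<in> U"
  shows sublinear_gauge_fun: "sublinear (gauge_fun U)"
    and gauge_fun_less_1: "{y. gauge_fun U y < 1} = U"
proof -
  define T where "T = (\<lambda>y. {t. 0 < t \<and> (1/t) *\<^sub>R y \<in> U})"
  have g: "gauge_fun U y = Inf (T y)" for y by (simp add: gauge_fun_def T_def)
  have bdd: "bdd_below (T y)" for y by (rule bdd_belowI[of _ 0]) (auto simp: T_def)
  obtain e where e: "e > 0" "ball 0 e \<subseteq> U" using assms openE by blast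
  have ne: "T y \<noteq> {}" for y
  proof -
    have "e * norm y < e * (norm y + 1)" using e by simp
    then have "e * norm y / (norm y + 1) < e" by (simp only: pos_divide_less_eq add_nonneg_pos norm_ge_zero zero_less_one)
    then have "norm ((1 / ((norm y + 1) / e)) *\<^sub>R y) < e"
      using e by simp
    then have "(norm y + 1) / e \<in> T y" using e by (auto simp: T_def intro!: divide_pos_pos add_nonneg_pos)
    then show ?thesis by blast
  qed
  have nn: "0 \<le> gauge_fun U y" for y
    unfolding g by (rule cInf_greatest[OF ne]) (auto simp: T_def)
  \<comment> \<open>Because \<open>U\<close> is convex and contains 0, \<open>T y\<close> is an
    upper set; every number above its infimum therefore belongs to it.\<close>
  have up: "t \<in> T y" if "s \<in> T y" "s \<le> t" for s t y
  proof -
    have "(s/t) *\<^sub>R ((1/s) *\<^sub>R y) + (1 - s/t) *\<^sub>R 0 \<in> U"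
      using that assms by (intro convexD) (auto simp: T_def)
    then show ?thesis using that by (auto simp: T_def)
  qed
  have inT: "t \<in> T y" if "gauge_fun U y < t" for t y
    using that cInf_lessD[OF ne] up less_imp_le unfolding g by blast
  have le: "gauge_fun U y \<le> t" if "t \<in> T y" for t y
    unfolding g by (rule cInf_lower[OF that bdd])
  have add: "gauge_fun U (x + y) \<le> gauge_fun U x + gauge_fun U y" for x y
  proof (rule field_le_epsilon)
    fix d :: real assume "d > 0"
    define s t where "s = gauge_fun U x + d/2" and "t = gauge_fun U y + d/2"
    have st: "s \<in> T x" "t \<in> T y" using \<open>d > 0\<close> by (auto simp: s_def t_def intro: inT)
    then have "(s/(s+t)) *\<^sub>R ((1/s) *\<^sub>R x) + (t/(s+t)) *\<^sub>R ((1/t) *\<^sub>R y) \<in> U"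
      using assms by (intro convexD) (auto simp: T_def simp flip: add_divide_distrib)
    then have "s + t \<in> T (x + y)" using st by (auto simp: T_def scaleR_add_right)
    from le[OF this] show "gauge_fun U (x + y) \<le> gauge_fun U x + gauge_fun U y + d"
      by (simp add: s_def t_def)
  qed
  have hom_le: "gauge_fun U (c *\<^sub>R x) \<le> c * gauge_fun U x" if "0 < c" for c x
  proof (rule field_le_epsilon)
    fix d :: real assume "d > 0"
    define s where "s = gauge_fun U x + d/c"
    have "s \<in> T x" using \<open>d > 0\<close> \<open>0 < c\<close> by (auto simp: s_def intro: inT)
    then have "c * s \<in> T (c *\<^sub>R x)" using \<open>0 < c\<close> by (simp add: T_def)
    from le[OF this] show "gauge_fun U (c *\<^sub>R x) \<le> c * gauge_fun U x + d"
      using \<open>0 < c\<close> by (simp add: s_def algebra_simps)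
  qed
  have hom: "gauge_fun U (c *\<^sub>R x) = c * gauge_fun U x" if "0 \<le> c" for c x
  proof (cases "c = 0")
    case True
    have "gauge_fun U 0 \<le> 0 + t" if "t > 0" for t using assms that by (intro le) (simp add: T_def)
    then have "gauge_fun U 0 \<le> 0" by (rule field_le_epsilon)
    then show ?thesis using nn[of 0] True by simp
  next
    case False
    then have "c > 0" using that by simp
    with hom_le[of "1/c" "c *\<^sub>R x"] have "c * gauge_fun U x \<le> gauge_fun U (c *\<^sub>R x)"
      by (simp add: field_simps)
    then show ?thesis using hom_le[OF \<open>c > 0\<close>] by (simp add: antisym)
  qed
  show "sublinear (gauge_fun U)" unfolding sublinear_def using nn add hom by blast
  show "{y. gauge_fun U y < 1} = U"
  proof (intro set_eqI iffI; clarify?)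
    fix y assume "gauge_fun U y < 1"
    then show "y \<in> U" using inT[of y 1] by (simp add: T_def)
  next
    fix y assume y: "y \<in> U"
    then obtain e where e: "e > 0" "ball y e \<subseteq> U" using assms openE by blast
    \<comment> \<open>Openness of \<open>U\<close> must make the gauge strictly less than 1: with
      this \<open>s\<close> the dilate \<open>(1 + s) *\<^sub>R y\<close> stays within distance
      \<open>e\<close> of \<open>y\<close>.\<close>
    define s where "s = e / (2 * (norm y + 1))"
    have s: "s > 0" using e by (auto simp: s_def intro!: divide_pos_pos add_nonneg_pos)
    have "dist y ((1 + s) *\<^sub>R y) = s * norm y" using s by (simp add: dist_norm algebra_simps)
    also have "\<dots> = e * (norm y / (2 * (norm y + 1)))" by (simp add: s_def)
    also have "\<dots> < e * 1"
    proof (intro mult_strict_left_mono)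
      show "norm y / (2 * (norm y + 1)) < 1"
      proof -
        have "0 < 2 * (norm y + 1)" "norm y < 1 * (2 * (norm y + 1))"
          using norm_ge_zero[of y] by (simp_all add: algebra_simps add_nonneg_pos del: norm_ge_zero)
        then show ?thesis by (simp only: pos_divide_less_eq)
      qed
    qed (use e in simp)
    also have "\<dots> = e" by simp
    finally have "(1 + s) *\<^sub>R y \<in> U" using e by auto
    then have "1 / (1 + s) \<in> T y" using s by (simp add: T_def)
    from le[OF this] have "gauge_fun U y \<le> 1 / (1 + s)" .
    also have "\<dots> < 1" using s by simp
    finally show "gauge_fun U y < 1" .
  qed
qed

context
  fixes p :: "'a::real_normed_vector \<Rightarrow> real" and K :: real
  assumes p: "sublinear p" and K: "\<And>y. p y \<le> K * norm y"
begin

text \<open>Subadditivity turns the one-sided linear bound into a Lipschitz bound with the same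
  constant; this yields both continuity and equicontinuity of families.\<close>

lemma sublinear_Lipschitz: "\<bar>p x - p y\<bar> \<le> K * norm (x - y)"
proof -
  have "p x \<le> p (x - y) + p y" "p y \<le> p (y - x) + p x"
    using sublinearD(2)[OF p, of "x - y" y] sublinearD(2)[OF p, of "y - x" x] by auto
  then show ?thesis using K[of "x - y"] K[of "y - x"] by (simp add: norm_minus_commute)
qed

lemma continuous_on_sublinear: "continuous_on S p"
proof -
  have "isCont p x" for x
  proof -
    have "((\<lambda>y. K * norm (y - x)) \<longlongrightarrow> K * norm (x - x)) (at x)" by (intro tendsto_intros)
    then have "((\<lambda>y. K * norm (y - x)) \<longlongrightarrow> 0) (at x)" by simp
    then have "((\<lambda>y. p y - p x) \<longlongrightarrow> 0) (at x)"
      by (rule Lim_null_comparison[rotated]) (use sublinear_Lipschitz in simp)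
    then show ?thesis by (simp add: isCont_def LIM_zero_iff)
  qed
  then show ?thesis by (simp add: continuous_at_imp_continuous_on)
qed

lemma open_sublevel: "open {y. p y < 1}"
  using continuous_on_sublinear[of UNIV] by (intro open_Collect_less continuous_on_const)

lemma convex_sublevel: "convex {y. p y < 1}"
proof (rule convexI, clarify)
  fix x y and u v :: real
  assume "p x < 1" "p y < 1" and uv: "0 \<le> u" "0 \<le> v" "u + v = 1"
  have "p (u *\<^sub>R x + v *\<^sub>R y) \<le> u * p x + v * p y"
    using sublinearD(2)[OF p, of "u *\<^sub>R x" "v *\<^sub>R y"] uv by (simp add: sublinearD(3)[OF p])
  also have "\<dots> < 1" using \<open>p x < 1\<close> \<open>p y < 1\<close> uv
    by (rule convex_bound_lt)
  finally show "p (u *\<^sub>R x + v *\<^sub>R y) < 1" .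
qed

text \<open>A point of gauge at most 1 is the limit of its contractions towards 0, whose gauge is
  less than 1.\<close>

lemma closure_sublevel: "closure {y. p y < 1} = {y. p y \<le> 1}"
proof
  have "closed {y. p y \<le> 1}"
    using continuous_on_sublinear[of UNIV] by (intro closed_Collect_le continuous_on_const)
  then show "closure {y. p y < 1} \<subseteq> {y. p y \<le> 1}" by (intro closure_minimal) auto
  show "{y. p y \<le> 1} \<subseteq> closure {y. p y < 1}"
  proof clarify
    fix y assume y: "p y \<le> 1"
    have "(\<lambda>n. (1 - 1 / real (Suc n)) *\<^sub>R y) \<longlonglongrightarrow> (1 - 0) *\<^sub>R y"
      by (intro tendsto_intros lim_1_over_n[THEN LIMSEQ_Suc])
    moreover have "(1 - 1 / real (Suc n)) *\<^sub>R y \<in> {y. p y < 1}" for n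
    proof -
      have "p ((1 - 1 / real (Suc n)) *\<^sub>R y) = (1 - 1 / real (Suc n)) * p y"
        by (rule sublinearD(3)[OF p]) simp
      also have "\<dots> \<le> (1 - 1 / real (Suc n)) * 1" using y by (intro mult_left_mono) auto
      also have "\<dots> < 1" by simp
      finally show ?thesis by simp
    qed
    ultimately show "y \<in> closure {y. p y < 1}"
      unfolding closure_sequential by (intro exI[of _ "\<lambda>n. (1 - 1 / real (Suc n)) *\<^sub>R y"]) auto
  qed
qed

end

text \<open>By homogeneity this is uniform convergence on the unit sphere, or equivalently on
  bounded sets.\<close>

definition gauge_tendsto :: "(nat \<Rightarrow> 'a::real_normed_vector \<Rightarrow> real) \<Rightarrow> ('a \<Rightarrow> real) \<Rightarrow> bool" where
  "gauge_tendsto P p \<longleftrightarrow>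
     (\<forall>e>0. \<forall>\<^sub>F n in sequentially. \<forall>y. \<bar>P n y - p y\<bar> \<le> e * norm y)"

text \<open>The common bound \<open>K\<close> gives a common Lipschitz constant, so Arzela-Ascoli
  applies on the closed unit ball; homogeneity spreads the uniform convergence to the whole
  space.\<close>

lemma sublinear_sequence_compact:
  fixes P :: "nat \<Rightarrow> 'a::euclidean_space \<Rightarrow> real"
  assumes P: "\<And>n. sublinear (P n)" and K: "\<And>n y. P n y \<le> K * norm y"
  shows "\<exists>k p. strict_mono (k :: nat \<Rightarrow> nat) \<and> sublinear p \<and> (\<forall>y. p y \<le> K * norm y) \<and>
    gauge_tendsto (P \<circ> k) p"
proof -
  have "K * norm y \<ge> 0" for y :: 'a using sublinearD(1)[OF P[of 0], of y] K[of 0 y] by linarith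
  then have Kn: "K * norm y \<le> \<bar>K\<bar> * norm y" for y :: 'a by (simp add: mult_right_mono)
  obtain g k where k: "strict_mono (k :: nat \<Rightarrow> nat)"
    and u: "\<And>e. 0 < e \<Longrightarrow> \<exists>N. \<forall>n x. n \<ge> N \<and> x \<in> cball 0 1 \<longrightarrow> norm (P (k n) x - g x) < e"
  proof (rule Arzela_Ascoli[of "cball (0::'a) 1" P "\<bar>K\<bar>"])
    show "norm (P n x) \<le> \<bar>K\<bar>" if "x \<in> cball 0 1" for n x
    proof -
      have "P n x \<le> \<bar>K\<bar> * norm x" using K[of n x] Kn[of x] by linarith
      also have "\<dots> \<le> \<bar>K\<bar> * 1" using that by (intro mult_left_mono) auto
      finally show ?thesis using sublinearD(1)[OF P[of n], of x] by simp
    qed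
    fix x :: 'a and e :: real assume "0 < e"
    show "\<exists>d>0. \<forall>n y. y \<in> cball 0 1 \<and> norm (x - y) < d \<longrightarrow> norm (P n x - P n y) < e"
    proof (intro exI[of _ "e / (\<bar>K\<bar> + 1)"] conjI allI impI)
      show "0 < e / (\<bar>K\<bar> + 1)" using \<open>0 < e\<close> by simp
      fix n y assume "y \<in> cball 0 1 \<and> norm (x - y) < e / (\<bar>K\<bar> + 1)"
      then have 1: "(\<bar>K\<bar> + 1) * norm (x - y) < e" by (simp add: field_simps)
      have "norm (P n x - P n y) \<le> K * norm (x - y)"
        using sublinear_Lipschitz[OF P K] by simp
      also have "\<dots> \<le> (\<bar>K\<bar> + 1) * norm (x - y)" by (intro mult_right_mono) auto
      finally show "norm (P n x - P n y) < e" using 1 by linarith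
    qed
  qed auto
  \<comment> \<open>Only the values of \<open>g\<close> on the unit sphere matter; the factor
    \<open>norm y\<close> gives \<open>p 0 = 0\<close>.\<close>
  define p where "p = (\<lambda>y. norm y * g ((1 / norm y) *\<^sub>R y))"
  have conv: "gauge_tendsto (P \<circ> k) p"
    unfolding gauge_tendsto_def
  proof (intro allI impI)
    fix e :: real assume "e > 0"
    from u[OF this] obtain N where N: "\<And>n x. n \<ge> N \<Longrightarrow> x \<in> cball 0 1 \<Longrightarrow> norm (P (k n) x - g x) < e"
      by blast
    have "\<bar>(P \<circ> k) n y - p y\<bar> \<le> e * norm y" if "n \<ge> N" for n y
    proof (cases "y = 0")
      case True then show ?thesis by (simp add: p_def sublinear_0[OF P])
    next
      case False
      define x where "x = (1 / norm y) *\<^sub>R y"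
      have y: "y = norm y *\<^sub>R x" using False by (simp add: x_def)
      have "P (k n) y = norm y * P (k n) x"
        using sublinearD(3)[OF P[of "k n"], of "norm y" x] y by simp
      then have "(P \<circ> k) n y - p y = norm y * (P (k n) x - g x)"
        by (simp add: p_def x_def algebra_simps)
      then show ?thesis using N[OF that, of x] False
        by (simp add: abs_mult x_def mult.commute mult_left_mono)
    qed
    then show "\<forall>\<^sub>F n in sequentially. \<forall>y. \<bar>(P \<circ> k) n y - p y\<bar> \<le> e * norm y"
      using eventually_sequentially by blast
  qed
  have lim: "(\<lambda>n. P (k n) y) \<longlonglongrightarrow> p y" for y
  proof (rule LIMSEQ_I)
    fix r :: real assume "r > 0"
    define e where "e = r / (norm y + 1)"
    have "e > 0" using \<open>r > 0\<close> by (simp add: e_def add_nonneg_pos)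
    have "r * norm y < r * (norm y + 1)" using \<open>r > 0\<close> by simp
    then have "e * norm y < r" by (simp add: e_def pos_divide_less_eq add_nonneg_pos)
    moreover obtain N where "\<And>n. n \<ge> N \<Longrightarrow> \<bar>(P \<circ> k) n y - p y\<bar> \<le> e * norm y"
      using conv \<open>e > 0\<close> unfolding gauge_tendsto_def eventually_sequentially by metis
    ultimately show "\<exists>no. \<forall>n\<ge>no. norm (P (k n) y - p y) < r"
      unfolding real_norm_def comp_def using le_less_trans by blast
  qed
  have "sublinear p"
    unfolding sublinear_def
  proof (intro conjI allI impI)
    show "0 \<le> p x" for x
      by (rule LIMSEQ_le_const[OF lim]) (use sublinearD(1)[OF P] in blast)
    show "p (x + y) \<le> p x + p y" for x y
      by (rule LIMSEQ_le[OF lim tendsto_add[OF lim lim]]) (use sublinearD(2)[OF P] in blast)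
    show "p (c *\<^sub>R x) = c * p x" if "0 \<le> c" for c x
      using LIMSEQ_unique[OF lim[of "c *\<^sub>R x"]] tendsto_mult_left[OF lim[of x], of c]
      by (simp add: sublinearD(3)[OF P that])
  qed
  moreover have "p y \<le> K * norm y" for y
    by (rule LIMSEQ_le_const2[OF lim]) (use K in blast)
  ultimately show ?thesis using k conv by blast
qed

lemma hausdorff_distance_le:
  assumes "\<And>a. a \<in> A \<Longrightarrow> \<exists>b\<in>B. dist a b \<le> r" "\<And>b. b \<in> B \<Longrightarrow> \<exists>a\<in>A. dist b a \<le> r"
  shows "hausdorff_distance A B \<le> ennreal r"
  unfolding hausdorff_distance_def
proof (intro max.boundedI SUP_least)
  fix a assume "a \<in> A"
  with assms obtain b where "b \<in> B" "dist a b \<le> r" by blast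
  then show "(INF b\<in>B. ennreal (dist a b)) \<le> ennreal r"
    by (meson INF_lower2 ennreal_leI)
next
  fix b assume "b \<in> B"
  with assms obtain a where "a \<in> A" "dist a b \<le> r" by (metis dist_commute)
  then show "(INF a\<in>A. ennreal (dist a b)) \<le> ennreal r"
    by (meson INF_lower2 ennreal_leI)
qed

text \<open>The point \<open>b\<close> is the contraction of \<open>a\<close> by the factor
  \<open>1 / (1 + e * R)\<close>. A contraction towards 0 stays in the ball of radius
  \<open>R\<close>, so truncation of both sets to that ball causes no loss.\<close>

lemma sublevel_near_sublevel:
  fixes p q :: "'a::real_normed_vector \<Rightarrow> real"
  assumes q: "sublinear q" and "0 \<le> e" and near: "\<And>y. q y \<le> p y + e * norm y"
    and a: "p a \<le> 1" "norm a \<le> R"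
  shows "\<exists>b. q b \<le> 1 \<and> norm b \<le> R \<and> dist a b \<le> e * R * R"
proof -
  have R: "R \<ge> 0" using a(2) norm_ge_zero order_trans by blast
  define s where "s = 1 / (1 + e * R)"
  have s: "0 < s" "s \<le> 1" using \<open>0 \<le> e\<close> R by (auto simp: s_def add_pos_nonneg)
  have "q a \<le> 1 + e * R" using near[of a] a(1) mult_left_mono[OF a(2) \<open>0 \<le> e\<close>] by linarith
  then have "q (s *\<^sub>R a) \<le> s * (1 + e * R)" using s by (simp add: sublinearD(3)[OF q])
  also have "\<dots> = 1" using \<open>0 \<le> e\<close> R by (simp add: s_def add_nonneg_eq_0_iff)
  finally have 1: "q (s *\<^sub>R a) \<le> 1" .
  have 2: "norm (s *\<^sub>R a) \<le> R" using s a(2) mult_right_mono[OF s(2), of "norm a"] by simp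
  have "1 - s = s * (e * R)" using \<open>0 \<le> e\<close> R by (simp add: s_def field_simps add_nonneg_eq_0_iff)
  also have "\<dots> \<le> e * R" using s \<open>0 \<le> e\<close> R by (simp add: mult_left_le_one_le)
  finally have 3: "1 - s \<le> e * R" .
  have "dist a (s *\<^sub>R a) = (1 - s) * norm a"
    using s by (metis abs_of_nonneg diff_ge_0_iff_ge dist_norm norm_scaleR scaleR_left_diff_distrib scaleR_one)
  also have "\<dots> \<le> (e * R) * R" using 3 a(2) s R \<open>0 \<le> e\<close> by (intro mult_mono) auto
  finally show ?thesis using 1 2 by blast
qed

text \<open>This links convergence of gauges to the topology in which \<open>f\<close> is
  semicontinuous. The threshold radius can be taken to be 0, since all the sets contain the origin
  and points are moved only by contraction.\<close>

lemma gauge_tendsto_imp_local_hausdorff_tendsto: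
  fixes P :: "nat \<Rightarrow> 'a::real_normed_vector \<Rightarrow> real"
  assumes P: "\<And>n. sublinear (P n)" "\<And>n y. P n y \<le> K * norm y"
    and p: "sublinear p" "\<And>y. p y \<le> K * norm y" and lim: "gauge_tendsto P p"
  shows "local_hausdorff_tendsto (\<lambda>n. {y. P n y < 1}) {y. p y < 1}"
  unfolding local_hausdorff_tendsto_def
proof (intro exI[of _ 0] conjI allI impI)
  fix R :: real assume R: "0 \<le> R"
  have small: "\<forall>\<^sub>F n in sequentially.
      hausdorff_distance_upto R (closure {y. P n y < 1}) (closure {y. p y < 1}) \<le> ennreal (e * R * R)"
    if "e > 0" for e
    using lim[unfolded gauge_tendsto_def, rule_format, OF that]
  proof eventually_elim
    case (elim n)
    have cl: "closure {y. P n y < 1} = {y. P n y \<le> 1}" "closure {y. p y < 1} = {y. p y \<le> 1}"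
      using closure_sublevel P p by blast+
    have 1: "P n y \<le> p y + e * norm y" and 2: "p y \<le> P n y + e * norm y" for y
      using elim[rule_format, of y] by linarith+
    show ?case
      unfolding hausdorff_distance_upto_def cl
    proof (rule hausdorff_distance_le)
      show "\<exists>b\<in>{y. p y \<le> 1} \<inter> cball 0 R. dist a b \<le> e * R * R" if "a \<in> {y. P n y \<le> 1} \<inter> cball 0 R" for a
        using sublevel_near_sublevel[where p = "P n" and q = p and e = e and a = a and R = R] p(1) \<open>e > 0\<close> 2 that by auto
      show "\<exists>b\<in>{y. P n y \<le> 1} \<inter> cball 0 R. dist a b \<le> e * R * R" if "a \<in> {y. p y \<le> 1} \<inter> cball 0 R" for a
        using sublevel_near_sublevel[where p = p and q = "P n" and e = e and a = a and R = R] P(1) \<open>e > 0\<close> 1 that by auto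
    qed
  qed
  show "(\<lambda>n. hausdorff_distance_upto R (closure {y. P n y < 1}) (closure {y. p y < 1})) \<longlonglongrightarrow> 0"
  proof (rule order_tendstoI)
    fix a :: ennreal assume "0 < a"
    then obtain r where r: "0 < r" "ennreal r < a"
      by (metis dense ennreal_cases ennreal_less_zero_iff infinity_ennreal_def less_le_trans not_less top_greatest)
    \<comment> \<open>The choice gives \<open>e * R * R \<le> r\<close>; the summand 1 covers
      \<open>R = 0\<close>.\<close>
    define e where "e = r / (R * R + 1)"
    have "0 < R * R + 1" using R by (simp add: add_nonneg_pos)
    then have e: "e > 0" "e * R * R \<le> r" using r(1) by (auto simp: e_def field_simps)
    from small[OF e(1)]
    show "\<forall>\<^sub>F n in sequentially. hausdorff_distance_upto R (closure {y. P n y < 1}) (closure {y. p y < 1}) < a"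
      by eventually_elim (meson e(2) ennreal_leI le_less_trans r(2))
  qed simp
qed simp

section \<open>Matrices of maximal determinant\<close>

lemma norm_vec_le_sum: "norm x \<le> (\<Sum>i\<in>UNIV. norm (x $ i))"
  unfolding norm_vec_def by (rule L2_set_le_sum) auto

lemma continuous_on_det: "continuous_on S (\<lambda>E :: complex ^ 'd ^ 'd. det E)"
  unfolding det_def
  by (intro continuous_on_sum continuous_on_mult continuous_on_const continuous_on_prod
      continuous_on_component continuous_on_id)

text \<open>A matrix of maximal determinant with columns in \<open>S\<close>, as in the construction of an Auerbach basis.\<close>

lemma exists_Auerbach_matrix:
  fixes S :: "(complex ^ 'd) set"
  assumes "compact S" and "r > 0" and r: "cball 0 r \<subseteq> S"
  obtains E :: "complex ^ 'd ^ 'd" where "det E \<noteq> 0" "\<And>i. column i E \<in> S"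
    "\<And>x i. E *v x \<in> S \<Longrightarrow> norm (x $ i) \<le> 1"
proof -
  define M where "M = {E :: complex ^ 'd ^ 'd. \<forall>i. column i E \<in> S}"
  have colcont: "continuous_on UNIV (\<lambda>E :: complex ^ 'd ^ 'd. column i E)" for i
    unfolding column_def by (intro continuous_on_vec_lambda continuous_on_component continuous_on_id)
  have "closed M"
  proof -
    have "M = (\<Inter>i. (\<lambda>E. column i E) -` S)" by (auto simp: M_def)
    moreover have "closed ((\<lambda>E :: complex ^ 'd ^ 'd. column i E) -` S)" for i
      using closed_vimage[OF compact_imp_closed[OF \<open>compact S\<close>] colcont] .
    ultimately show ?thesis by auto
  qed
  moreover have "bounded M"
  proof -
    obtain b where b: "\<And>y. y \<in> S \<Longrightarrow> norm y \<le> b"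
      using compact_imp_bounded[OF \<open>compact S\<close>] by (auto simp: bounded_iff)
    have "norm E \<le> of_nat CARD('d) * (of_nat CARD('d) * b)" if "E \<in> M" for E
    proof -
      have "norm (E $ i $ j) \<le> b" for i j
      proof -
        have "norm (E $ i $ j) = norm (column j E $ i)" by (simp add: column_def)
        also have "\<dots> \<le> norm (column j E)" by (rule Finite_Cartesian_Product.norm_nth_le)
        also have "\<dots> \<le> b" using that b by (simp add: M_def)
        finally show ?thesis .
      qed
      then have "norm (E $ i) \<le> of_nat CARD('d) * b" for i
        by (rule order_trans[OF norm_vec_le_sum sum_bounded_above])
      then show ?thesis by (rule order_trans[OF norm_vec_le_sum sum_bounded_above])
    qed
    then show ?thesis by (auto simp: bounded_iff)
  qed
  ultimately have "compact M" by (simp add: compact_eq_bounded_closed)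
  have r1: "(of_real r :: complex) *s axis i 1 \<in> S" for i
  proof -
    have "norm ((of_real r :: complex) *s (axis i 1 :: complex ^ 'd)) = r"
      using \<open>r > 0\<close> by (simp add: norm_smult)
    then show ?thesis using r by auto
  qed
  \<comment> \<open>A multiple of the identity is admissible, which makes the maximal determinant
    nonzero.\<close>
  define E0 :: "complex ^ 'd ^ 'd" where "E0 = mat (of_real r)"
  have "column i E0 = (of_real r :: complex) *s axis i 1" for i
    by (simp add: column_def E0_def mat_def vec_eq_iff axis_def)
  then have "E0 \<in> M" using r1 by (simp add: M_def)
  have "det E0 = of_real r ^ CARD('d)"
    unfolding E0_def by (subst det_diagonal) (auto simp: mat_def)
  then have d0: "norm (det E0) > 0" using \<open>r > 0\<close> by (simp add: norm_power)
  have "continuous_on M (\<lambda>E. norm (det E))"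
    by (intro continuous_on_norm continuous_on_det)
  then obtain E where E: "E \<in> M" "\<And>E'. E' \<in> M \<Longrightarrow> norm (det E') \<le> norm (det E)"
    using continuous_attains_sup[OF \<open>compact M\<close>, of "\<lambda>E. norm (det E)"] \<open>E0 \<in> M\<close> by blast
  have dE: "det E \<noteq> 0" using E(2)[OF \<open>E0 \<in> M\<close>] d0 by auto
  have "norm (x $ k) \<le> 1" if x: "E *v x \<in> S" for x k
  proof -
    \<comment> \<open>Replacing column \<open>k\<close> by the point \<open>E *v x\<close> of
      \<open>S\<close> multiplies the determinant by \<open>x $ k\<close>, by Cramer's rule;
      maximality then bounds that coordinate.\<close>
    define E' :: "complex ^ 'd ^ 'd" where "E' = (\<chi> i j. if j = k then (E *v x) $ i else E $ i $ j)"
    have "column j E' = (if j = k then E *v x else column j E)" for j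
      by (simp add: column_def E'_def vec_eq_iff)
    then have "E' \<in> M" using E(1) x by (simp add: M_def)
    moreover have "det E' = x $ k * det E" unfolding E'_def by (rule cramer_lemma)
    ultimately show ?thesis using E(2)[of E'] dE by (simp add: norm_mult)
  qed
  then show ?thesis using that dE E(1) by (auto simp: M_def)
qed

section \<open>Weakly pseudoconvex boundary points\<close>

text \<open>The right-hand side is twice the complex-linear part of \<open>D\<close>, hence
  determined by its values on the coordinate vectors. In the Levi form it replaces Wirtinger
  derivatives by real directional ones.\<close>

lemma linear_complex_expansion:
  fixes D :: "complex ^ 'd \<Rightarrow> real"
  assumes "linear D"
  shows "(\<Sum>j\<in>UNIV. (of_real (D (axis j 1)) - \<i> * of_real (D (axis j \<i>))) * v $ j) =
         of_real (D v) - \<i> * of_real (D (\<i> *s v))"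
proof -
  have D: "D w = (\<Sum>j\<in>UNIV. Re (w $ j) * D (axis j 1) + Im (w $ j) * D (axis j \<i>))" for w
  proof -
    have "w = (\<Sum>j\<in>UNIV. Re (w $ j) *\<^sub>R axis j 1 + Im (w $ j) *\<^sub>R axis j \<i>)"
      by (simp add: vec_eq_iff axis_def complex_eq_iff if_distrib sum.delta cong: if_cong)
    then have "D w = D (\<Sum>j\<in>UNIV. Re (w $ j) *\<^sub>R axis j 1 + Im (w $ j) *\<^sub>R axis j \<i>)" by simp
    also have "\<dots> = (\<Sum>j\<in>UNIV. Re (w $ j) * D (axis j 1) + Im (w $ j) * D (axis j \<i>))"
      using assms by (simp add: linear_sum linear_add linear_scale)
    finally show ?thesis .
  qed
  show ?thesis
    unfolding D[of v] D[of "\<i> *s v"] complex_eq_iff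
    by (simp add: sum_subtractf sum.distrib sum_negf algebra_simps)
qed

lemma C_k_on_has_derivative:
  assumes "C_k_on (Suc k) r U" "x \<in> U"
  shows "(r has_derivative frechet_derivative r (at x)) (at x)"
  using assms by (simp add: frechet_derivative_works)

lemma C_k_on_Suc_imp: "C_k_on (Suc k) r U \<Longrightarrow> C_k_on k r U"
proof (induction k arbitrary: r)
  case 0
  then show ?case
    by (auto simp: continuous_at_imp_continuous_on differentiable_imp_continuous_within)
next
  case (Suc k)
  have "C_k_on (Suc k) (\<lambda>x. frechet_derivative r (at x) v) U" for v
    using Suc.prems by simp
  then have "C_k_on k (\<lambda>x. frechet_derivative r (at x) v) U" for v
    by (rule Suc.IH)
  then show ?case using Suc.prems by simp
qed

text \<open>The direction comes first so that \<open>directional u\<close> is an operator on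
  functions and can be iterated.\<close>

definition directional :: "'a::euclidean_space \<Rightarrow> ('a \<Rightarrow> real) \<Rightarrow> 'a \<Rightarrow> real" where
  "directional u r x = frechet_derivative r (at x) u"

lemma directional_C_k_on: "C_k_on (Suc k) r U \<Longrightarrow> C_k_on k (directional u r) U"
  by (simp add: directional_def[abs_def])

lemma directional_has_real_derivative:
  assumes "C_k_on (Suc k) r U" "p + s *\<^sub>R u \<in> U"
  shows "((\<lambda>s. r (p + s *\<^sub>R u)) has_real_derivative directional u r (p + s *\<^sub>R u)) (at s)"
proof -
  have "((\<lambda>s. p + s *\<^sub>R u) has_derivative (\<lambda>h. h *\<^sub>R u)) (at s)"
    by (auto intro!: derivative_eq_intros)
  from has_derivative_compose[OF this C_k_on_has_derivative[OF assms]]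
  have "((\<lambda>s. r (p + s *\<^sub>R u)) has_derivative
      (\<lambda>h. frechet_derivative r (at (p + s *\<^sub>R u)) (h *\<^sub>R u))) (at s)" .
  moreover have "linear (frechet_derivative r (at (p + s *\<^sub>R u)))"
    using C_k_on_has_derivative[OF assms] has_derivative_linear by blast
  ultimately show ?thesis
    by (simp add: has_field_derivative_def directional_def linear_scale mult_commute_abs)
qed

text \<open>The third derivative along the line is continuous, hence bounded near \<open>p\<close>.
  The resulting cubic remainder is the source of the exponent 1/3 for the discs at a degenerate
  point.\<close>

lemma C3_Taylor_along_line:
  assumes C: "C_k_on 3 r U" and "open U" "p \<in> U"
  obtains B \<delta> where "B > 0" "\<delta> > 0"
    "\<And>s. \<bar>s\<bar> < \<delta> \<Longrightarrow> p + s *\<^sub>R u \<in> U \<and>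
       \<bar>r (p + s *\<^sub>R u) - (r p + s * directional u r p + s\<^sup>2 / 2 * directional u (directional u r) p)\<bar> \<le> B * \<bar>s\<bar> ^ 3"
proof -
  define f where "f = (\<lambda>i s. (directional u ^^ i) r (p + s *\<^sub>R u))"
  have C': "C_k_on (Suc (Suc (Suc 0))) r U" using C by (simp only: numeral_3_eq_3)
  have C2: "C_k_on (Suc (Suc 0)) (directional u r) U" by (rule directional_C_k_on[OF C'])
  have C1: "C_k_on (Suc 0) (directional u (directional u r)) U" by (rule directional_C_k_on[OF C2])
  have C0: "continuous_on U (directional u (directional u (directional u r)))"
    using directional_C_k_on[OF C1] by simp
  have "isCont (\<lambda>s. directional u (directional u (directional u r)) (p + s *\<^sub>R u)) 0"
  proof (rule isCont_o2[where f = "\<lambda>s. p + s *\<^sub>R u"])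
    show "isCont (directional u (directional u (directional u r))) (p + 0 *\<^sub>R u)"
      using C0 assms(2,3) by (simp add: continuous_on_eq_continuous_at)
  qed simp
  then have "\<forall>\<^sub>F s in at 0. dist (f 3 s) (f 3 0) < 1"
    unfolding isCont_def f_def numeral_3_eq_3 by (intro tendstoD) auto
  moreover have "\<forall>\<^sub>F s in at 0. p + s *\<^sub>R u \<in> U"
  proof (rule topological_tendstoD[OF _ assms(2)])
    have "((\<lambda>s. p + s *\<^sub>R u) \<longlongrightarrow> p + 0 *\<^sub>R u) (at 0)" by (intro tendsto_intros)
    then show "((\<lambda>s. p + s *\<^sub>R u) \<longlongrightarrow> p) (at 0)" by simp
  qed (use assms in simp)
  ultimately have "\<forall>\<^sub>F s in at 0. dist (f 3 s) (f 3 0) < 1 \<and> p + s *\<^sub>R u \<in> U"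
    by (rule eventually_conj)
  then obtain \<delta> where "\<delta> > 0"
    and \<delta>: "\<And>s. s \<noteq> 0 \<Longrightarrow> dist s 0 < \<delta> \<Longrightarrow> dist (f 3 s) (f 3 0) < 1 \<and> p + s *\<^sub>R u \<in> U"
    unfolding eventually_at by auto
  have inU: "p + s *\<^sub>R u \<in> U" if "\<bar>s\<bar> < \<delta>" for s
    using \<delta>[of s] that \<open>p \<in> U\<close> by (cases "s = 0") auto
  define B where "B = \<bar>f 3 0\<bar> + 1"
  have "B > 0" by (simp add: B_def)
  have bd: "norm (f 3 s) \<le> B" if "s \<in> ball 0 \<delta>" for s
    using \<delta>[of s] that by (cases "s = 0") (auto simp: B_def dist_real_def)
  have der: "(f i has_field_derivative f (Suc i) s) (at s within ball 0 \<delta>)"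
    if s: "s \<in> ball 0 \<delta>" and i: "i \<le> 2" for i s
  proof -
    have U: "p + s *\<^sub>R u \<in> U" using inU s by simp
    consider "i = 0" | "i = 1" | "i = 2" using i by linarith
    then have "(f i has_field_derivative f (Suc i) s) (at s)"
    proof cases
      case 1 then show ?thesis using directional_has_real_derivative[OF C' U] by (simp add: f_def)
    next
      case 2 then show ?thesis using directional_has_real_derivative[OF C2 U] by (simp add: f_def)
    next
      case 3 then show ?thesis using directional_has_real_derivative[OF C1 U]
        by (simp add: f_def numeral_2_eq_2)
    qed
    then show ?thesis by (rule has_field_derivative_at_within)
  qed
  have "\<bar>r (p + s *\<^sub>R u) - (r p + s * directional u r p + s\<^sup>2 / 2 * directional u (directional u r) p)\<bar>
      \<le> B * \<bar>s\<bar> ^ 3" if s: "\<bar>s\<bar> < \<delta>" for s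
  proof -
    have "norm (f 0 s - (\<Sum>i\<le>2. f i 0 * (s - 0) ^ i / fact i)) \<le> B * norm (s - 0) ^ Suc 2 / fact 2"
      by (rule field_Taylor[where S = "ball 0 \<delta>"])
        (use der bd s \<open>\<delta> > 0\<close> in \<open>auto simp: numeral_3_eq_3 numeral_2_eq_2 dist_real_def\<close>)
    also have "\<dots> \<le> B * \<bar>s\<bar> ^ 3" using \<open>B > 0\<close> zero_le_power[of "\<bar>s\<bar>" 3] by simp
    finally show ?thesis
      by (simp add: f_def numeral_2_eq_2 algebra_simps)
  qed
  then show ?thesis using that[OF \<open>B > 0\<close> \<open>\<delta> > 0\<close>] inU by blast
qed

text \<open>This is -2 times the covector of the derivatives of \<open>r\<close> in the
  \<open>z\<close> variables. The sign and factor make \<open>Re (cdot (conormal r x) h)\<close> the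
  derivative of \<open>-r\<close> along \<open>h\<close>, positive for directions into the
  domain.\<close>

definition conormal :: "(complex ^ 'd \<Rightarrow> real) \<Rightarrow> complex ^ 'd \<Rightarrow> complex ^ 'd" where
  "conormal r x = (\<chi> j. - (of_real (directional (axis j 1) r x) - \<i> * of_real (directional (axis j \<i>) r x)))"

lemma Re_cdot_conormal:
  assumes "r differentiable (at x)"
  shows "frechet_derivative r (at x) h = - Re (cdot (conormal r x) h)"
proof -
  have "linear (frechet_derivative r (at x))"
    using assms frechet_derivative_works has_derivative_linear by blast
  from arg_cong[OF linear_complex_expansion[OF this, of h], of Re]
  show ?thesis by (simp add: cdot_def conormal_def directional_def algebra_simps flip: sum_negf)
qed

lemma deriv_z_of_real:
  assumes "r differentiable (at x)"
  shows "deriv_z j (\<lambda>z. of_real (r z)) x =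
    (of_real (directional (axis j 1) r x) - \<i> * of_real (directional (axis j \<i>) r x)) / 2"
proof -
  have "((\<lambda>z. complex_of_real (r z)) has_derivative (\<lambda>h. of_real (frechet_derivative r (at x) h))) (at x)"
    using assms by (intro has_derivative_of_real) (simp add: frechet_derivative_works)
  then have "frechet_derivative (\<lambda>z. complex_of_real (r z)) (at x) = (\<lambda>h. of_real (frechet_derivative r (at x) h))"
    by (metis frechet_derivative_at)
  then show ?thesis by (simp add: deriv_z_def directional_def)
qed

lemma complex_tangent_space_eq:
  assumes "r differentiable (at x)"
  shows "v \<in> complex_tangent_space r x \<longleftrightarrow> cdot (conormal r x) v = 0"
proof -
  have "(\<Sum>j\<in>UNIV. deriv_z j (\<lambda>z. of_real (r z)) x * v $ j) = - cdot (conormal r x) v / 2"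
    by (simp add: deriv_z_of_real[OF assms] cdot_def conormal_def sum_divide_distrib sum_negf[symmetric]
        field_simps del: sum_negf)
  then show ?thesis by (simp add: complex_tangent_space_def)
qed

text \<open>Expanding the derivatives in the \<open>z\<close> and then in the conjugate variables
  leaves the pure second derivatives along \<open>v\<close> and \<open>\<i> *s v\<close> in the real
  part. Convexity will make each of them nonnegative separately.\<close>

lemma Re_levi_form:
  fixes r :: "complex ^ 'd \<Rightarrow> real"
  assumes C: "C_k_on 2 r U" and "open U" "p \<in> U"
  shows "Re (levi_form r p v) =
    (directional v (directional v r) p + directional (\<i> *s v) (directional (\<i> *s v) r) p) / 4"
proof -
  have C2: "C_k_on (Suc (Suc 0)) r U" using C by (simp only: numeral_2_eq_2)
  define H where "H = (\<lambda>a b. directional b (directional a r) p)"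
  have dH: "(directional a r has_derivative H a) (at p)" for a
    using C_k_on_has_derivative[OF directional_C_k_on[OF C2] \<open>p \<in> U\<close>, of a]
    by (simp add: H_def directional_def[abs_def])
  have diffU: "r differentiable (at x)" if "x \<in> U" for x using C2 that by simp
  have lin2: "linear (H a)" for a using dH has_derivative_linear by blast
  have linU: "linear (\<lambda>a. directional a r x)" if "x \<in> U" for x
    using C_k_on_has_derivative[OF C2 that] has_derivative_linear by (auto simp: directional_def)
  \<comment> \<open>Linearity in the direction differentiated first is obtained from linearity of
    \<open>directional\<close> on all of \<open>U\<close>, by differentiating at \<open>p\<close>
    and using uniqueness of the derivative.\<close>
  have lin1: "linear (\<lambda>a. H a b)" for b
  proof (rule linearI)
    fix a a' and c :: real
    have "(directional (a + a') r has_derivative (\<lambda>h. H a h + H a' h)) (at p)"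
      by (rule has_derivative_transform_within_open[OF has_derivative_add[OF dH dH] \<open>open U\<close> \<open>p \<in> U\<close>])
        (simp add: linear_add[OF linU])
    then show "H (a + a') b = H a b + H a' b"
      using has_derivative_unique[OF dH] by metis
    have "(directional (c *\<^sub>R a) r has_derivative (\<lambda>h. c *\<^sub>R H a h)) (at p)"
      by (rule has_derivative_transform_within_open[OF has_derivative_scaleR_right[OF dH] \<open>open U\<close> \<open>p \<in> U\<close>])
        (simp add: linear_scale[OF linU])
    then show "H (c *\<^sub>R a) b = c *\<^sub>R H a b"
      using has_derivative_unique[OF dH] by metis
  qed
  have z: "frechet_derivative (deriv_z j (\<lambda>z. of_real (r z))) (at p) b =
      (of_real (H (axis j 1) b) - \<i> * of_real (H (axis j \<i>) b)) / 2" for j b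
  proof -
    have "((\<lambda>x. (of_real (directional (axis j 1) r x) - \<i> * of_real (directional (axis j \<i>) r x)) / 2) has_derivative
        (\<lambda>b. (of_real (H (axis j 1) b) - \<i> * of_real (H (axis j \<i>) b)) / 2)) (at p)"
      by (intro bounded_linear.has_derivative[OF bounded_linear_divide] has_derivative_diff has_derivative_mult_right has_derivative_of_real dH)
    then have "(deriv_z j (\<lambda>z. of_real (r z)) has_derivative
        (\<lambda>b. (of_real (H (axis j 1) b) - \<i> * of_real (H (axis j \<i>) b)) / 2)) (at p)"
      by (rule has_derivative_transform_within_open[OF _ \<open>open U\<close> \<open>p \<in> U\<close>])
        (rule deriv_z_of_real[OF diffU, symmetric])
    from frechet_derivative_at[OF this] show ?thesis by (rule fun_cong[OF sym])
  qed
  define X where "X = (\<lambda>b. H v b)"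
  define Y where "Y = (\<lambda>b. H (\<i> *s v) b)"
  have inner_sum: "(\<Sum>j\<in>UNIV. frechet_derivative (deriv_z j (\<lambda>z. of_real (r z))) (at p) b * v $ j) =
      (of_real (X b) - \<i> * of_real (Y b)) / 2" for b
    using linear_complex_expansion[OF lin1[of b], of v]
    by (simp add: z X_def Y_def flip: sum_divide_distrib)
  have "levi_form r p v = (\<Sum>k\<in>UNIV. \<Sum>j\<in>UNIV.
      deriv_zbar k (deriv_z j (\<lambda>z. of_real (r z))) p * v $ j * cnj (v $ k))"
    unfolding levi_form_def by (rule sum.swap)
  also have "\<dots> = (\<Sum>k\<in>UNIV. ((of_real (X (axis k 1)) - \<i> * of_real (Y (axis k 1))) / 2 +
      \<i> * ((of_real (X (axis k \<i>)) - \<i> * of_real (Y (axis k \<i>))) / 2)) / 2 * cnj (v $ k))"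
    unfolding inner_sum[symmetric]
  proof (rule sum.cong[OF refl])
    fix k
    have "(\<Sum>j\<in>UNIV. (a j + \<i> * b j) / 2 * v $ j * c) =
        ((\<Sum>j\<in>UNIV. a j * v $ j) + \<i> * (\<Sum>j\<in>UNIV. b j * v $ j)) / 2 * c" for a b :: "'d \<Rightarrow> complex" and c
    proof -
      have "(\<Sum>j\<in>UNIV. (a j + \<i> * b j) / 2 * v $ j * c) =
          (\<Sum>j\<in>UNIV. (a j * v $ j + \<i> * (b j * v $ j)) / 2 * c)"
        by (rule sum.cong) (auto simp: algebra_simps)
      also have "\<dots> = (\<Sum>j\<in>UNIV. a j * v $ j + \<i> * (b j * v $ j)) / 2 * c"
        by (simp only: sum_distrib_right sum_divide_distrib)
      finally show ?thesis by (simp add: sum.distrib sum_distrib_left)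
    qed
    then show "(\<Sum>j\<in>UNIV. deriv_zbar k (deriv_z j (\<lambda>z. of_real (r z))) p * v $ j * cnj (v $ k)) =
        ((\<Sum>j\<in>UNIV. frechet_derivative (deriv_z j (\<lambda>z. of_real (r z))) (at p) (axis k 1) * v $ j) +
        \<i> * (\<Sum>j\<in>UNIV. frechet_derivative (deriv_z j (\<lambda>z. of_real (r z))) (at p) (axis k \<i>) * v $ j)) / 2 * cnj (v $ k)"
      by (simp add: deriv_zbar_def)
  qed
  also have "\<dots> = (cnj (\<Sum>k\<in>UNIV. (of_real (X (axis k 1)) - \<i> * of_real (X (axis k \<i>))) * v $ k) -
      \<i> * cnj (\<Sum>k\<in>UNIV. (of_real (Y (axis k 1)) - \<i> * of_real (Y (axis k \<i>))) * v $ k)) / 4"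
    unfolding cnj_sum sum_distrib_left sum_subtractf[symmetric] sum_divide_distrib
    by (rule sum.cong) (auto simp: complex_eq_iff field_simps)
  also have "\<dots> = (cnj (of_real (X v) - \<i> * of_real (X (\<i> *s v))) -
      \<i> * cnj (of_real (Y v) - \<i> * of_real (Y (\<i> *s v)))) / 4"
    using linear_complex_expansion[of X v] linear_complex_expansion[of Y v] lin2
    by (simp add: X_def Y_def)
  finally have "levi_form r p v = (cnj (of_real (X v) - \<i> * of_real (X (\<i> *s v))) -
      \<i> * cnj (of_real (Y v) - \<i> * of_real (Y (\<i> *s v)))) / 4" .
  then show ?thesis
    by (simp only: Re_divide_numeral) (simp add: X_def Y_def H_def)
qed


section \<open>Convex domains near a boundary point with a defining function\<close>

context
  fixes \<Omega> :: "(complex ^ 'd) set" and p r U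
  assumes dom: "convex_domain \<Omega>" and p: "p \<in> frontier \<Omega>"
    and ldf: "local_defining_function \<Omega> p U r"
begin

lemma defining_function_facts:
  shows "open U" "p \<in> U" "p \<notin> \<Omega>" "r p = 0" "r differentiable (at p)"
    "\<And>x. x \<in> U \<Longrightarrow> x \<in> \<Omega> \<longleftrightarrow> r x < 0"
proof -
  have C: "C_k_on (Suc 0) r U" using ldf by (simp add: local_defining_function_def)
  show U: "open U" "p \<in> U" and iff: "\<And>x. x \<in> U \<Longrightarrow> x \<in> \<Omega> \<longleftrightarrow> r x < 0"
    using ldf by (auto simp: local_defining_function_def set_eq_iff)
  show "r differentiable (at p)" using C U by simp
  show "p \<notin> \<Omega>" using p dom by (simp add: frontier_def convex_domain_def interior_open)
  then have "0 \<le> r p" using iff[OF U(2)] by simp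
  moreover have "r p \<le> 0"
  proof (rule ccontr)
    assume "\<not> r p \<le> 0"
    have cont: "continuous_on U r" by (rule C_k_on_Suc_imp[OF C, simplified])
    have "open {x \<in> U. 0 < r x}"
    proof -
      have "{x \<in> U. 0 < r x} = U \<inter> r -` {0<..}" by auto
      then show ?thesis using continuous_open_preimage[OF cont U(1) open_greaterThan[of 0]] by simp
    qed
    moreover have "p \<in> closure \<Omega>" using p by (simp add: frontier_def)
    moreover have "p \<in> {x \<in> U. 0 < r x}" using \<open>\<not> r p \<le> 0\<close> U by simp
    ultimately obtain x where "x \<in> \<Omega>" "x \<in> U" "0 < r x"
      by (auto simp: closure_iff_nhds_not_empty)
    then show False using iff by force
  qed
  ultimately show "r p = 0" by simp
qed

lemma conormal_nonzero: "conormal r p \<noteq> 0"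
proof
  assume "conormal r p = 0"
  then have "frechet_derivative r (at p) = (\<lambda>v. 0)"
    using Re_cdot_conormal[OF defining_function_facts(5)] by (auto simp: cdot_def)
  then show False using ldf defining_function_facts(2) by (auto simp: local_defining_function_def)
qed

lemma real_derivative_defining_function:
  "((\<lambda>s. r (p + s *\<^sub>R w)) has_real_derivative - Re (cdot (conormal r p) w)) (at 0)"
proof -
  have "C_k_on (Suc 0) r U" using ldf by (simp add: local_defining_function_def)
  from directional_has_real_derivative[OF this, of p 0 w] show ?thesis
    using defining_function_facts(2) Re_cdot_conormal[OF defining_function_facts(5)]
    by (simp add: directional_def)
qed

text \<open>If the pairing were nonpositive at some \<open>y\<close> in the domain, a small push
  against \<open>n\<close> would make it negative. Then \<open>r\<close> increases from 0 along the
  segment from \<open>p\<close> to the pushed point, yet by convexity that segment lies in the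
  domain after \<open>p\<close>.\<close>

lemma convex_domain_subset_half_space:
  assumes "y \<in> \<Omega>"
  shows "0 < Re (cdot (conormal r p) (y - p))"
proof (rule ccontr)
  assume neg: "\<not> 0 < Re (cdot (conormal r p) (y - p))"
  define l where "l = conormal r p"
  obtain i where i: "l $ i \<noteq> 0" using conormal_nonzero by (auto simp: vec_eq_iff l_def)
  define n where "n = axis i (1 / l $ i)"
  have n: "cdot l n = 1" using i by (simp add: n_def cdot_axis)
  have op: "open \<Omega>" and cv: "convex \<Omega>" using dom by (auto simp: convex_domain_def)
  have "((\<lambda>s. y - s *\<^sub>R n) \<longlongrightarrow> y - 0 *\<^sub>R n) (at_right 0)" by (intro tendsto_intros)
  then have "\<forall>\<^sub>F s in at_right 0. y - s *\<^sub>R n \<in> \<Omega>"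
    using assms op by (auto dest: topological_tendstoD)
  moreover have "\<forall>\<^sub>F s::real in at_right 0. 0 < s" by (simp add: eventually_at_right_less)
  ultimately have "\<exists>s::real. y - s *\<^sub>R n \<in> \<Omega> \<and> 0 < s"
    using eventually_happens[OF eventually_conj] by (metis (mono_tags, lifting) trivial_limit_at_right_real)
  then obtain s :: real where s: "y - s *\<^sub>R n \<in> \<Omega>" "0 < s" by blast
  define w where "w = y - s *\<^sub>R n - p"
  have "Re (cdot l w) < 0"
  proof -
    have "cdot l w = cdot l (y - p) - s *\<^sub>R cdot l n"
      by (simp add: w_def cdot_diff cdot_scaleR)
    then show ?thesis using neg n s(2) by (simp add: l_def)
  qed
  then have "0 < - Re (cdot l w)" by simp
  from DERIV_pos_inc_right[OF real_derivative_defining_function this[unfolded l_def]]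
  obtain d where d: "d > 0" "\<And>h. h > 0 \<Longrightarrow> h < d \<Longrightarrow> 0 < r (p + h *\<^sub>R w)"
    using defining_function_facts(4) by auto
  have "((\<lambda>h. p + h *\<^sub>R w) \<longlongrightarrow> p + 0 *\<^sub>R w) (at_right 0)" by (intro tendsto_intros)
  then have "\<forall>\<^sub>F h in at_right 0. p + h *\<^sub>R w \<in> U"
    using defining_function_facts(1,2) by (auto dest: topological_tendstoD)
  moreover have "\<forall>\<^sub>F h in at_right 0. h \<in> {0<..<min d 1}"
    using d(1) by (intro eventually_at_right_field[THEN iffD2]) (auto intro!: exI[of _ "min d 1"])
  ultimately have "\<exists>h. p + h *\<^sub>R w \<in> U \<and> h \<in> {0<..<min d 1}"
    using eventually_happens[OF eventually_conj] by (metis (mono_tags, lifting) trivial_limit_at_right_real)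
  then obtain h where h: "p + h *\<^sub>R w \<in> U" "0 < h" "h < d" "h < 1" by auto
  \<comment> \<open>A segment from a point of the closure to an interior point stays in the
    interior, apart from its starting point.\<close>
  have "p - h *\<^sub>R (p - (y - s *\<^sub>R n)) \<in> interior \<Omega>"
    by (rule mem_interior_closure_convex_shrink[OF cv])
      (use s h p op in \<open>auto simp: interior_open frontier_def\<close>)
  then have "p + h *\<^sub>R w \<in> \<Omega>"
    by (simp add: interior_open[OF op] w_def algebra_simps)
  then show False using d(2)[of h] h defining_function_facts(6)[OF h(1)] by simp
qed

text \<open>To first order \<open>r\<close> equals \<open>- Re \<zeta>\<close> at
  \<open>p + \<zeta> *s n\<close>. Since \<eta> is arbitrary, these sectors widen under rescaling to
  a complex half-plane.\<close>

lemma cone_subset_domain: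
  assumes n: "cdot (conormal r p) n = 1" and "\<eta> > 0"
  shows "\<exists>\<delta>>0. \<forall>\<zeta>. \<zeta> \<noteq> 0 \<and> norm \<zeta> \<le> \<delta> \<and> \<eta> * norm \<zeta> \<le> Re \<zeta> \<longrightarrow> p + \<zeta> *s n \<in> \<Omega>"
proof -
  have "n \<noteq> 0" using n by (auto simp: cdot_zero)
  \<comment> \<open>With this tolerance the first-order error is at most half of
    \<open>\<eta> * norm \<zeta>\<close>.\<close>
  define e where "e = \<eta> / (2 * norm n)"
  have "e > 0" using \<open>\<eta> > 0\<close> \<open>n \<noteq> 0\<close> by (simp add: e_def)
  have "(r has_derivative frechet_derivative r (at p)) (at p)"
    using defining_function_facts(5) frechet_derivative_works by blast
  then obtain d where d: "d > 0"
    "\<And>y. norm (y - p) < d \<Longrightarrow> norm (r y - r p - frechet_derivative r (at p) (y - p)) \<le> e * norm (y - p)"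
    using \<open>e > 0\<close> unfolding has_derivative_at_alt by metis
  obtain d' where d': "d' > 0" "ball p d' \<subseteq> U" using defining_function_facts(1,2) openE by blast
  define \<delta> where "\<delta> = min d d' / (2 * norm n)"
  have "\<delta> > 0" using d d' \<open>n \<noteq> 0\<close> by (simp add: \<delta>_def)
  have "p + \<zeta> *s n \<in> \<Omega>" if z: "\<zeta> \<noteq> 0" "norm \<zeta> \<le> \<delta>" "\<eta> * norm \<zeta> \<le> Re \<zeta>" for \<zeta>
  proof -
    have "norm (\<zeta> *s n) \<le> \<delta> * norm n" using z(2) by (simp add: norm_smult mult_right_mono)
    also have "\<dots> = min d d' / 2" using \<open>n \<noteq> 0\<close> by (simp add: \<delta>_def)
    finally have sm: "norm (\<zeta> *s n) < d" "norm (\<zeta> *s n) < d'" using d(1) d'(1) by linarith+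
    have U: "p + \<zeta> *s n \<in> U" using sm(2) d'(2) by (auto simp: dist_norm)
    have "frechet_derivative r (at p) (\<zeta> *s n) = - Re \<zeta>"
      using Re_cdot_conormal[OF defining_function_facts(5), of "\<zeta> *s n"] n by (simp add: cdot_smult)
    then have "r (p + \<zeta> *s n) \<le> - Re \<zeta> + e * norm (\<zeta> *s n)"
      using d(2)[of "p + \<zeta> *s n"] sm(1) defining_function_facts(4) by simp
    also have "e * norm (\<zeta> *s n) = \<eta> * norm \<zeta> / 2"
      using \<open>n \<noteq> 0\<close> by (simp add: e_def norm_smult)
    finally have "r (p + \<zeta> *s n) \<le> - (\<eta> * norm \<zeta>) / 2" using z(3) by simp
    also have "\<dots> < 0" using \<open>\<eta> > 0\<close> z(1) by simp
    finally show ?thesis using defining_function_facts(6)[OF U] by simp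
  qed
  then show ?thesis using \<open>\<delta> > 0\<close> by blast
qed

text \<open>Otherwise \<open>p + s *\<^sub>R u\<close> and \<open>p - s *\<^sub>R u\<close> lie in
  the domain for small \<open>s\<close>, and so does their midpoint \<open>p\<close>, a boundary
  point of an open set.\<close>

lemma second_derivative_nonneg:
  assumes C: "C_k_on 3 r U" and u: "Re (cdot (conormal r p) u) = 0"
  shows "0 \<le> directional u (directional u r) p"
proof (rule ccontr)
  assume "\<not> 0 \<le> directional u (directional u r) p"
  define \<kappa> where "\<kappa> = - directional u (directional u r) p / 2"
  have "\<kappa> > 0" using \<open>\<not> _\<close> by (simp add: \<kappa>_def)
  have D0: "directional u r p = 0"
    using Re_cdot_conormal[OF defining_function_facts(5), of u] u by (simp add: directional_def)
  obtain B \<delta> where B: "B > 0" "\<delta> > 0"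
    "\<And>s. \<bar>s\<bar> < \<delta> \<Longrightarrow> p + s *\<^sub>R u \<in> U \<and>
       \<bar>r (p + s *\<^sub>R u) - (r p + s * directional u r p + s\<^sup>2 / 2 * directional u (directional u r) p)\<bar> \<le> B * \<bar>s\<bar> ^ 3"
    using C3_Taylor_along_line[OF C defining_function_facts(1,2)] by metis
  \<comment> \<open>At this scale the cubic remainder is smaller than the negative quadratic
    term.\<close>
  define s where "s = min (\<delta> / 2) (\<kappa> / (2 * B))"
  have s: "0 < s" "s < \<delta>" "B * s < \<kappa>"
  proof -
    show "0 < s" "s < \<delta>" using B \<open>\<kappa> > 0\<close> by (auto simp: s_def)
    have "B * s \<le> B * (\<kappa> / (2 * B))" using B by (intro mult_left_mono) (auto simp: s_def)
    also have "\<dots> < \<kappa>" using B \<open>\<kappa> > 0\<close> by simp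
    finally show "B * s < \<kappa>" .
  qed
  have "p + t *\<^sub>R u \<in> \<Omega>" if "\<bar>t\<bar> = s" for t
  proof -
    have t2: "t\<^sup>2 = s\<^sup>2" using that by (metis power2_abs)
    have "r (p + t *\<^sub>R u) \<le> B * s ^ 3 - \<kappa> * s\<^sup>2"
    proof -
      have "\<bar>r (p + t *\<^sub>R u) - s\<^sup>2 / 2 * directional u (directional u r) p\<bar> \<le> B * s ^ 3"
        using B(3)[of t] that s D0 defining_function_facts(4) by (simp add: t2)
      then show ?thesis by (simp add: abs_le_iff \<kappa>_def algebra_simps)
    qed
    also have "\<dots> = (B * s - \<kappa>) * s\<^sup>2" by (simp add: power2_eq_square power3_eq_cube algebra_simps)
    also have "\<dots> < 0" using s by (intro mult_neg_pos) auto
    finally show ?thesis using B(3)[of t] that s defining_function_facts(6) by simp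
  qed
  from this[of s] this[of "- s"] have "p + s *\<^sub>R u \<in> \<Omega>" "p + (- s) *\<^sub>R u \<in> \<Omega>"
    using s by auto
  then have "(1/2) *\<^sub>R (p + s *\<^sub>R u) + (1/2) *\<^sub>R (p + (- s) *\<^sub>R u) \<in> \<Omega>"
    using dom by (intro convexD) (auto simp: convex_domain_def)
  moreover have "(1/2) *\<^sub>R (p + s *\<^sub>R u) + (1/2) *\<^sub>R (p + (- s) *\<^sub>R u) = p"
    by (simp add: algebra_simps flip: scaleR_add_left)
  ultimately show False using defining_function_facts(3) by simp
qed

text \<open>Along \<open>u\<close> only the cubic remainder of \<open>r\<close> survives, while a
  move by \<open>t\<close> along \<open>n\<close> lowers \<open>r\<close> by more than
  \<open>t/2\<close>. The latter wins as long as the cube of \<open>s\<close> is small compared with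
  \<open>t\<close>.\<close>

lemma segment_in_degenerate_direction:
  assumes C: "C_k_on 3 r U" and u: "Re (cdot (conormal r p) u) = 0"
    and deg: "directional u (directional u r) p = 0" and n: "cdot (conormal r p) n = 1"
  shows "\<exists>c>0. \<exists>\<delta>>0. \<forall>t s. 0 < t \<and> t < \<delta> \<and> \<bar>s\<bar> < c * t powr (1/3) \<longrightarrow>
           p + t *\<^sub>R n + s *\<^sub>R u \<in> \<Omega>"
proof -
  have D0: "directional u r p = 0"
    using Re_cdot_conormal[OF defining_function_facts(5), of u] u by (simp add: directional_def)
  obtain B \<delta>0 where B: "B > 0" "\<delta>0 > 0"
    "\<And>s. \<bar>s\<bar> < \<delta>0 \<Longrightarrow> p + s *\<^sub>R u \<in> U \<and>
       \<bar>r (p + s *\<^sub>R u) - (r p + s * directional u r p + s\<^sup>2 / 2 * directional u (directional u r) p)\<bar> \<le> B * \<bar>s\<bar> ^ 3"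
    using C3_Taylor_along_line[OF C defining_function_facts(1,2)] by metis
  have C1: "C_k_on (Suc 0) r U" using ldf by (simp add: local_defining_function_def)
  have "continuous_on U (directional n r)" using directional_C_k_on[OF C1] by simp
  \<comment> \<open>At \<open>p\<close> the derivative along \<open>n\<close> is -1, so by
    continuity it stays below -1/2 on a ball.\<close>
  then have "open (U \<inter> directional n r -` {..< - 1/2})"
    by (intro continuous_open_preimage defining_function_facts(1)) auto
  moreover have "p \<in> U \<inter> directional n r -` {..< - 1/2}"
    using Re_cdot_conormal[OF defining_function_facts(5), of n] n defining_function_facts(2)
    by (simp add: directional_def)
  ultimately obtain e where e: "e > 0" "ball p e \<subseteq> U \<inter> directional n r -` {..< - 1/2}"
    using openE by blast
  define M where "M = norm n + norm u + 1"
  have "M > 0" by (simp add: M_def add_nonneg_pos)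
  \<comment> \<open>The cube of \<open>c\<close> is \<open>1 / (4 * B)\<close>, so the remainder is
    at most \<open>t / 4\<close>.\<close>
  define c where "c = (1 / (4 * B)) powr (1/3)"
  have "c > 0" using B by (simp add: c_def)
  \<comment> \<open>The bound \<sigma> keeps \<open>s\<close> in the Taylor range and the points in
    the ball; \<open>(\<sigma> / c) powr 3\<close> is the height at which
    \<open>c * t powr (1/3)\<close> reaches \<sigma>.\<close>
  define \<sigma> where "\<sigma> = min \<delta>0 (e / (2 * M))"
  have "\<sigma> > 0" using B e \<open>M > 0\<close> by (simp add: \<sigma>_def)
  define \<delta> where "\<delta> = min (e / (2 * M)) ((\<sigma> / c) powr 3)"
  have "\<delta> > 0" using e \<open>M > 0\<close> \<open>c > 0\<close> \<open>\<sigma> > 0\<close> by (simp add: \<delta>_def)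
  have "p + t *\<^sub>R n + s *\<^sub>R u \<in> \<Omega>" if t: "0 < t" "t < \<delta>" and s: "\<bar>s\<bar> < c * t powr (1/3)" for t s
  proof -
    have "t powr (1/3) < ((\<sigma> / c) powr 3) powr (1/3)"
      using t by (intro powr_less_mono2) (auto simp: \<delta>_def)
    also have "\<dots> = \<sigma> / c" using \<open>\<sigma> > 0\<close> \<open>c > 0\<close> by (simp only: powr_powr) simp
    finally have "c * t powr (1/3) < \<sigma>" using \<open>c > 0\<close> by (simp add: field_simps)
    then have s': "\<bar>s\<bar> < \<delta>0" "\<bar>s\<bar> < e / (2 * M)" using s by (auto simp: \<sigma>_def)
    have t': "t < e / (2 * M)" using t by (simp add: \<delta>_def)
    have inball: "p + s *\<^sub>R u + h *\<^sub>R n \<in> ball p e" if h: "0 \<le> h" "h \<le> t" for h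
    proof -
      have "norm (s *\<^sub>R u + h *\<^sub>R n) \<le> \<bar>s\<bar> * norm u + h * norm n"
        using norm_triangle_ineq[of "s *\<^sub>R u" "h *\<^sub>R n"] h by simp
      also have "\<dots> \<le> e / (2 * M) * norm u + e / (2 * M) * norm n"
        using s' t' h by (intro add_mono mult_right_mono) auto
      also have "\<dots> < e / (2 * M) * M"
        using e \<open>M > 0\<close> unfolding distrib_left[symmetric] by (intro mult_strict_left_mono) (auto simp: M_def)
      also have "\<dots> < e" using e \<open>M > 0\<close> by simp
      finally show ?thesis
        using dist_add_cancel[of p 0 "s *\<^sub>R u + h *\<^sub>R n"] by (simp add: add.assoc)
    qed
    have "\<exists>z>0. z < t \<and> r (p + s *\<^sub>R u + t *\<^sub>R n) - r (p + s *\<^sub>R u + 0 *\<^sub>R n) =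
        (t - 0) * directional n r (p + s *\<^sub>R u + z *\<^sub>R n)"
      by (rule MVT2[OF t(1)]) (use inball e directional_has_real_derivative[OF C1] in blast)
    then obtain z where z: "0 < z" "z < t"
      "r (p + s *\<^sub>R u + t *\<^sub>R n) = r (p + s *\<^sub>R u) + t * directional n r (p + s *\<^sub>R u + z *\<^sub>R n)"
      by auto
    have "directional n r (p + s *\<^sub>R u + z *\<^sub>R n) < - 1/2" using inball[of z] z e by auto
    then have "t * directional n r (p + s *\<^sub>R u + z *\<^sub>R n) < t * (- 1/2)"
      using t by (intro mult_strict_left_mono)
    moreover have "r (p + s *\<^sub>R u) \<le> B * \<bar>s\<bar> ^ 3"
      using B(3)[OF s'(1)] D0 deg defining_function_facts(4) by (simp add: abs_le_iff)
    moreover have "B * \<bar>s\<bar> ^ 3 \<le> t / 4"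
    proof -
      have cube: "(x powr (1/3)) ^ 3 = x" if "0 < x" for x :: real
        using powr_powr[of x "1/3" 3] that by simp
      have "\<bar>s\<bar> ^ 3 \<le> (c * t powr (1/3)) ^ 3" using s by (intro power_mono) auto
      also have "\<dots> = 1 / (4 * B) * t"
        unfolding c_def power_mult_distrib using cube[of "1 / (4 * B)"] cube[of t] B t by (simp only:) simp
      finally have "B * \<bar>s\<bar> ^ 3 \<le> B * (1 / (4 * B) * t)" using B by (intro mult_left_mono) auto
      then show ?thesis using B by simp
    qed
    ultimately have "r (p + s *\<^sub>R u + t *\<^sub>R n) < 0" using z(3) t by linarith
    moreover have "p + s *\<^sub>R u + t *\<^sub>R n \<in> U" using inball[of t] t e by auto
    ultimately have "p + s *\<^sub>R u + t *\<^sub>R n \<in> \<Omega>" using defining_function_facts(6) by simp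
    then show ?thesis by (simp add: add_ac)
  qed
  then show ?thesis using \<open>c > 0\<close> \<open>\<delta> > 0\<close> by blast
qed

end

text \<open>The nonpositive Levi form is a sum of two second derivatives that convexity makes
  nonnegative, so both vanish. This gives long segments in the directions \<open>v\<close> and
  \<open>\<i> *s v\<close>, and the convex hull of the two contains a disc.\<close>

lemma weakly_pseudoconvex_boundary_point:
  fixes \<Omega> :: "(complex ^ 'd) set"
  assumes dom: "convex_domain \<Omega>" and "smooth_boundary \<Omega>" and "\<not> strongly_pseudoconvex \<Omega>"
  obtains \<xi> n v l where "cdot l n = 1" "v \<noteq> 0"
    "\<And>y. y \<in> \<Omega> \<Longrightarrow> 0 < Re (cdot l (y - \<xi>))"
    "\<And>\<eta>. \<eta> > 0 \<Longrightarrow> \<exists>\<delta>>0. \<forall>\<zeta>. \<zeta> \<noteq> 0 \<and> norm \<zeta> \<le> \<delta> \<and> \<eta> * norm \<zeta> \<le> Re \<zeta> \<longrightarrow> \<xi> + \<zeta> *s n \<in> \<Omega>"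
    "\<exists>c>0. \<exists>\<delta>>0. \<forall>t \<tau>. 0 < t \<and> t < \<delta> \<and> norm \<tau> < c * t powr (1/3) \<longrightarrow> \<xi> + t *\<^sub>R n + \<tau> *s v \<in> \<Omega>"
proof -
  obtain p where p: "p \<in> frontier \<Omega>"
    and np: "\<And>U r. local_defining_function \<Omega> p U r \<Longrightarrow> C_k_on 2 r U \<Longrightarrow>
        \<exists>v\<in>complex_tangent_space r p. v \<noteq> 0 \<and> Re (levi_form r p v) \<le> 0"
    using assms(3) unfolding strongly_pseudoconvex_def by (metis not_le)
  obtain U r where ldf: "local_defining_function \<Omega> p U r" and "C_infinity_on r U"
    using assms(2) p unfolding smooth_boundary_def by blast
  then have C3: "C_k_on 3 r U" and C2: "C_k_on 2 r U" by (auto simp: C_infinity_on_def)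
  note facts = defining_function_facts[OF dom p ldf]
  obtain v where v: "v \<in> complex_tangent_space r p" "v \<noteq> 0" "Re (levi_form r p v) \<le> 0"
    using np[OF ldf C2] by blast
  define l where "l = conormal r p"
  have lv: "cdot l v = 0" using v(1) complex_tangent_space_eq[OF facts(5)] by (simp add: l_def)
  have liv: "cdot l (\<i> *s v) = 0" using lv by (simp add: cdot_smult)
  have "0 \<le> directional v (directional v r) p" "0 \<le> directional (\<i> *s v) (directional (\<i> *s v) r) p"
    using second_derivative_nonneg[OF dom p ldf C3] lv liv by (simp_all add: l_def)
  with v(3) have deg: "directional v (directional v r) p = 0" "directional (\<i> *s v) (directional (\<i> *s v) r) p = 0"
    unfolding Re_levi_form[OF C2 facts(1,2)] by simp_all
  obtain i where i: "l $ i \<noteq> 0" using conormal_nonzero[OF dom p ldf] by (auto simp: vec_eq_iff l_def)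
  define n where "n = axis i (1 / l $ i)"
  have n: "cdot l n = 1" using i by (simp add: n_def cdot_axis)
  obtain c1 d1 where 1: "c1 > 0" "d1 > 0"
    "\<And>t s. 0 < t \<Longrightarrow> t < d1 \<Longrightarrow> \<bar>s\<bar> < c1 * t powr (1/3) \<Longrightarrow> p + t *\<^sub>R n + s *\<^sub>R v \<in> \<Omega>"
    using segment_in_degenerate_direction[OF dom p ldf C3 _ deg(1), of n] lv n unfolding l_def by auto
  obtain c2 d2 where 2: "c2 > 0" "d2 > 0"
    "\<And>t s. 0 < t \<Longrightarrow> t < d2 \<Longrightarrow> \<bar>s\<bar> < c2 * t powr (1/3) \<Longrightarrow> p + t *\<^sub>R n + s *\<^sub>R (\<i> *s v) \<in> \<Omega>"
    using segment_in_degenerate_direction[OF dom p ldf C3 _ deg(2), of n] liv n unfolding l_def by auto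
  \<comment> \<open>A point of the disc is the midpoint of a point displaced by
    \<open>2 * Re \<tau>\<close> along \<open>v\<close> and one displaced by
    \<open>2 * Im \<tau>\<close> along \<open>\<i> *s v\<close>; the doubling explains the division
    by 2.\<close>
  define c where "c = min c1 c2 / 2"
  have disc: "p + t *\<^sub>R n + \<tau> *s v \<in> \<Omega>" if t: "0 < t" "t < min d1 d2" and \<tau>: "norm \<tau> < c * t powr (1/3)" for t \<tau>
  proof -
    have "2 * norm \<tau> < min c1 c2 * t powr (1/3)" using \<tau> by (simp add: c_def)
    also have "\<dots> \<le> c1 * t powr (1/3)" by (intro mult_right_mono) auto
    finally have r1: "\<bar>2 * Re \<tau>\<bar> < c1 * t powr (1/3)" using abs_Re_le_cmod[of \<tau>] by linarith
    have "2 * norm \<tau> < min c1 c2 * t powr (1/3)" using \<tau> by (simp add: c_def)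
    also have "\<dots> \<le> c2 * t powr (1/3)" by (intro mult_right_mono) auto
    finally have r2: "\<bar>2 * Im \<tau>\<bar> < c2 * t powr (1/3)" using abs_Im_le_cmod[of \<tau>] by linarith
    have "(1/2) *\<^sub>R (p + t *\<^sub>R n + (2 * Re \<tau>) *\<^sub>R v) + (1/2) *\<^sub>R (p + t *\<^sub>R n + (2 * Im \<tau>) *\<^sub>R (\<i> *s v)) \<in> \<Omega>"
      using dom 1(3)[of t, OF _ _ r1] 2(3)[of t, OF _ _ r2] t
      by (intro convexD) (auto simp: convex_domain_def)
    moreover have "(1/2) *\<^sub>R (p + t *\<^sub>R n + (2 * Re \<tau>) *\<^sub>R v) + (1/2) *\<^sub>R (p + t *\<^sub>R n + (2 * Im \<tau>) *\<^sub>R (\<i> *s v)) =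
        p + t *\<^sub>R n + \<tau> *s v"
      by (simp add: vec_eq_iff complex_eq_iff field_simps)
    ultimately show ?thesis by simp
  qed
  show ?thesis
  proof (rule that)
    show "cdot l n = 1" "v \<noteq> 0" using n v by auto
    show "0 < Re (cdot l (y - p))" if "y \<in> \<Omega>" for y
      unfolding l_def by (rule convex_domain_subset_half_space[OF dom p ldf that])
    show "\<exists>\<delta>>0. \<forall>\<zeta>. \<zeta> \<noteq> 0 \<and> norm \<zeta> \<le> \<delta> \<and> \<eta> * norm \<zeta> \<le> Re \<zeta> \<longrightarrow> p + \<zeta> *s n \<in> \<Omega>" if "\<eta> > 0" for \<eta>
      by (rule cone_subset_domain[OF dom p ldf n[unfolded l_def] that])
    have "c > 0" "min d1 d2 > 0" using 1 2 by (auto simp: c_def)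
    then show "\<exists>c>0. \<exists>\<delta>>0. \<forall>t \<tau>. 0 < t \<and> t < \<delta> \<and> norm \<tau> < c * t powr (1/3) \<longrightarrow> p + t *\<^sub>R n + \<tau> *s v \<in> \<Omega>"
      using disc by blast
  qed
qed

section \<open>Rescaling at a weakly pseudoconvex point\<close>

text \<open>Any near-minimiser \<open>t\<close> of \<open>g t / t powr \<gamma>\<close> will do.\<close>

lemma exists_record_scale:
  fixes g :: "real \<Rightarrow> real"
  assumes "c > 0" "a > 0" "\<beta> \<le> \<gamma>" and g: "\<And>t. 0 < t \<Longrightarrow> t \<le> a \<Longrightarrow> c * t powr \<beta> \<le> g t"
  shows "\<exists>t. 0 < t \<and> t \<le> a \<and> (\<forall>s. 0 < s \<longrightarrow> s \<le> 1 \<longrightarrow> 1/2 * s powr \<gamma> * g t \<le> g (s * t))"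
proof -
  define \<phi> where "\<phi> = (\<lambda>t. g t / t powr \<gamma>)"
  define I where "I = Inf (\<phi> ` {0<..a})"
  \<comment> \<open>As \<open>\<beta> \<le> \<gamma>\<close>, the power
    \<open>t powr (\<beta> - \<gamma>)\<close> is smallest at \<open>t = a\<close>. The infimum
    \<open>I\<close> is therefore positive and \<open>2 * I\<close> strictly exceeds it.\<close>
  have lb: "c * a powr (\<beta> - \<gamma>) \<le> \<phi> t" if "0 < t" "t \<le> a" for t
  proof -
    have "c * a powr (\<beta> - \<gamma>) \<le> c * t powr (\<beta> - \<gamma>)"
      using assms that by (intro mult_left_mono powr_mono2') auto
    also have "\<dots> = c * t powr \<beta> / t powr \<gamma>" by (simp add: powr_diff)
    also have "\<dots> \<le> \<phi> t" unfolding \<phi>_def using g[OF that] by (intro divide_right_mono) auto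
    finally show ?thesis .
  qed
  have ne: "\<phi> ` {0<..a} \<noteq> {}" using \<open>a > 0\<close> by auto
  have bdd: "bdd_below (\<phi> ` {0<..a})" using lb by (intro bdd_belowI2) auto
  have "c * a powr (\<beta> - \<gamma>) \<le> I" unfolding I_def using lb by (intro cInf_greatest ne) auto
  moreover have "0 < c * a powr (\<beta> - \<gamma>)" using assms by simp
  ultimately have "I > 0" by linarith
  then have "Inf (\<phi> ` {0<..a}) < 2 * I" by (simp add: I_def)
  then obtain t where t: "0 < t" "t \<le> a" "\<phi> t < 2 * I"
    using cInf_lessD[OF ne] by (metis greaterThanAtMost_iff imageE)
  have "1/2 * s powr \<gamma> * g t \<le> g (s * t)" if s: "0 < s" "s \<le> 1" for s
  proof -
    have "s * t \<le> a" using s t mult_left_le_one_le[of t s] by linarith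
    then have "I \<le> \<phi> (s * t)" unfolding I_def using s t by (intro cInf_lower bdd) auto
    then have "\<phi> t / 2 \<le> \<phi> (s * t)" using t(3) by linarith
    then have "\<phi> t / 2 * (s * t) powr \<gamma> \<le> \<phi> (s * t) * (s * t) powr \<gamma>" by (rule mult_right_mono) simp
    also have "\<dots> = g (s * t)" using s t by (simp add: \<phi>_def)
    also have "\<phi> t / 2 * (s * t) powr \<gamma> = 1/2 * s powr \<gamma> * g t"
      using s t by (simp add: \<phi>_def powr_mult)
    finally show ?thesis .
  qed
  then show ?thesis using t by blast
qed

lemma gauge_fun_le_norm:
  fixes U :: "'a::real_normed_vector set"
  assumes "open U" "convex U" "0 \<in> U"
  obtains C where "C > 0" "\<And>y. gauge_fun U y \<le> C * norm y"
proof -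
  obtain e where e: "e > 0" "ball 0 e \<subseteq> U" using assms openE by blast
  have "gauge_fun U y \<le> 2 / e * norm y" for y
  proof (cases "y = 0")
    case True
    then show ?thesis using sublinear_0[OF sublinear_gauge_fun[OF assms]] by simp
  next
    case False
    define c where "c = e / (2 * norm y)"
    have c: "c > 0" using e False by (simp add: c_def)
    have "norm (c *\<^sub>R y) = e / 2" using False e by (simp add: c_def)
    then have "c *\<^sub>R y \<in> U" using e by (intro subsetD[OF e(2)]) simp
    then have "gauge_fun U (c *\<^sub>R y) < 1" using gauge_fun_less_1[OF assms] by blast
    then have "c * gauge_fun U y < 1"
      using sublinearD(3)[OF sublinear_gauge_fun[OF assms]] c by simp
    then show ?thesis using c e False by (simp add: c_def field_simps)
  qed
  then show ?thesis using that[of "2/e"] e by simp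
qed

lemma sublinear_sum:
  assumes "sublinear p" "finite I"
  shows "p (\<Sum>i\<in>I. f i) \<le> (\<Sum>i\<in>I. p (f i))"
  using assms(2)
proof (induction I rule: finite_induct)
  case (insert i I)
  then show ?case using sublinearD(2)[OF assms(1), of "f i" "sum f I"] by simp
qed (simp add: sublinear_0[OF assms(1)])

lemma of_real_smult: "of_real c *s x = c *\<^sub>R (x :: complex ^ 'd)"
  by (simp only: vec_eq_iff vector_smult_component vector_scaleR_component) (simp add: scaleR_conv_of_real)

text \<open>Homogeneity covers only the modulus of \<open>c\<close>; its phase is absorbed by the
  hypothesis on rotations.\<close>

lemma sublinear_smult_le:
  fixes p :: "complex ^ 'd \<Rightarrow> real"
  assumes p: "sublinear p" and y: "\<And>\<omega>. norm \<omega> = 1 \<Longrightarrow> p (\<omega> *s y) \<le> 1"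
  shows "p (c *s y) \<le> norm c"
proof (cases "c = 0")
  case True then show ?thesis by (simp add: sublinear_0[OF p])
next
  case False
  have "c *s y = norm c *\<^sub>R ((c / norm c) *s y)"
    using False by (simp flip: of_real_smult add: vector_smult_assoc)
  then have "p (c *s y) = norm c * p ((c / norm c) *s y)"
    using sublinearD(3)[OF p, of "norm c"] by simp
  also have "\<dots> \<le> norm c * 1" using False by (intro mult_left_mono y) (auto simp: norm_divide)
  finally show ?thesis by simp
qed

lemma sum_norm_le_CARD:
  fixes y :: "complex ^ 'd"
  shows "(\<Sum>i\<in>UNIV. norm (y $ i)) \<le> real CARD('d) * norm y"
  using sum_bounded_above[of UNIV "\<lambda>i. norm (y $ i)" "norm y"] Finite_Cartesian_Product.norm_nth_le
  by fastforce

lemma norm_le_CARD: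
  fixes y :: "complex ^ 'd"
  assumes "\<And>i. norm (y $ i) \<le> b"
  shows "norm y \<le> real CARD('d) * b"
  using norm_vec_le_sum[of y] sum_bounded_above[of UNIV "\<lambda>i. norm (y $ i)" b] assms by fastforce

text \<open>
  The sublevel set \<open>{p < 1}\<close> is a rescaled domain with base point \<open>0\<close>: the third condition puts its
  largest balanced subset into the unit polydisc, \<open>-N\<close> is the image of the boundary point, and \<open>V\<close>
  is the image of the degenerate tangent direction, scaled to the size of its disc at \<open>0\<close>.
\<close>

definition normalised_gauge ::
  "nat \<Rightarrow> (complex ^ 'd \<Rightarrow> real) \<Rightarrow> complex ^ 'd \<Rightarrow> complex ^ 'd \<Rightarrow> complex ^ 'd \<Rightarrow> bool" where
  "normalised_gauge k p N V l \<longleftrightarrow>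
     sublinear p \<and> (\<forall>y. p y \<le> (\<Sum>i\<in>UNIV. norm (y $ i))) \<and>
     (\<forall>y i. (\<forall>\<omega>. norm \<omega> = 1 \<longrightarrow> p (\<omega> *s y) \<le> 1) \<longrightarrow> norm (y $ i) \<le> 1) \<and>
     cdot l N = 1 \<and>
     (\<forall>i. norm (l $ i) \<le> 1) \<and> (\<forall>i. norm (N $ i) \<le> 2) \<and> (\<forall>i. norm (V $ i) \<le> 1) \<and>
     1 \<le> (\<Sum>i\<in>UNIV. norm (V $ i)) \<and>
     (\<forall>y. p y < 1 \<longrightarrow> -1 < Re (cdot l y)) \<and>
     (\<forall>\<zeta>. norm \<zeta> \<le> real k \<and> 1 / real k \<le> Re \<zeta> \<longrightarrow> p ((\<zeta> - 1) *s N) < 1) \<and>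
     (\<forall>s \<tau>. 0 < s \<and> s \<le> 1 \<and> norm \<tau> < 1/2 * s powr (2/5) \<longrightarrow> p ((s - 1) *\<^sub>R N + \<tau> *s V) < 1)"

text \<open>The base point is moved to height \<open>t\<close> above the degenerate boundary point,
  with \<open>t\<close> a record scale for the disc radius. Linear coordinates are then chosen to
  normalise the largest balanced subset at that point. Small \<open>t\<close> provides large sectors
  and pushes a fixed compact set out of the ball of radius \<open>k\<close>.\<close>

lemma normalisation:
  fixes \<Omega> :: "(complex ^ 'd) set"
  assumes bdd: "bounded \<Omega>" and dom: "convex_domain \<Omega>" and "smooth_boundary \<Omega>"
    and "\<not> strongly_pseudoconvex \<Omega>" and K: "compact K" "K \<subseteq> \<Omega>" and k: "2 \<le> k"
  obtains E x p N V l where "normalised_gauge k p N V l" "det (E :: complex ^ 'd ^ 'd) \<noteq> 0"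
    "\<And>y. p y < 1 \<longleftrightarrow> x + E *v y \<in> \<Omega>"
    "\<And>y. p y < 1 \<Longrightarrow> norm y < real k \<Longrightarrow> x + E *v y \<notin> K"
proof -
  have op: "open \<Omega>" and cv: "convex \<Omega>" using dom by (auto simp: convex_domain_def)
  obtain \<xi> n v l0 where l0n: "cdot l0 n = 1" and "v \<noteq> 0"
    and half: "\<And>y. y \<in> \<Omega> \<Longrightarrow> 0 < Re (cdot l0 (y - \<xi>))"
    and cone: "\<And>\<eta>. \<eta> > 0 \<Longrightarrow> \<exists>\<delta>>0. \<forall>\<zeta>. \<zeta> \<noteq> 0 \<and> norm \<zeta> \<le> \<delta> \<and> \<eta> * norm \<zeta> \<le> Re \<zeta> \<longrightarrow> \<xi> + \<zeta> *s n \<in> \<Omega>"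
    and disc: "\<exists>c>0. \<exists>\<delta>>0. \<forall>t \<tau>. 0 < t \<and> t < \<delta> \<and> norm \<tau> < c * t powr (1/3) \<longrightarrow> \<xi> + t *\<^sub>R n + \<tau> *s v \<in> \<Omega>"
    using weakly_pseudoconvex_boundary_point[OF assms(2-4)] by metis
  \<comment> \<open>This opening makes the sector contain every \<zeta> with
    \<open>norm \<zeta> \<le> k * t\<close> and \<open>Re \<zeta> \<ge> t / k\<close>, since
    \<open>\<eta> * k * t = t / k\<close>.\<close>
  define \<eta> where "\<eta> = 1 / (real k)\<^sup>2"
  have k0: "real k > 0" using k by simp
  have eta: "\<eta> > 0" "\<eta> \<le> 1/4"
  proof -
    show "\<eta> > 0" using k by (simp add: \<eta>_def)
    have "(2::real)\<^sup>2 \<le> (real k)\<^sup>2" using k by (intro power_mono) auto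
    then show "\<eta> \<le> 1/4" using k by (simp add: \<eta>_def field_simps)
  qed
  obtain \<delta>1 where d1: "\<delta>1 > 0"
    "\<And>\<zeta>. \<zeta> \<noteq> 0 \<Longrightarrow> norm \<zeta> \<le> \<delta>1 \<Longrightarrow> \<eta> * norm \<zeta> \<le> Re \<zeta> \<Longrightarrow> \<xi> + \<zeta> *s n \<in> \<Omega>"
    using cone[OF eta(1)] by blast
  obtain c \<delta>2 where c: "c > 0" "\<delta>2 > 0"
    "\<And>t \<tau>. 0 < t \<Longrightarrow> t < \<delta>2 \<Longrightarrow> norm \<tau> < c * t powr (1/3) \<Longrightarrow> \<xi> + t *\<^sub>R n + \<tau> *s v \<in> \<Omega>"
    using disc by blast
  \<comment> \<open>By compactness \<open>K\<close> has a positive height above the supporting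
    hyperplane.\<close>
  obtain m where m: "m > 0" "\<And>y. y \<in> K \<Longrightarrow> m \<le> Re (cdot l0 (y - \<xi>))"
  proof (cases "K = {}")
    case True then show ?thesis using that[of 1] by simp
  next
    case False
    have "continuous_on K (\<lambda>y. Re (cdot l0 (y - \<xi>)))"
      unfolding cdot_def
      by (intro continuous_on_Re continuous_on_sum continuous_on_mult continuous_on_const
          continuous_on_component continuous_on_diff continuous_on_id)
    then obtain y0 where "y0 \<in> K" "\<And>y. y \<in> K \<Longrightarrow> Re (cdot l0 (y0 - \<xi>)) \<le> Re (cdot l0 (y - \<xi>))"
      using continuous_attains_inf[OF K(1) False] by blast
    then show ?thesis using that[of "Re (cdot l0 (y0 - \<xi>))"] half K(2) by blast
  qed
  define d where "d = real CARD('d)"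
  \<comment> \<open>The three bounds on heights serve the sector up to size \<open>k * t\<close>,
    the discs in direction \<open>v\<close>, and the escape from \<open>K\<close>.\<close>
  define a where "a = min (min (\<delta>1 / real k) (\<delta>2 / 2)) (m / (2 * (1 + d * real k)))"
  have dk: "1 + d * real k > 0" by (simp add: d_def add_pos_nonneg)
  have a: "a > 0" "a \<le> \<delta>1 / real k" "a < \<delta>2" "a * (1 + d * real k) < m"
  proof -
    show "a > 0" using d1 c m k0 dk by (simp add: a_def)
    show "a \<le> \<delta>1 / real k" by (simp add: a_def)
    have "a \<le> \<delta>2 / 2" unfolding a_def by linarith
    then show "a < \<delta>2" using c by simp
    have "a \<le> m / (2 * (1 + d * real k))" by (simp add: a_def)
    then have "a * (1 + d * real k) \<le> m / (2 * (1 + d * real k)) * (1 + d * real k)"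
      using dk by (intro mult_right_mono) auto
    also have "\<dots> = m / 2"
    proof -
      have "m / (2 * Z) * Z = m / 2" if "Z > 0" for Z using that by simp
      from this[OF dk] show ?thesis .
    qed
    also have "\<dots> < m" using m by simp
    finally show "a * (1 + d * real k) < m" .
  qed
  \<comment> \<open>\<open>g t\<close> is the radius of the disc in direction \<open>v\<close> at height \<open>t\<close> above \<open>\<xi>\<close>.\<close>
  define G where "G = (\<lambda>t. {\<rho>. 0 \<le> \<rho> \<and> (\<forall>\<tau>. norm \<tau> < \<rho> \<longrightarrow> \<xi> + t *\<^sub>R n + \<tau> *s v \<in> \<Omega>)})"
  define g where "g = (\<lambda>t. Sup (G t))"
  obtain R where R: "\<And>y. y \<in> \<Omega> \<Longrightarrow> norm y \<le> R" using bdd by (auto simp: bounded_iff)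
  have inG: "c * t powr (1/3) \<in> G t" if "0 < t" "t \<le> a" for t
    using c that a(3) by (auto simp: G_def)
  have Gle: "\<rho> \<le> 2 * R / norm v" if "\<rho> \<in> G t" for \<rho> t
  proof (rule dense_le)
    fix x assume "x < \<rho>"
    show "x \<le> 2 * R / norm v"
    proof (cases "x \<ge> 0")
      case False
      have "R \<ge> 0" using R dom norm_ge_zero order_trans unfolding convex_domain_def by blast
      then have "0 \<le> 2 * R / norm v" by simp
      then show ?thesis using False by linarith
    next
      case True
      have G: "\<xi> + t *\<^sub>R n + \<tau> *s v \<in> \<Omega>" if "norm \<tau> < \<rho>" for \<tau>
        using \<open>\<rho> \<in> G t\<close> that by (simp add: G_def)
      have "\<xi> + t *\<^sub>R n + of_real x *s v \<in> \<Omega>" "\<xi> + t *\<^sub>R n + 0 *s v \<in> \<Omega>"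
        using G[of "of_real x"] G[of 0] \<open>x < \<rho>\<close> True by simp_all
      then have "norm (\<xi> + t *\<^sub>R n + of_real x *s v) \<le> R" "norm (\<xi> + t *\<^sub>R n) \<le> R"
        using R by auto
      then have "norm (of_real x *s v) \<le> 2 * R"
        using norm_triangle_ineq4[of "\<xi> + t *\<^sub>R n + of_real x *s v" "\<xi> + t *\<^sub>R n"] by simp
      then show ?thesis using True \<open>v \<noteq> 0\<close> by (simp add: norm_smult pos_le_divide_eq)
    qed
  qed
  have bddG: "bdd_above (G t)" for t using Gle by (rule bdd_aboveI)
  have g_upper: "\<rho> \<le> g t" if "\<rho> \<in> G t" for \<rho> t
    unfolding g_def by (rule cSup_upper[OF that bddG])
  have g_disc: "\<xi> + t *\<^sub>R n + \<tau> *s v \<in> \<Omega>" if t: "0 < t" "t \<le> a" "norm \<tau> < g t" for t \<tau>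
  proof -
    obtain \<rho> where "\<rho> \<in> G t" "norm \<tau> < \<rho>"
      using less_cSupD[of "G t" "norm \<tau>"] inG[OF t(1,2)] t(3) unfolding g_def by blast
    then show ?thesis by (auto simp: G_def)
  qed
  have g_ge: "c * t powr (1/3) \<le> g t" if "0 < t" "t \<le> a" for t
    by (rule g_upper[OF inG[OF that]])
  \<comment> \<open>The exponent 2/5 lies between 1/3, supplied by the Taylor remainder, and 1/2,
    the exponent in the derivative bound for the ball.\<close>
  have exponents: "(1/3 :: real) \<le> 2/5" by simp
  obtain t where t: "0 < t" "t \<le> a"
    and rec: "\<And>s. 0 < s \<Longrightarrow> s \<le> 1 \<Longrightarrow> 1/2 * s powr (2/5) * g t \<le> g (s * t)"
    using exists_record_scale[OF c(1) a(1) exponents g_ge] by blast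
  have "0 < c * t powr (1/3)" using c(1) t(1) by simp
  with g_ge[OF t] have gt: "g t > 0" by linarith
  have tk: "real k * t \<le> \<delta>1"
  proof -
    have "real k * t \<le> real k * (\<delta>1 / real k)" using t a(2) k0 by (intro mult_left_mono) auto
    then show ?thesis using k0 by simp
  qed
  define x where "x = \<xi> + t *\<^sub>R n"
  have xO: "x \<in> \<Omega>" using g_disc[OF t, of 0] gt by (simp add: x_def)
  define U where "U = {y. x + y \<in> \<Omega>}"
  have U_eq: "U = (\<lambda>y. y - x) ` \<Omega>" by (auto simp: U_def image_iff intro!: bexI[of _ "x + _"])
  have U: "open U" "convex U" "0 \<in> U"
    using op cv xO unfolding U_eq
    by (auto simp: open_translation_subtract convex_translation_subtract image_iff)
  define p0 where "p0 = gauge_fun U"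
  have p0: "sublinear p0" and p0_1: "\<And>y. p0 y < 1 \<longleftrightarrow> x + y \<in> \<Omega>"
    using sublinear_gauge_fun[OF U] gauge_fun_less_1[OF U] by (auto simp: p0_def U_def)
  obtain C where C: "C > 0" "\<And>y. p0 y \<le> C * norm y" using gauge_fun_le_norm[OF U] by (auto simp: p0_def)
  \<comment> \<open>This is the intersection of all rotations of the closed domain about the base
    point, its largest balanced subset.\<close>
  define S where "S = {y. \<forall>\<omega>. norm \<omega> = 1 \<longrightarrow> p0 (\<omega> *s y) \<le> 1}"
  have "closed S"
  proof -
    have "S = (\<Inter>\<omega>\<in>{\<omega>. norm \<omega> = 1}. {y. p0 (\<omega> *s y) \<le> 1})" by (auto simp: S_def)
    moreover have "closed {y. p0 (\<omega> *s y) \<le> 1}" for \<omega>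
    proof (intro closed_Collect_le continuous_on_const)
      have "continuous_on UNIV (\<lambda>y :: complex ^ 'd. \<omega> *s y)"
        unfolding vector_scalar_mult_def
        by (intro continuous_on_vec_lambda continuous_on_mult continuous_on_const continuous_on_component continuous_on_id)
      then show "continuous_on UNIV (\<lambda>y. p0 (\<omega> *s y))"
        by (rule continuous_on_compose2[OF continuous_on_sublinear[OF p0 C(2)]]) auto
    qed
    ultimately show ?thesis by (metis (no_types, lifting) closed_INT)
  qed
  moreover have "bounded S"
  proof -
    have "norm y \<le> 2 * (R + norm x)" if "y \<in> S" for y
    proof -
      have "\<forall>\<omega>. norm \<omega> = 1 \<longrightarrow> p0 (\<omega> *s y) \<le> 1" using that by (simp add: S_def)
      from this[rule_format, of 1] have "p0 y \<le> 1" by simp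
      then have "p0 ((1/2) *\<^sub>R y) < 1" by (simp add: sublinearD(3)[OF p0])
      then have "norm (x + (1/2) *\<^sub>R y) \<le> R" using p0_1 R by blast
      then have "norm ((1/2) *\<^sub>R y) \<le> R + norm x"
        using norm_triangle_ineq4[of "x + (1/2) *\<^sub>R y" x] by simp
      then show ?thesis by simp
    qed
    then show ?thesis by (auto simp: bounded_iff)
  qed
  ultimately have "compact S" by (simp add: compact_eq_bounded_closed)
  have S_ball: "cball 0 (1/C) \<subseteq> S"
  proof
    fix y :: "complex ^ 'd" assume y: "y \<in> cball 0 (1/C)"
    have "p0 (\<omega> *s y) \<le> 1" if "norm \<omega> = 1" for \<omega>
    proof -
      have "p0 (\<omega> *s y) \<le> C * norm y" using C(2)[of "\<omega> *s y"] that by (simp add: norm_smult)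
      also have "\<dots> \<le> C * (1/C)" using y C(1) by (intro mult_left_mono) auto
      finally show ?thesis using C(1) by simp
    qed
    then show "y \<in> S" by (simp add: S_def)
  qed
  obtain E :: "complex ^ 'd ^ 'd" where E: "det E \<noteq> 0" "\<And>i. column i E \<in> S"
    "\<And>y i. E *v y \<in> S \<Longrightarrow> norm (y $ i) \<le> 1"
    using exists_Auerbach_matrix[OF \<open>compact S\<close> _ S_ball] C(1) by (metis divide_pos_pos zero_less_one)
  obtain E' where E': "E ** E' = mat 1"
    using E(1) invertible_det_nz[of E] by (auto simp: invertible_def)
  have EE': "E *v (E' *v y) = y" for y by (simp add: matrix_vector_mul_assoc E')
  have Esm: "E *v (\<omega> *s y) = \<omega> *s (E *v y)" for \<omega> y by (rule vec.scale)
  have Esc: "E *v (r *\<^sub>R y) = r *\<^sub>R (E *v y)" for r y by (simp flip: of_real_smult add: Esm)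
  define p where "p = (\<lambda>y. p0 (E *v y))"
  have p: "sublinear p"
    using sublinearD[OF p0] by (simp add: sublinear_def p_def vec.add Esc)
  have p_1: "p y < 1 \<longleftrightarrow> x + E *v y \<in> \<Omega>" for y by (simp add: p_def p0_1)
  have p_le: "p y \<le> (\<Sum>i\<in>UNIV. norm (y $ i))" for y
  proof -
    have "p y = p0 (\<Sum>i\<in>UNIV. y $ i *s column i E)" by (simp add: p_def matrix_mult_sum)
    also have "\<dots> \<le> (\<Sum>i\<in>UNIV. p0 (y $ i *s column i E))" by (rule sublinear_sum[OF p0]) simp
    also have "\<dots> \<le> (\<Sum>i\<in>UNIV. norm (y $ i))"
      using E(2) by (intro sum_mono sublinear_smult_le[OF p0]) (auto simp: S_def)
    finally show ?thesis .
  qed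
  have p_core: "norm (y $ i) \<le> 1" if "\<And>\<omega>. norm \<omega> = 1 \<Longrightarrow> p (\<omega> *s y) \<le> 1" for y i
    using that by (intro E(3)) (simp add: S_def p_def Esm)
  define N where "N = E' *v (t *\<^sub>R n)"
  define V where "V = E' *v (g t *\<^sub>R v)"
  have EN: "E *v N = t *\<^sub>R n" and EV: "E *v V = g t *\<^sub>R v" by (simp_all add: N_def V_def EE')
  \<comment> \<open>The supporting functional in the new coordinates, divided by \<open>t\<close>:
    the base point has height 1 and the image of the boundary point is \<open>- N\<close>.\<close>
  define l where "l = (\<chi> i. cdot l0 (column i E) / of_real t)"
  have l: "cdot l y = cdot l0 (E *v y) / of_real t" for y
  proof -
    have "cdot l0 (E *v y) = (\<Sum>i\<in>UNIV. y $ i * cdot l0 (column i E))"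
    proof -
      have "cdot l0 (\<Sum>i\<in>I. y $ i *s column i E) = (\<Sum>i\<in>I. y $ i * cdot l0 (column i E))" if "finite I" for I
        using that by induction (auto simp: cdot_zero cdot_add cdot_smult)
      then show ?thesis by (simp add: matrix_mult_sum)
    qed
    then have "cdot l0 (E *v y) / of_real t = (\<Sum>i\<in>UNIV. l $ i * y $ i)"
      by (simp add: l_def sum_divide_distrib mult.commute)
    then show ?thesis by (simp only: cdot_def[of l])
  qed
  have lx: "cdot l0 (x + E *v y - \<xi>) = of_real t * (1 + cdot l y)" for y
  proof -
    have "cdot l0 (x + E *v y - \<xi>) = cdot l0 (t *\<^sub>R n + E *v y)" by (simp add: x_def algebra_simps)
    also have "\<dots> = of_real t + cdot l0 (E *v y)" by (simp only: cdot_add cdot_scaleR l0n) (simp add: scaleR_conv_of_real)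
    finally show ?thesis using t(1) by (simp add: l field_simps)
  qed
  have l_half: "-1 < Re (cdot l y)" if "p y < 1" for y
  proof -
    have "0 < Re (cdot l0 (x + E *v y - \<xi>))" using that p_1 half by blast
    then show ?thesis unfolding lx using t(1) by (simp add: zero_less_mult_iff)
  qed
  \<comment> \<open>The new domain contains every vector whose coordinate norms sum to less than 1.
    A larger coefficient of \<open>l\<close> would yield such a vector with pairing -1, outside the
    half-space.\<close>
  have l_le: "norm (l $ i) \<le> 1" for i
  proof (rule ccontr)
    assume "\<not> norm (l $ i) \<le> 1"
    then have li: "norm (l $ i) > 1" by simp
    define y where "y = axis i (- (1 / l $ i))"
    have "(\<Sum>j\<in>UNIV. norm (y $ j)) = norm (1 / l $ i)"
      by (simp add: y_def axis_def if_distrib[of norm] cong: if_cong)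
    also have "\<dots> < 1" using li by (simp add: norm_divide divide_less_eq)
    finally have "p y < 1" using p_le[of y] by simp
    moreover have "cdot l y = -1"
      using li by (auto simp: y_def cdot_axis)
    ultimately show False using l_half[of y] by simp
  qed
  have in_cone: "\<xi> + \<zeta> *s n \<in> \<Omega>" if "norm \<zeta> \<le> real k * t" "t / real k \<le> Re \<zeta>" for \<zeta>
  proof (rule d1(2))
    have "0 < Re \<zeta>" using that(2) t(1) k0 divide_pos_pos[of t "real k"] by linarith
    then show "\<zeta> \<noteq> 0" by auto
    show "norm \<zeta> \<le> \<delta>1" using that(1) tk by simp
    have "\<eta> * norm \<zeta> \<le> \<eta> * (real k * t)" using that(1) eta by (intro mult_left_mono) auto
    also have "\<dots> = t / real k" using k0 by (simp add: \<eta>_def power2_eq_square)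
    finally show "\<eta> * norm \<zeta> \<le> Re \<zeta>" using that(2) by simp
  qed
  have N_half: "p ((\<zeta> - 1) *s N) < 1" if "norm \<zeta> \<le> real k" "1 / real k \<le> Re \<zeta>" for \<zeta>
  proof -
    have "x + E *v ((\<zeta> - 1) *s N) = \<xi> + (of_real t * \<zeta>) *s n"
      unfolding Esm EN x_def of_real_smult[symmetric] vec_eq_iff vector_add_component vector_smult_component
      by (simp add: algebra_simps)
    also have "\<dots> \<in> \<Omega>"
    proof (rule in_cone)
      show "norm (of_real t * \<zeta>) \<le> real k * t" using that(1) t(1) by (simp add: norm_mult)
      show "t / real k \<le> Re (of_real t * \<zeta>)"
        using mult_left_mono[OF that(2), of t] t(1) by simp
    qed
    finally show ?thesis using p_1 by blast
  qed
  \<comment> \<open>All rotations of \<open>(1/2) *s N\<close> lie in the domain: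
    \<open>1 + \<omega> / 2\<close> has modulus at most 3/2 and real part at least 1/2, which the
    sector allows because \<open>2 \<le> k\<close>.\<close>
  have N_le: "norm (N $ i) \<le> 2" for i
  proof -
    have "norm (((1/2) *s N) $ i) \<le> 1"
    proof (rule p_core)
      fix \<omega> :: complex assume \<omega>: "norm \<omega> = 1"
      define \<zeta> where "\<zeta> = 1 + \<omega> / 2"
      have "norm \<zeta> \<le> 1 + 1/2" unfolding \<zeta>_def using norm_triangle_ineq[of 1 "\<omega>/2"] \<omega> by (simp add: norm_divide)
      then have 1: "norm \<zeta> \<le> real k" using k by linarith
      have "1 / real k \<le> 1 / 2" using k by (simp add: field_simps)
      moreover have "1/2 \<le> Re \<zeta>" using abs_Re_le_cmod[of \<omega>] \<omega> by (simp add: \<zeta>_def)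
      ultimately have 2: "1 / real k \<le> Re \<zeta>" by linarith
      have "\<omega> *s ((1/2) *s N) = (\<zeta> - 1) *s N" by (simp add: \<zeta>_def vector_smult_assoc)
      then show "p (\<omega> *s ((1/2) *s N)) \<le> 1" using N_half[OF 1 2] by simp
    qed
    then show ?thesis by (simp add: norm_mult)
  qed
  have xV: "x + E *v (\<tau> *s V) = \<xi> + t *\<^sub>R n + (\<tau> * of_real (g t)) *s v" for \<tau>
    by (simp only: Esm EV x_def of_real_smult[symmetric] vector_smult_assoc)
  have V_core: "p (\<tau> *s V) < 1" if "norm \<tau> < 1" for \<tau>
  proof -
    have "norm (\<tau> * of_real (g t)) < g t" using that gt by (simp add: norm_mult)
    from g_disc[OF t this] show ?thesis by (simp add: p_1 xV)
  qed
  \<comment> \<open>The open unit disc in direction \<open>V\<close> lies in the domain, so every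
    rotation of \<open>V\<close> has gauge at most 1; otherwise shrinking it to gauge exactly 1
    would put it inside that disc.\<close>
  have V_le: "norm (V $ i) \<le> 1" for i
  proof (rule p_core, rule ccontr)
    fix \<omega> :: complex assume \<omega>: "norm \<omega> = 1" and "\<not> p (\<omega> *s V) \<le> 1"
    then have q: "p (\<omega> *s V) > 1" by simp
    define \<theta> where "\<theta> = 1 / p (\<omega> *s V)"
    have th: "0 < \<theta>" "\<theta> < 1" using q by (auto simp: \<theta>_def)
    have "p ((of_real \<theta> * \<omega>) *s V) < 1" using th \<omega> by (intro V_core) (simp add: norm_mult)
    moreover have "p ((of_real \<theta> * \<omega>) *s V) = \<theta> * p (\<omega> *s V)"
      using sublinearD(3)[OF p, of \<theta> "\<omega> *s V"] th by (simp flip: of_real_smult add: vector_smult_assoc)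
    ultimately show False using q by (simp add: \<theta>_def)
  qed
  \<comment> \<open>This uses that \<open>g t\<close> is a supremum: if the coordinate norms of
    \<open>V\<close> summed to \<sigma> < 1, the disc could be enlarged by a factor \<theta> > 1
    with \<open>\<theta> * \<sigma> < 1\<close>.\<close>
  have V_ge: "1 \<le> (\<Sum>i\<in>UNIV. norm (V $ i))"
  proof (rule ccontr)
    define \<sigma> where "\<sigma> = (\<Sum>i\<in>UNIV. norm (V $ i))"
    assume "\<not> 1 \<le> (\<Sum>i\<in>UNIV. norm (V $ i))"
    then have s1: "\<sigma> < 1" by (simp add: \<sigma>_def)
    have s0: "0 \<le> \<sigma>" by (simp add: \<sigma>_def sum_nonneg)
    define \<theta> where "\<theta> = 2 / (1 + \<sigma>)"
    have th: "1 < \<theta>" "\<theta> * \<sigma> < 1" using s0 s1 by (auto simp: \<theta>_def field_simps)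
    have "\<theta> * g t \<in> G t"
      unfolding G_def
    proof (intro CollectI conjI allI impI)
      show "0 \<le> \<theta> * g t" using th gt by simp
      fix \<tau> :: complex assume "norm \<tau> < \<theta> * g t"
      then have tau: "norm (\<tau> / of_real (g t)) \<le> \<theta>" using gt by (simp add: norm_divide field_simps)
      have "p ((\<tau> / of_real (g t)) *s V) \<le> (\<Sum>i\<in>UNIV. norm (((\<tau> / of_real (g t)) *s V) $ i))" by (rule p_le)
      also have "\<dots> = norm (\<tau> / of_real (g t)) * \<sigma>" by (simp add: \<sigma>_def norm_mult sum_distrib_left norm_divide)
      also have "\<dots> \<le> \<theta> * \<sigma>" using tau s0 by (intro mult_right_mono)
      also have "\<dots> < 1" by (rule th)
      finally have "x + E *v ((\<tau> / of_real (g t)) *s V) \<in> \<Omega>" by (simp only: p_1)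
      then show "\<xi> + t *\<^sub>R n + \<tau> *s v \<in> \<Omega>" using gt by (simp only: xV) simp
    qed
    then have "\<theta> * g t \<le> g t" by (rule g_upper)
    then show False using th gt by simp
  qed
  \<comment> \<open>This is the record property of \<open>t\<close>, expressed in the new
    coordinates at the relative height \<open>s\<close>.\<close>
  have V_disc: "p ((s - 1) *\<^sub>R N + \<tau> *s V) < 1" if s: "0 < s" "s \<le> 1" and \<tau>: "norm \<tau> < 1/2 * s powr (2/5)" for s \<tau>
  proof -
    have "norm (\<tau> * of_real (g t)) < 1/2 * s powr (2/5) * g t"
      using \<tau> gt mult_strict_right_mono[OF \<tau> gt] by (simp add: norm_mult)
    also have "\<dots> \<le> g (s * t)" by (rule rec[OF s])
    finally have "norm (\<tau> * of_real (g t)) < g (s * t)" .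
    moreover have "s * t \<le> a" using s t mult_left_le_one_le[of t s] by linarith
    ultimately have "\<xi> + (s * t) *\<^sub>R n + (\<tau> * of_real (g t)) *s v \<in> \<Omega>"
      using s t by (intro g_disc) auto
    moreover have "x + E *v ((s - 1) *\<^sub>R N + \<tau> *s V) = \<xi> + (s * t) *\<^sub>R n + (\<tau> * of_real (g t)) *s v"
    proof -
      have "x + E *v ((s - 1) *\<^sub>R N + \<tau> *s V) = x + E *v (\<tau> *s V) + (s - 1) *\<^sub>R (E *v N)"
        by (simp add: vec.add Esc)
      then show ?thesis by (simp add: xV EN algebra_simps)
    qed
    ultimately show ?thesis by (simp add: p_1)
  qed
  have lN: "cdot l N = 1" using t(1) by (simp only: l EN cdot_scaleR l0n) (simp add: scaleR_conv_of_real)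
  \<comment> \<open>Points of \<open>K\<close> have height at least \<open>m\<close>, whereas those
    with \<open>norm y < k\<close> have height at most \<open>t * (1 + d * k)\<close>.\<close>
  have escape: "x + E *v y \<notin> K" if "p y < 1" "norm y < real k" for y
  proof
    assume "x + E *v y \<in> K"
    then have "m \<le> Re (cdot l0 (x + E *v y - \<xi>))" by (rule m(2))
    also have "\<dots> = t * (1 + Re (cdot l y))" by (simp add: lx)
    also have "\<dots> \<le> t * (1 + d * real k)"
    proof (intro mult_left_mono add_left_mono)
      have "Re (cdot l y) \<le> norm l * norm y" using complex_Re_le_cmod norm_cdot_le order_trans by blast
      also have "\<dots> \<le> d * real k"
        using norm_le_CARD[of l 1] l_le that(2) by (intro mult_mono) (auto simp: d_def)
      finally show "Re (cdot l y) \<le> d * real k" .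
    qed (use t in auto)
    also have "\<dots> \<le> a * (1 + d * real k)" using t dk by (intro mult_right_mono) auto
    also have "\<dots> < m" by (rule a(4))
    finally show False by simp
  qed
  have "normalised_gauge k p N V l"
    unfolding normalised_gauge_def
    using p p_le p_core lN l_le N_le V_le V_ge l_half N_half V_disc by blast
  then show ?thesis using that E(1) p_1 escape by blast
qed

section \<open>Limits of rescaled domains\<close>

lemma normalised_gaugeD:
  assumes "normalised_gauge k p N V l"
  shows "sublinear p" "p y \<le> (\<Sum>i\<in>UNIV. norm (y $ i))"
    "(\<And>\<omega>. norm \<omega> = 1 \<Longrightarrow> p (\<omega> *s y) \<le> 1) \<Longrightarrow> norm (y $ i) \<le> 1"
    "cdot l N = 1"
    "norm (l $ i) \<le> 1" "norm (N $ i) \<le> 2" "norm (V $ i) \<le> 1" "1 \<le> (\<Sum>i\<in>UNIV. norm (V $ i))"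
    "p y < 1 \<Longrightarrow> -1 < Re (cdot l y)"
    "norm \<zeta> \<le> real k \<Longrightarrow> 1 / real k \<le> Re \<zeta> \<Longrightarrow> p ((\<zeta> - 1) *s N) < 1"
    "0 < s \<Longrightarrow> s \<le> 1 \<Longrightarrow> norm \<tau> < 1/2 * s powr (2/5) \<Longrightarrow> p ((s - 1) *\<^sub>R N + \<tau> *s V) < 1"
  using assms unfolding normalised_gauge_def by blast+

text \<open>Convergence of gauges is uniform on bounded sets, so the arguments may vary along the
  sequence.\<close>

lemma tendsto_gauge:
  fixes p :: "'a::real_normed_vector \<Rightarrow> real"
  assumes p: "sublinear p" "\<And>y. p y \<le> K * norm y" and lim: "gauge_tendsto P p"
    and y: "y \<longlonglongrightarrow> y0"
  shows "(\<lambda>n. P n (y n)) \<longlonglongrightarrow> p y0"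
proof -
  have "(\<lambda>n. P n (y n) - p (y n)) \<longlonglongrightarrow> 0"
  proof (rule tendstoI)
    fix e :: real assume "e > 0"
    have pos: "0 < norm y0 + 1" by (simp add: add_nonneg_pos)
    define e' where "e' = e / (norm y0 + 1)"
    have "e' > 0" using \<open>e > 0\<close> pos by (simp add: e'_def)
    then have 1: "\<forall>\<^sub>F n in sequentially. \<forall>y. \<bar>P n y - p y\<bar> \<le> e' * norm y"
      using lim by (simp add: gauge_tendsto_def)
    have 2: "\<forall>\<^sub>F n in sequentially. norm (y n) < norm y0 + 1"
      using tendsto_norm[OF y] by (rule order_tendstoD) simp
    from 1 2 show "\<forall>\<^sub>F n in sequentially. dist (P n (y n) - p (y n)) 0 < e"
    proof eventually_elim
      case (elim n)
      have "\<bar>P n (y n) - p (y n)\<bar> \<le> e' * norm (y n)" using elim by blast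
      also have "\<dots> < e' * (norm y0 + 1)" using elim \<open>e' > 0\<close> by simp
      also have "\<dots> = e" using pos by (simp add: e'_def)
      finally show ?case by simp
    qed
  qed
  moreover have "(\<lambda>n. p (y n)) \<longlonglongrightarrow> p y0"
    using continuous_on_sublinear[OF p, of UNIV] y
    by (simp add: continuous_on_eq_continuous_at isCont_tendsto_compose)
  ultimately show ?thesis using tendsto_add by fastforce
qed

lemma tendsto_cdot:
  assumes "l \<longlonglongrightarrow> l0" "y \<longlonglongrightarrow> y0"
  shows "(\<lambda>n. cdot (l n) (y n)) \<longlonglongrightarrow> cdot l0 y0"
  unfolding cdot_def
  by (intro tendsto_sum tendsto_mult tendsto_vec_nth assms)

lemma tendsto_smult:
  fixes y :: "nat \<Rightarrow> complex ^ 'd"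
  assumes "y \<longlonglongrightarrow> y0"
  shows "(\<lambda>n. c *s y n) \<longlonglongrightarrow> c *s y0"
  unfolding vector_scalar_mult_def
  by (intro tendsto_vec_lambda tendsto_mult tendsto_const tendsto_vec_nth assms)

text \<open>The normalisation bounds all data, so a subsequence converges. The bound on balanced
  subsets rules out complex lines in the limit; the limiting half-space, half-plane and discs
  satisfy the hypotheses of \<open>not_biholomorphic_to_ball\<close>.\<close>

lemma normalised_gauge_compact:
  fixes P :: "nat \<Rightarrow> complex ^ 'd \<Rightarrow> real"
  assumes P: "\<And>k. normalised_gauge (k + 2) (P k) (N k) (V k) (l k)"
  obtains s p where "strict_mono (s :: nat \<Rightarrow> nat)" "sublinear p"
    "\<And>y. p y \<le> real CARD('d) * norm y" "gauge_tendsto (P \<circ> s) p" "{y. p y < 1} \<in> XX"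
    "\<not> biholomorphic {y. p y < 1} (ball 0 1 :: (complex ^ 'd) set)"
proof -
  note n = normalised_gaugeD[OF P]
  define d where "d = real CARD('d)"
  have PK: "P k y \<le> d * norm y" for k y
    using n(2) sum_norm_le_CARD unfolding d_def by (rule order_trans)
  define X where "X = (cball 0 (2 * d) :: (complex ^ 'd) set) \<times> (cball 0 (2 * d) :: (complex ^ 'd) set) \<times> (cball 0 (2 * d) :: (complex ^ 'd) set)"
  have cX: "compact X" unfolding X_def by (intro compact_Times compact_cball)
  have inX: "\<forall>k. (N k, V k, l k) \<in> X"
  proof
    fix k
    have "norm (N k) \<le> d * 2" "norm (V k) \<le> d * 1" "norm (l k) \<le> d * 1"
      unfolding d_def by (rule norm_le_CARD, rule n)+
    moreover have "0 \<le> d" by (simp add: d_def)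
    ultimately show "(N k, V k, l k) \<in> X" by (simp add: X_def mult.commute)
  qed
  obtain x0 r where x0: "strict_mono (r :: nat \<Rightarrow> nat)" "((\<lambda>k. (N k, V k, l k)) \<circ> r) \<longlonglongrightarrow> x0"
    by (rule seq_compactE[OF compact_imp_seq_compact[OF cX] inX])
  have Pr: "sublinear ((P \<circ> r) k)" "(P \<circ> r) k y \<le> d * norm y" for k y
    using n(1) PK by simp_all
  obtain p s0 where s0: "strict_mono (s0 :: nat \<Rightarrow> nat)" and p: "sublinear p" "\<And>y. p y \<le> d * norm y"
    and conv: "gauge_tendsto ((P \<circ> r) \<circ> s0) p"
    using sublinear_sequence_compact[where P = "P \<circ> r", OF Pr] by blast
  define s where "s = r \<circ> s0"
  have s: "strict_mono s" unfolding s_def using x0(1) s0 by (rule strict_mono_o)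
  have conv: "gauge_tendsto (\<lambda>k. P (s k)) p" using conv by (simp add: s_def comp_def)
  obtain N0 V0 l0 where x0_eq: "x0 = (N0, V0, l0)" by (cases x0)
  have "(\<lambda>k. (N (s k), V (s k), l (s k))) \<longlonglongrightarrow> (N0, V0, l0)"
    using LIMSEQ_subseq_LIMSEQ[OF x0(2) s0] by (simp add: s_def comp_def x0_eq)
  note T = this
  have lN: "(\<lambda>k. N (s k)) \<longlonglongrightarrow> N0" and lV: "(\<lambda>k. V (s k)) \<longlonglongrightarrow> V0" and ll: "(\<lambda>k. l (s k)) \<longlonglongrightarrow> l0"
    using tendsto_fst[OF T] tendsto_fst[OF tendsto_snd[OF T]] tendsto_snd[OF tendsto_snd[OF T]]
    by simp_all
  note lim = tendsto_gauge[OF p conv]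
  define D where "D = {y. p y < 1}"
  have oD: "open D" and cD: "convex D" unfolding D_def by (rule open_sublevel[OF p], rule convex_sublevel[OF p])
  have "convex_domain D"
  proof -
    have "0 \<in> D" using sublinear_0[OF p(1)] by (simp add: D_def)
    then show ?thesis using oD cD by (auto simp: convex_domain_def)
  qed
  moreover have "\<not> contains_complex_line D"
  proof
    assume "contains_complex_line D"
    then obtain a w where w: "w \<noteq> 0" "\<And>\<zeta>. a + \<zeta> *s w \<in> D" by (auto simp: contains_complex_line_def)
    \<comment> \<open>The gauge is bounded along an entire complex line, and homogeneity forces it
      to vanish on the direction of that line.\<close>
    have zero: "p (\<zeta> *s w) \<le> 0" for \<zeta>
    proof (rule field_le_epsilon)
      fix e :: real assume "e > 0"
      define M where "M = (1 + p (- a)) / e"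
      have M: "M > 0" using \<open>e > 0\<close> sublinearD(1)[OF p(1), of "- a"] by (simp add: M_def add_pos_nonneg)
      have "M * p (\<zeta> *s w) = p ((of_real M * \<zeta>) *s w)"
        using sublinearD(3)[OF p(1), of M "\<zeta> *s w"] M by (simp flip: of_real_smult add: vector_smult_assoc)
      also have "\<dots> \<le> p (a + (of_real M * \<zeta>) *s w) + p (- a)"
        using sublinearD(2)[OF p(1), of "a + (of_real M * \<zeta>) *s w" "- a"] by simp
      also have "\<dots> \<le> 1 + p (- a)" using w(2)[of "of_real M * \<zeta>"] by (simp add: D_def)
      also have "\<dots> = M * e" using \<open>e > 0\<close> by (simp add: M_def)
      finally show "p (\<zeta> *s w) \<le> 0 + e" using M by simp
    qed
    obtain i where i: "w $ i \<noteq> 0" using w(1) by (auto simp: vec_eq_iff)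
    \<comment> \<open>The vector \<open>u\<close> has coordinate 2 at \<open>i\<close>, while
      \<open>p\<close> vanishes on all its rotations. A gauge of the sequence within
      \<open>1 / norm u\<close> of \<open>p\<close> is then at most 1 on these rotations, against
      the bound on balanced subsets.\<close>
    define u where "u = (2 / w $ i) *s w"
    have "norm u > 0" using i w(1) by (simp add: u_def norm_smult norm_divide)
    then have "0 < 1 / norm u" by simp
    then have "\<forall>\<^sub>F k in sequentially. \<forall>y. \<bar>P (s k) y - p y\<bar> \<le> 1 / norm u * norm y"
      using conv unfolding gauge_tendsto_def by blast
    then obtain k where k: "\<And>y. \<bar>P (s k) y - p y\<bar> \<le> 1 / norm u * norm y"
      by (auto simp: eventually_sequentially)
    have "norm (u $ i) \<le> 1"
    proof (rule n(3))
      fix \<omega> :: complex assume "norm \<omega> = 1"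
      have "p (\<omega> *s u) \<le> 0" using zero by (simp add: u_def vector_smult_assoc)
      then show "P (s k) (\<omega> *s u) \<le> 1"
        using k[of "\<omega> *s u"] \<open>norm \<omega> = 1\<close> \<open>norm u > 0\<close> by (simp add: norm_smult)
    qed
    then show False using i by (simp add: u_def)
  qed
  ultimately have DXX: "D \<in> XX" by (simp add: XX_def)
  have N1: "cdot l0 N0 = 1"
    using LIMSEQ_unique[OF tendsto_cdot[OF ll lN]] by (simp add: n(4))
  have V1: "1 \<le> (\<Sum>i\<in>UNIV. norm (V0 $ i))"
  proof (rule LIMSEQ_le_const)
    show "(\<lambda>k. \<Sum>i\<in>UNIV. norm (V (s k) $ i)) \<longlonglongrightarrow> (\<Sum>i\<in>UNIV. norm (V0 $ i))"
      by (intro tendsto_sum tendsto_norm tendsto_vec_nth lV)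
  qed (use n(8) in blast)
  then have "V0 \<noteq> 0" by auto
  \<comment> \<open>The limit gives only a weak inequality; it becomes strict by applying it to a
    slightly larger multiple of \<open>y\<close> that is still in \<open>D\<close>.\<close>
  have half: "-1 < Re (cdot l0 y)" if "y \<in> D" for y
  proof -
    have le: "-1 \<le> Re (cdot l0 y)" if "p y < 1" for y
    proof (rule tendsto_lowerbound)
      show "(\<lambda>k. Re (cdot (l (s k)) y)) \<longlonglongrightarrow> Re (cdot l0 y)"
        by (intro tendsto_Re tendsto_cdot ll tendsto_const)
      have "\<forall>\<^sub>F k in sequentially. P (s k) y < 1"
        using lim[OF tendsto_const[of y]] that by (rule order_tendstoD)
      then show "\<forall>\<^sub>F k in sequentially. -1 \<le> Re (cdot (l (s k)) y)"
        by eventually_elim (use n(9) less_imp_le in blast)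
    qed simp
    have py: "0 \<le> p y" "p y < 1" using that sublinearD(1)[OF p(1)] by (auto simp: D_def)
    define \<theta> where "\<theta> = 2 / (1 + p y)"
    have th: "1 < \<theta>" "\<theta> * p y < 1" using py by (auto simp: \<theta>_def field_simps)
    have "p (\<theta> *\<^sub>R y) < 1" using th sublinearD(3)[OF p(1), of \<theta> y] by simp
    from le[OF this] have "-1 \<le> \<theta> * Re (cdot l0 y)" by (simp add: cdot_scaleR)
    then have "- 1 / \<theta> \<le> Re (cdot l0 y)" using th by (simp add: field_simps)
    moreover have "-1 < - 1 / \<theta>" using th by simp
    ultimately show ?thesis by linarith
  qed
  \<comment> \<open>The sector conditions at successive stages exhaust the open half-plane; the
    limit makes the inequality weak.\<close>
  have plane: "p ((\<zeta> - 1) *s N0) \<le> 1" if "0 < Re \<zeta>" for \<zeta>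
  proof (rule tendsto_upperbound)
    show "(\<lambda>k. P (s k) ((\<zeta> - 1) *s N (s k))) \<longlonglongrightarrow> p ((\<zeta> - 1) *s N0)"
      by (intro lim tendsto_smult lN)
    obtain m :: nat where m: "norm \<zeta> + 1 / Re \<zeta> \<le> real m" using real_arch_simple by blast
    have "P (s k) ((\<zeta> - 1) *s N (s k)) \<le> 1" if "k \<ge> m" for k
    proof -
      have "k \<le> s k" using s by (rule seq_suble)
      then have mk: "real m \<le> real (s k + 2)" using that by simp
      have "0 < 1 / Re \<zeta>" using \<open>0 < Re \<zeta>\<close> by simp
      then have 1: "norm \<zeta> \<le> real (s k + 2)" using m mk by linarith
      have "1 / Re \<zeta> \<le> real (s k + 2)" using m mk norm_ge_zero[of \<zeta>] by linarith
      then have "1 / real (s k + 2) \<le> Re \<zeta>"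
        using \<open>0 < Re \<zeta>\<close> by (simp add: field_simps)
      then show ?thesis using n(10)[OF 1] by (simp add: less_imp_le)
    qed
    then show "\<forall>\<^sub>F k in sequentially. P (s k) ((\<zeta> - 1) *s N (s k)) \<le> 1"
      unfolding eventually_sequentially by blast
  qed simp
  have disc: "p ((t - 1) *\<^sub>R N0 + \<tau> *s V0) \<le> 1" if "0 < t" "t \<le> 1" "norm \<tau> < 1/2 * t powr (2/5)" for t \<tau>
  proof (rule LIMSEQ_le_const2)
    show "(\<lambda>k. P (s k) ((t - 1) *\<^sub>R N (s k) + \<tau> *s V (s k))) \<longlonglongrightarrow> p ((t - 1) *\<^sub>R N0 + \<tau> *s V0)"
      by (intro lim tendsto_add tendsto_smult tendsto_scaleR tendsto_const lN lV)
    show "\<exists>m. \<forall>k\<ge>m. P (s k) ((t - 1) *\<^sub>R N (s k) + \<tau> *s V (s k)) \<le> 1"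
      using n(11)[OF that] less_imp_le by blast
  qed
  \<comment> \<open>Rescaling the points with \<open>Re \<zeta> = 1\<close> shows that imaginary
    multiples of \<open>N0\<close> are recession directions of \<open>D\<close>.\<close>
  have line: "p ((\<i> * of_real b) *s N0) \<le> 0" for b
  proof (rule field_le_epsilon)
    fix e :: real assume "e > 0"
    have "p ((1 + \<i> * of_real (b / e) - 1) *s N0) \<le> 1" by (rule plane) simp
    then have "e * p ((\<i> * of_real (b / e)) *s N0) \<le> e" using \<open>e > 0\<close> by simp
    moreover have "e * p ((\<i> * of_real (b / e)) *s N0) = p (e *\<^sub>R ((\<i> * of_real (b / e)) *s N0))"
      using sublinearD(3)[OF p(1), of e] \<open>e > 0\<close> by simp
    moreover have "e *\<^sub>R ((\<i> * of_real (b / e)) *s N0) = (\<i> * of_real b) *s N0"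
      using \<open>e > 0\<close> by (simp flip: of_real_smult add: vector_smult_assoc)
    ultimately show "p ((\<i> * of_real b) *s N0) \<le> 0 + e" by simp
  qed
  \<comment> \<open>Letting the height tend to 0 in \<open>plane\<close> gives
    \<open>p (- N0) \<le> 1\<close>, and homogeneity gives the rest.\<close>
  have seg: "p ((t - 1) *\<^sub>R N0) \<le> 1 - t" if "0 < t" "t \<le> 1" for t
  proof -
    have "p (- N0) \<le> 1"
    proof (rule tendsto_upperbound)
      show "((\<lambda>t. (1 - t) * p (- N0)) \<longlongrightarrow> p (- N0)) (at_right 0)"
        by (auto intro!: tendsto_eq_intros)
      have "(1 - t) * p (- N0) \<le> 1" if "0 < t" "t < 1" for t
      proof -
        have "(1 - t) * p (- N0) = p ((1 - t) *\<^sub>R (- N0))"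
          by (rule sublinearD(3)[OF p(1), symmetric]) (use that in simp)
        also have "(1 - t) *\<^sub>R (- N0) = (of_real t - 1) *s N0"
          by (simp flip: of_real_smult add: vec_eq_iff algebra_simps)
        also have "p \<dots> \<le> 1" using that by (intro plane) simp
        finally show ?thesis .
      qed
      then show "\<forall>\<^sub>F t in at_right 0. (1 - t) * p (- N0) \<le> 1"
        by (intro eventually_at_right_field[THEN iffD2]) (auto intro!: exI[of _ 1])
    qed simp
    then have "(1 - t) * p (- N0) \<le> (1 - t) * 1" using that by (intro mult_left_mono) auto
    moreover have eq: "(t - 1) *\<^sub>R N0 = (1 - t) *\<^sub>R (- N0)" by (simp add: algebra_simps)
    have "p ((t - 1) *\<^sub>R N0) = (1 - t) * p (- N0)"
      unfolding eq by (rule sublinearD(3)[OF p(1)]) (use that in simp)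
    ultimately show ?thesis by simp
  qed
  have "\<not> biholomorphic D (ball 0 1 :: (complex ^ 'd) set)"
  proof
    assume "biholomorphic D (ball 0 1 :: (complex ^ 'd) set)"
    then obtain F where "biholomorphism F D (ball 0 1 :: (complex ^ 'd) set)" by (auto simp: biholomorphic_def)
    then show False
    \<comment> \<open>Here 2/5 = 1/2 - 1/10. The radius constant drops from 1/2 to 1/4 because of
      the averaging below.\<close>
    proof (rule not_biholomorphic_to_ball[OF _ oD half N1 \<open>V0 \<noteq> 0\<close>, of F "1/4" "1/10"])
      fix \<zeta> \<tau> :: complex assume z: "0 < Re \<zeta>" "Re \<zeta> \<le> 1" and "norm \<tau> < 1/4 * Re \<zeta> powr (1/2 - 1/10)"
      then have tau: "norm (2 * \<tau>) < 1/2 * Re \<zeta> powr (2/5)" by (simp add: norm_mult)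
      define a where "a = (Re \<zeta> - 1) *\<^sub>R N0"
      have h: "p ((1/2) *\<^sub>R y) = 1/2 * p y" for y by (rule sublinearD(3)[OF p(1)]) simp
      \<comment> \<open>The disc estimate at the real height \<open>Re \<zeta>\<close> is only weak.
        Averaging with the center of the disc, where \<open>seg\<close> is better than 1, makes it
        strict, and the imaginary translation costs nothing.\<close>
      have "(\<zeta> - 1) *s N0 + \<tau> *s V0 = (\<i> * of_real (Im \<zeta>)) *s N0 + ((1/2) *\<^sub>R (a + (2 * \<tau>) *s V0) + (1/2) *\<^sub>R a)"
        by (simp add: a_def vec_eq_iff complex_eq_iff field_simps)
      also have "p \<dots> \<le> p ((\<i> * of_real (Im \<zeta>)) *s N0) + (p ((1/2) *\<^sub>R (a + (2 * \<tau>) *s V0)) + p ((1/2) *\<^sub>R a))"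
        by (intro order_trans[OF sublinearD(2)[OF p(1)]] add_left_mono sublinearD(2)[OF p(1)])
      also have "\<dots> \<le> 0 + (1/2 * 1 + 1/2 * (1 - Re \<zeta>))"
        unfolding h a_def by (intro add_mono mult_left_mono line disc[OF z tau] seg[OF z]) simp_all
      also have "\<dots> < 1" using z by (simp add: field_simps)
      finally show "(\<zeta> - 1) *s N0 + \<tau> *s V0 \<in> D" by (simp add: D_def)
    qed simp_all
  qed
  then show ?thesis using that[OF s p(1) p(2)[unfolded d_def]] conv DXX by (simp add: comp_def D_def)
qed

section \<open>Affine invariance and the contradiction\<close>

lemma bounded_convex_domain_in_XX:
  assumes "bounded \<Omega>" "convex_domain \<Omega>"
  shows "\<Omega> \<in> XX"
proof -
  have "\<not> contains_complex_line \<Omega>"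
  proof
    assume "contains_complex_line \<Omega>"
    then obtain a v where v: "v \<noteq> 0" "\<And>\<zeta>. a + \<zeta> *s v \<in> \<Omega>" by (auto simp: contains_complex_line_def)
    obtain R where R: "\<And>y. y \<in> \<Omega> \<Longrightarrow> norm y \<le> R" using assms(1) by (auto simp: bounded_iff)
    define c where "c = (\<bar>R\<bar> + norm a + 1) / norm v"
    have "norm (of_real c *s v) \<le> R + norm a"
      using R[OF v(2)[of "of_real c"]] norm_triangle_ineq4[of "a + of_real c *s v" a] by simp
    moreover have "norm (of_real c *s v) = \<bar>R\<bar> + norm a + 1"
      using v(1) by (simp only: of_real_smult norm_scaleR) (simp add: c_def)
    ultimately show False by linarith
  qed
  then show ?thesis using assms(2) by (simp add: XX_def)
qed

lemma biholomorphism_affine: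
  fixes E :: "complex ^ 'd ^ 'd"
  assumes "det E \<noteq> 0" "open \<Omega>"
  shows "biholomorphism (\<lambda>y. x + E *v y) {y. x + E *v y \<in> \<Omega>} \<Omega>"
proof -
  obtain B where B: "E ** B = mat 1" "B ** E = mat 1"
    using assms(1) invertible_det_nz[of E] by (auto simp: invertible_def)
  have EB: "E *v (B *v y) = y" "B *v (E *v y) = y" for y by (simp_all add: matrix_vector_mul_assoc B)
  define U where "U = {y. x + E *v y \<in> \<Omega>}"
  have lin: "bounded_linear (\<lambda>v. A *v v)" for A :: "complex ^ 'd ^ 'd"
    unfolding linear_conv_bounded_linear[symmetric]
    by (rule linearI) (simp_all add: vec.add vec.scale flip: of_real_smult)
  have inj: "inj_on (\<lambda>y. x + E *v y) U"
    by (rule inj_onI) (metis EB(2) add_left_cancel)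
  have img: "(\<lambda>y. x + E *v y) ` U = \<Omega>"
    by (auto simp: U_def image_iff EB intro!: exI[of _ "B *v (_ - x)"])
  have inv: "the_inv_into U (\<lambda>y. x + E *v y) z = B *v (z - x)" if "z \<in> \<Omega>" for z
    by (rule the_inv_into_f_eq[OF inj]) (use that in \<open>simp_all add: U_def EB\<close>)
  have "holomorphic_map_on (\<lambda>y. x + E *v y) U"
    unfolding holomorphic_map_on_def
  proof (intro ballI exI)
    fix z
    show "((\<lambda>y. x + E *v y) has_derivative (\<lambda>v. E *v v)) (at z)"
      using has_derivative_add[OF has_derivative_const[of x] bounded_linear_imp_has_derivative[OF lin[of E]]] by simp
  qed
  moreover have "holomorphic_map_on (the_inv_into U (\<lambda>y. x + E *v y)) \<Omega>"
    unfolding holomorphic_map_on_def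
  proof (intro ballI exI)
    fix z assume "z \<in> \<Omega>"
    have "((\<lambda>z. z - x) has_derivative (\<lambda>v. v)) (at z)"
      using has_derivative_diff[OF has_derivative_ident has_derivative_const[of x]] by simp
    from bounded_linear.has_derivative[OF lin[of B] this]
    have "((\<lambda>z. B *v (z - x)) has_derivative (\<lambda>v. B *v v)) (at z)" .
    then show "(the_inv_into U (\<lambda>y. x + E *v y) has_derivative (\<lambda>v. B *v v)) (at z)"
      by (rule has_derivative_transform_within_open[OF _ assms(2) \<open>z \<in> \<Omega>\<close>]) (simp add: inv)
  qed
  ultimately show ?thesis unfolding biholomorphism_def bij_betw_def U_def[symmetric] using inj img by blast
qed

lemma affine_preimage_in_XX:
  fixes E :: "complex ^ 'd ^ 'd"
  assumes "det E \<noteq> 0" "\<Omega> \<in> XX" and cd: "convex_domain {y. x + E *v y \<in> \<Omega>}"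
  shows "{y. x + E *v y \<in> \<Omega>} \<in> XX"
proof -
  obtain B where B: "B ** E = mat 1"
    using assms(1) invertible_det_nz[of E] by (auto simp: invertible_def)
  have "\<not> contains_complex_line {y. x + E *v y \<in> \<Omega>}"
  proof
    assume "contains_complex_line {y. x + E *v y \<in> \<Omega>}"
    then obtain a v where v: "v \<noteq> 0" "\<And>\<zeta>. x + E *v (a + \<zeta> *s v) \<in> \<Omega>"
      by (auto simp: contains_complex_line_def)
    have "E *v v \<noteq> 0"
    proof
      assume "E *v v = 0"
      then have "B *v (E *v v) = 0" by simp
      then show False using v(1) by (simp add: matrix_vector_mul_assoc B)
    qed
    moreover have "(x + E *v a) + \<zeta> *s (E *v v) \<in> \<Omega>" for \<zeta>
      using v(2)[of \<zeta>] by (simp add: vec.add vec.scale add.assoc)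
    ultimately have "contains_complex_line \<Omega>" unfolding contains_complex_line_def by blast
    then show False using assms(2) by (simp add: XX_def)
  qed
  then show ?thesis using cd by (simp add: XX_def)
qed

theorem theorem1p15:
  fixes f :: "(complex ^ 'd) set \<times> (complex ^ 'd) \<Rightarrow> real"
  assumes "upper_semicontinuous_XX0 f"
    and "intrinsic f"
    and "\<And>\<Omega>. \<Omega> \<in> XX \<Longrightarrow> (\<forall>x\<in>\<Omega>. f (\<Omega>, x) \<ge> f (ball 0 1, 0)) \<Longrightarrow>
           biholomorphic \<Omega> (ball 0 1 :: (complex ^ 'd) set)"
  shows "\<exists>\<epsilon>>0. \<forall>\<Omega>. bounded \<Omega> \<and> convex_domain \<Omega> \<and> smooth_boundary \<Omega> \<and>
           (\<exists>K. compact K \<and> K \<subseteq> \<Omega> \<and> (\<forall>z\<in>\<Omega> - K. f (\<Omega>, z) \<ge> f (ball 0 1, 0) - \<epsilon>)) \<longrightarrow>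
           strongly_pseudoconvex \<Omega>"
proof (rule ccontr)
  assume neg: "\<not> ?thesis"
  define f0 where "f0 = f (ball 0 1, 0)"
  \<comment> \<open>The negated conclusion is used for the values 1/(k+1) of \<epsilon>.\<close>
  have ex: "\<exists>\<Omega> K. bounded \<Omega> \<and> convex_domain \<Omega> \<and> smooth_boundary \<Omega> \<and> compact K \<and> K \<subseteq> \<Omega> \<and>
      (\<forall>z\<in>\<Omega> - K. f (\<Omega>, z) \<ge> f0 - 1 / real (Suc k)) \<and> \<not> strongly_pseudoconvex \<Omega>" for k
  proof -
    have "1 / real (Suc k) > 0" by simp
    then show ?thesis using neg unfolding f0_def by blast
  qed
  \<comment> \<open>The index is shifted by 2 because \<open>normalisation\<close> requires at least
    2. The points that avoid \<open>K\<close> inherit the lower bound on \<open>f\<close>.\<close>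
  have "\<exists>\<Omega> E x p N V l. convex_domain \<Omega> \<and> bounded \<Omega> \<and> normalised_gauge (k + 2) p N V l \<and>
      det (E :: complex ^ 'd ^ 'd) \<noteq> 0 \<and> (\<forall>y. p y < 1 \<longleftrightarrow> x + E *v y \<in> \<Omega>) \<and>
      (\<forall>y. p y < 1 \<longrightarrow> norm y < real (k + 2) \<longrightarrow> f0 - 1 / real (Suc k) \<le> f (\<Omega>, x + E *v y))" for k
  proof -
    obtain \<Omega> K where O: "bounded \<Omega>" "convex_domain \<Omega>" "smooth_boundary \<Omega>" "compact K" "K \<subseteq> \<Omega>"
      "\<And>z. z \<in> \<Omega> - K \<Longrightarrow> f (\<Omega>, z) \<ge> f0 - 1 / real (Suc k)" "\<not> strongly_pseudoconvex \<Omega>"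
      using ex[of k] by blast
    obtain E x p N V l where "normalised_gauge (k + 2) p N V l" "det (E :: complex ^ 'd ^ 'd) \<noteq> 0"
      "\<And>y. p y < 1 \<longleftrightarrow> x + E *v y \<in> \<Omega>"
      "\<And>y. p y < 1 \<Longrightarrow> norm y < real (k + 2) \<Longrightarrow> x + E *v y \<notin> K"
      by (rule normalisation[OF O(1-3,7,4,5), of "k + 2"]) simp_all
    then show ?thesis using O by blast
  qed
  then obtain \<Omega> E x P N V l where dom: "\<And>k. convex_domain (\<Omega> k)" "\<And>k. bounded (\<Omega> k)"
    and nrm: "\<And>k. normalised_gauge (k + 2) (P k) (N k) (V k) (l k)"
    and E: "\<And>k. det (E k :: complex ^ 'd ^ 'd) \<noteq> 0"
    and P: "\<And>k y. P k y < 1 \<longleftrightarrow> x k + E k *v y \<in> \<Omega> k"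
    and fl: "\<And>k y. P k y < 1 \<Longrightarrow> norm y < real (k + 2) \<Longrightarrow> f0 - 1 / real (Suc k) \<le> f (\<Omega> k, x k + E k *v y)"
    by metis
  obtain s p where s: "strict_mono (s :: nat \<Rightarrow> nat)" and p: "sublinear p"
    "\<And>y. p y \<le> real CARD('d) * norm y" and conv: "gauge_tendsto (P \<circ> s) p" and D: "{y. p y < 1} \<in> XX"
    and nb: "\<not> biholomorphic {y. p y < 1} (ball 0 1 :: (complex ^ 'd) set)"
    using normalised_gauge_compact[OF nrm] by metis
  have Pn: "sublinear (P k)" "P k y \<le> real CARD('d) * norm y" for k y
    using normalised_gaugeD(1,2)[OF nrm, of k] sum_norm_le_CARD[of y] order_trans by blast+
  have U_eq: "{y. P k y < 1} = {y. x k + E k *v y \<in> \<Omega> k}" for k by (simp add: P)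
  have U: "{y. P k y < 1} \<in> XX" for k
  proof -
    have "convex_domain {y. P k y < 1}"
      unfolding convex_domain_def using open_sublevel[OF Pn] convex_sublevel[OF Pn] sublinear_0[OF Pn(1)]
      by (metis (mono_tags, lifting) empty_iff mem_Collect_eq zero_less_one)
    then show ?thesis
      unfolding U_eq by (intro affine_preimage_in_XX E bounded_convex_domain_in_XX dom)
  qed
  \<comment> \<open>Intrinsicness transfers the lower bound from the original domain to the rescaled
    one through the affine change of coordinates.\<close>
  have fU: "f ({y. P k y < 1}, y) = f (\<Omega> k, x k + E k *v y)" if "P k y < 1" for k y
  proof -
    have "biholomorphism (\<lambda>y. x k + E k *v y) {y. P k y < 1} (\<Omega> k)"
      unfolding U_eq using dom(1) by (intro biholomorphism_affine E) (simp add: convex_domain_def)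
    moreover have "(\<Omega> k, x k + E k *v y) \<in> XX0"
      using bounded_convex_domain_in_XX[OF dom(2,1)] that P by (simp add: XX0_def)
    moreover have "({y. P k y < 1}, y) \<in> XX0" using U that by (simp add: XX0_def)
    ultimately show ?thesis using \<open>intrinsic f\<close> unfolding intrinsic_def by blast
  qed
  have "f0 \<le> f ({y. p y < 1}, y)" if y: "p y < 1" for y
  proof -
    have "(\<lambda>k. (P \<circ> s) k y) \<longlonglongrightarrow> p y" by (rule tendsto_gauge[OF p conv tendsto_const])
    then have 1: "\<forall>\<^sub>F k in sequentially. (P \<circ> s) k y < 1" using y by (rule order_tendstoD)
    obtain m :: nat where m: "norm y < real m" using reals_Archimedean2 by blast
    obtain n0 where n0: "\<And>k. k \<ge> n0 \<Longrightarrow> P (s k) y < 1" using 1 by (auto simp: eventually_sequentially)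
    \<comment> \<open>Semicontinuity needs every term of the sequence in \<open>XX0\<close>: the
      shift by \<open>n0\<close> puts \<open>y\<close> in each domain, and the shift by
      \<open>m\<close> puts it in the ball on which the lower bound holds.\<close>
    define r where "r = (\<lambda>k. s (k + (n0 + m)))"
    have r1: "P (r k) y < 1" for k using n0 by (simp add: r_def)
    have rk: "k + m \<le> r k" for k using seq_suble[OF s, of "k + (n0 + m)"] by (simp add: r_def)
    have low: "f0 - 1 / real (Suc k) \<le> f ({y. P (r k) y < 1}, y)" for k
    proof -
      have "norm y < real (r k + 2)" using m rk[of k] by linarith
      from fl[OF r1 this] have "f0 - 1 / real (Suc (r k)) \<le> f ({y. P (r k) y < 1}, y)"
        by (simp only: fU[OF r1])
      moreover have "1 / real (Suc (r k)) \<le> 1 / real (Suc k)"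
        using rk[of k] by (intro divide_left_mono) auto
      ultimately show ?thesis by linarith
    qed
    define Sq where "Sq = (\<lambda>k. ({y. P (r k) y < 1}, y))"
    have "gauge_tendsto (\<lambda>k. P (r k)) p"
      unfolding gauge_tendsto_def
    proof (intro allI impI)
      fix e :: real assume "e > 0"
      then have "\<forall>\<^sub>F k in sequentially. \<forall>y. \<bar>(P \<circ> s) k y - p y\<bar> \<le> e * norm y"
        using conv by (simp only: gauge_tendsto_def)
      from sequentially_offset[OF this, of "n0 + m"]
      show "\<forall>\<^sub>F k in sequentially. \<forall>y. \<bar>P (r k) y - p y\<bar> \<le> e * norm y" by (simp add: r_def)
    qed
    from gauge_tendsto_imp_local_hausdorff_tendsto[OF Pn p this]
    have "XX0_tendsto Sq ({y. p y < 1}, y)" by (simp add: XX0_tendsto_def Sq_def)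
    moreover have "range Sq \<subseteq> XX0" using U r1 by (auto simp: Sq_def XX0_def)
    moreover have "({y. p y < 1}, y) \<in> XX0" using D y by (simp add: XX0_def)
    ultimately have "limsup (\<lambda>k. ereal (f (Sq k))) \<le> ereal (f ({y. p y < 1}, y))"
      using assms(1) unfolding upper_semicontinuous_XX0_def by blast
    \<comment> \<open>The lower bounds tend to \<open>f0\<close>, so the limit superior is at least
      \<open>f0\<close>; upper semicontinuity passes this to the limit domain.\<close>
    moreover have "ereal f0 \<le> limsup (\<lambda>k. ereal (f (Sq k)))"
    proof -
      have "(\<lambda>k. f0 - 1 / real (Suc k)) \<longlonglongrightarrow> f0 - 0"
        by (intro tendsto_diff tendsto_const lim_1_over_n[THEN LIMSEQ_Suc])
      then have "(\<lambda>k. ereal (f0 - 1 / real (Suc k))) \<longlonglongrightarrow> ereal f0" by simp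
      then have "limsup (\<lambda>k. ereal (f0 - 1 / real (Suc k))) = ereal f0"
        by (rule lim_imp_Limsup[rotated]) simp
      moreover have "limsup (\<lambda>k. ereal (f0 - 1 / real (Suc k))) \<le> limsup (\<lambda>k. ereal (f (Sq k)))"
        by (rule Limsup_mono) (use low in \<open>simp add: Sq_def\<close>)
      ultimately show ?thesis by simp
    qed
    ultimately show ?thesis by (metis ereal_less_eq(3) order_trans)
  qed
  then have "biholomorphic {y. p y < 1} (ball 0 1 :: (complex ^ 'd) set)"
    using assms(3)[OF D] by (simp add: f0_def)
  then show False using nb by contradiction
qed

end
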